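(* Let $(M,g,\nabla)$ be a Lauritzen manifold, let $\nabla_0$ be an affine connection on $M$, and let $P^{\nabla,\nabla_0}$ be the $\nabla$-parallel transport along $\nabla_0$-geodesics, defined on a strongly $\nabla_0$-convex neighbourhood $\mathscr U_0$ of the diagonal $\Delta_M$ in $M\times M$. Then the assignment $$\varpi^{\nabla,\nabla_0}(X\mid Y)(m,n)=g_n\left(P^{\nabla,\nabla_0}_{(m,n)}X_m,Y_n\right),\qquad X,Y\in\mathfrak X(M),\ (m,n)\in\mathscr U_0,$$ defines an integrating bi-form for $(M,g,\nabla)$ on $\mathscr U_0$; that is, $\varpi^{\nabla,\nabla_0}$ is a contrast bi-form on $\mathscr U_0$ with $g^{\varpi^{\nabla,\nabla_0}}=g$ and $\nabla^{\varpi^{\nabla,\nabla_0}}=\nabla$.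
   Context: A Lauritzen (metric-affine) manifold $(M,g,\nabla)$ is a smooth manifold $M$ with a pseudo-Riemannian metric $g$ and an arbitrary affine connection $\nabla$ (no torsion or curvature assumption). $\Delta_M\subset M\times M$ is the diagonal and $\iota\colon M\to M\times M$, $\iota(m)=(m,m)$. Bi-forms. Let $\pi_L,\pi_R\colon M\times M\to M$ be the left and right projections. A (local) $(1,1)$-bi-form is a smooth section, over an open neighbourhood of $\Delta_M$ in $M\times M$, of $\pi_L^*T^*M\otimes\pi_R^*T^*M$, i.e. a bilinear pairing $\varpi_{(m,n)}\colon T_mM\times T_nM\to\mathbb R$ depending smoothly on $(m,n)$. For vector fields $X,Y$ write $\varpi(X\mid Y)(m,n)=\varpi_{(m,n)}(X_m\mid Y_n)$. For $Z\in\mathfrak X(M)$, $Z^L$ is the left lift to $M\times M$, $Z^L_{(m,n)}=(Z_m,0)$. A local $(1,1)$-bi-form $\varpi$ is a contrast bi-form if $g^\varpi(X,Y)=\iota^*(\varpi(X\mid Y))$ is a pseudo-Riemannian metric; it then induces an affine connection $\nabla^\varpi$ by $g^\varpi(\nabla^\varpi_ZX,Y)=\iota^*\left(\mathcal L_{Z^L}(\varpi(X\mid Y))\right)$ for all $X,Y,Z\in\mathfrak X(M)$. Strong convexity. Geodesic segments are affinely parametrized on $[0,1]$. An open set $C\subseteq M$ is $\nabla_0$-convex if for any $m,n\in C$ there is a unique $\nabla_0$-geodesic segment within $C$ joining $m$ to $n$; the associated interpolation map $C\times C\times[0,1]\to C$ is smooth. An open covering $\mathcal C$ of $M$ is strongly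 $\nabla_0$-convex if each $C\in\mathcal C$ is $\nabla_0$-convex and each intersection $C\cap C'$ with $C,C'\in\mathcal C$ is empty or $\nabla_0$-convex. A strongly $\nabla_0$-convex neighbourhood of $\Delta_M$ is a set $\mathscr U_0=\bigcup_{C\in\mathcal C}C\times C$ for such a covering. The interpolations of the sets $C$ glue to a smooth map $\Gamma_0\colon\mathscr U_0\times[0,1]\to M$, and for $(m,n)\in\mathscr U_0$ we write $\gamma^{(0)}_{n\leftarrow m}=\Gamma_0(m,n,\cdot)$ for the selected $\nabla_0$-geodesic segment from $m$ to $n$ (the one lying in any $C\in\mathcal C$ containing both $m$ and $n$). The $\nabla$-parallel transport along $\nabla_0$-geodesics: for $(m,n)\in\mathscr U_0$, $P^{\nabla,\nabla_0}_{(m,n)}\colon T_mM\to T_nM$ is the $\nabla$-parallel transport along $\gamma^{(0)}_{n\leftarrow m}$ from parameter $0$ to parameter $1$. *)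

theory Defs
  imports "HOL-Analysis.Analysis"
begin

section \<open>Smooth maps between Euclidean spaces\<close>

primrec differentiable_upto ::
  "nat \<Rightarrow> 'a::real_normed_vector set \<Rightarrow> ('a \<Rightarrow> 'b::real_normed_vector) \<Rightarrow> bool" where
  "differentiable_upto 0 S f \<longleftrightarrow> continuous_on S f"
| "differentiable_upto (Suc k) S f \<longleftrightarrow>
     (\<forall>x\<in>S. f differentiable (at x)) \<and>
     (\<forall>v. differentiable_upto k S (\<lambda>x. frechet_derivative f (at x) v))"

text \<open>Smoothness on an open set.\<close>

definition smooth_open ::
  "'a::real_normed_vector set \<Rightarrow> ('a \<Rightarrow> 'b::real_normed_vector) \<Rightarrow> bool" where
  "smooth_open S f \<longleftrightarrow> (\<forall>k. differentiable_upto k S f)"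

text \<open>Smoothness on an arbitrary set means existence of local smooth extensions; this is what is
  needed for curves on \<open>[0,1]\<close> and for maps on \<open>C \<times> C \<times> [0,1]\<close>.\<close>

definition smooth_within ::
  "'a::real_normed_vector set \<Rightarrow> ('a \<Rightarrow> 'b::real_normed_vector) \<Rightarrow> bool" where
  "smooth_within S f \<longleftrightarrow>
     (\<forall>x\<in>S. \<exists>U h. open U \<and> x \<in> U \<and> smooth_open U h \<and> (\<forall>y\<in>U \<inter> S. h y = f y))"


section \<open>Smooth manifolds\<close>

text \<open>The underlying space is a whole type. A chart \<open>(U, \<phi>)\<close> consists of its domain and its
  coordinate map; the values of \<open>\<phi>\<close> outside \<open>U\<close> are irrelevant.\<close>

type_synonym ('m, 'e) chart = "'m set \<times> ('m \<Rightarrow> 'e)"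

abbreviation cdom :: "('m, 'e) chart \<Rightarrow> 'm set" where
  "cdom c \<equiv> fst c"

abbreviation coord :: "('m, 'e) chart \<Rightarrow> 'm \<Rightarrow> 'e" where
  "coord c \<equiv> snd c"

abbreviation param :: "('m, 'e) chart \<Rightarrow> 'e \<Rightarrow> 'm" where
  "param c \<equiv> inv_into (cdom c) (coord c)"

definition smooth_atlas ::
  "('m::topological_space, 'e::euclidean_space) chart set \<Rightarrow> bool" where
  "smooth_atlas A \<longleftrightarrow>
     (\<forall>c\<in>A. open (cdom c) \<and> open (coord c ` cdom c) \<and>
        homeomorphism (cdom c) (coord c ` cdom c) (coord c) (param c)) \<and>
     (\<Union>c\<in>A. cdom c) = UNIV \<and>
     (\<forall>c\<in>A. \<forall>d\<in>A. smooth_open (coord c ` (cdom c \<inter> cdom d)) (coord d \<circ> param c))"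

definition std_atlas :: "('e::euclidean_space, 'e) chart set" where
  "std_atlas = {(UNIV, \<lambda>x. x)}"

definition prod_atlas ::
  "('m, 'e) chart set \<Rightarrow> ('n, 'f) chart set \<Rightarrow> ('m \<times> 'n, 'e \<times> 'f) chart set" where
  "prod_atlas A B = {(cdom c \<times> cdom d, map_prod (coord c) (coord d)) | c d. c \<in> A \<and> d \<in> B}"

text \<open>Smoothness of a map \<open>f\<close> on a subset \<open>S\<close> of a manifold with atlas \<open>A\<close>, with values in a
  manifold with atlas \<open>B\<close>.\<close>

definition smooth_map ::
  "('m::topological_space, 'e::euclidean_space) chart set \<Rightarrow>
   ('n::topological_space, 'f::euclidean_space) chart set \<Rightarrow> 'm set \<Rightarrow> ('m \<Rightarrow> 'n) \<Rightarrow> bool" where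
  "smooth_map A B S f \<longleftrightarrow> continuous_on S f \<and>
     (\<forall>c\<in>A. \<forall>d\<in>B. smooth_within (coord c ` (S \<inter> cdom c \<inter> f -` cdom d)) (coord d \<circ> f \<circ> param c))"


section \<open>Tangent vectors and vector fields\<close>

text \<open>A tangent vector is the family of its components in all charts of the atlas around the base
  point, the components in different charts being related by the derivative of the transition
  map. In charts that do not contain the base point the value is \<open>0\<close>.\<close>

type_synonym ('m, 'e) tvec = "('m, 'e) chart \<Rightarrow> 'e"
type_synonym ('m, 'e) vfield = "'m \<Rightarrow> ('m, 'e) tvec"

text \<open>The tangent vector at \<open>m\<close> whose component in the chart \<open>c\<close> is \<open>u\<close>.\<close>

definition coord_vec ::
  "('m, 'e::euclidean_space) chart set \<Rightarrow> ('m, 'e) chart \<Rightarrow> 'm \<Rightarrow> 'e \<Rightarrow> ('m, 'e) tvec" where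
  "coord_vec A c m u = (\<lambda>d. if d \<in> A \<and> m \<in> cdom d
     then frechet_derivative (coord d \<circ> param c) (at (coord c m)) u else 0)"

definition tangent_space ::
  "('m, 'e::euclidean_space) chart set \<Rightarrow> 'm \<Rightarrow> ('m, 'e) tvec set" where
  "tangent_space A m = {v. \<forall>c\<in>A. m \<in> cdom c \<longrightarrow> v = coord_vec A c m (v c)}"

definition tzero :: "('m, 'e::real_vector) tvec" where
  "tzero = (\<lambda>c. 0)"

definition tadd :: "('m, 'e::real_vector) tvec \<Rightarrow> ('m, 'e) tvec \<Rightarrow> ('m, 'e) tvec" where
  "tadd v w = (\<lambda>c. v c + w c)"

definition tscale :: "real \<Rightarrow> ('m, 'e::real_vector) tvec \<Rightarrow> ('m, 'e) tvec" where
  "tscale a v = (\<lambda>c. a *\<^sub>R v c)"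

definition vector_fields ::
  "('m::topological_space, 'e::euclidean_space) chart set \<Rightarrow> ('m, 'e) vfield set" where
  "vector_fields A = {X. (\<forall>m. X m \<in> tangent_space A m) \<and>
     (\<forall>c\<in>A. smooth_map A std_atlas (cdom c) (\<lambda>m. X m c))}"

text \<open>The derivative \<open>X f\<close> of a function along a vector field. It is computed in an arbitrary chart
  around the point.\<close>

definition lie_deriv ::
  "('m, 'e::euclidean_space) chart set \<Rightarrow> ('m, 'e) vfield \<Rightarrow> ('m \<Rightarrow> real) \<Rightarrow> 'm \<Rightarrow> real" where
  "lie_deriv A X f m =
     (let c = (SOME c. c \<in> A \<and> m \<in> cdom c)
      in frechet_derivative (f \<circ> param c) (at (coord c m)) (X m c))"


section \<open>Pseudo-Riemannian metrics and affine connections\<close>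

definition bilinear_form_on ::
  "('m, 'e::real_vector) tvec set \<Rightarrow> ('m, 'e) tvec set \<Rightarrow>
   (('m, 'e) tvec \<Rightarrow> ('m, 'e) tvec \<Rightarrow> real) \<Rightarrow> bool" where
  "bilinear_form_on V W b \<longleftrightarrow>
     (\<forall>v\<in>V. \<forall>v'\<in>V. \<forall>w\<in>W. b (tadd v v') w = b v w + b v' w) \<and>
     (\<forall>v\<in>V. \<forall>w\<in>W. \<forall>w'\<in>W. b v (tadd w w') = b v w + b v w') \<and>
     (\<forall>a. \<forall>v\<in>V. \<forall>w\<in>W. b (tscale a v) w = a * b v w \<and> b v (tscale a w) = a * b v w)"

definition pseudo_riemannian_metric ::
  "('m::topological_space, 'e::euclidean_space) chart set \<Rightarrow>
   ('m \<Rightarrow> ('m, 'e) tvec \<Rightarrow> ('m, 'e) tvec \<Rightarrow> real) \<Rightarrow> bool" where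
  "pseudo_riemannian_metric A g \<longleftrightarrow>
     (\<forall>m. bilinear_form_on (tangent_space A m) (tangent_space A m) (g m)) \<and>
     (\<forall>m. \<forall>v\<in>tangent_space A m. \<forall>w\<in>tangent_space A m. g m v w = g m w v) \<and>
     (\<forall>m. \<forall>v\<in>tangent_space A m. (\<forall>w\<in>tangent_space A m. g m v w = 0) \<longrightarrow> v = tzero) \<and>
     (\<forall>c\<in>A. \<forall>u w. smooth_map A std_atlas (cdom c)
        (\<lambda>m. g m (coord_vec A c m u) (coord_vec A c m w)))"

text \<open>In \<open>D X Y\<close>, that is \<open>\<nabla>\<^sub>X Y\<close>, the first argument is the direction.
  Only the values on smooth vector fields matter.\<close>

type_synonym ('m, 'e) connection = "('m, 'e) vfield \<Rightarrow> ('m, 'e) vfield \<Rightarrow> ('m, 'e) vfield"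

definition affine_connection ::
  "('m::topological_space, 'e::euclidean_space) chart set \<Rightarrow> ('m, 'e) connection \<Rightarrow> bool" where
  "affine_connection A D \<longleftrightarrow>
     (\<forall>X\<in>vector_fields A. \<forall>Y\<in>vector_fields A. D X Y \<in> vector_fields A) \<and>
     (\<forall>X\<in>vector_fields A. \<forall>X'\<in>vector_fields A. \<forall>Y\<in>vector_fields A.
        D (\<lambda>m. tadd (X m) (X' m)) Y = (\<lambda>m. tadd (D X Y m) (D X' Y m))) \<and>
     (\<forall>X\<in>vector_fields A. \<forall>Y\<in>vector_fields A. \<forall>Y'\<in>vector_fields A.
        D X (\<lambda>m. tadd (Y m) (Y' m)) = (\<lambda>m. tadd (D X Y m) (D X Y' m))) \<and>
     (\<forall>f. \<forall>X\<in>vector_fields A. \<forall>Y\<in>vector_fields A. smooth_map A std_atlas UNIV f \<longrightarrow>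
        D (\<lambda>m. tscale (f m) (X m)) Y = (\<lambda>m. tscale (f m) (D X Y m)) \<and>
        D X (\<lambda>m. tscale (f m) (Y m)) =
          (\<lambda>m. tadd (tscale (lie_deriv A X f m) (Y m)) (tscale (f m) (D X Y m))))"

definition lauritzen_manifold ::
  "('m::{t2_space, second_countable_topology}, 'e::euclidean_space) chart set \<Rightarrow>
   ('m \<Rightarrow> ('m, 'e) tvec \<Rightarrow> ('m, 'e) tvec \<Rightarrow> real) \<Rightarrow> ('m, 'e) connection \<Rightarrow> bool" where
  "lauritzen_manifold A g D \<longleftrightarrow>
     smooth_atlas A \<and> pseudo_riemannian_metric A g \<and> affine_connection A D"


section \<open>Covariant derivatives along curves\<close>

text \<open>The Christoffel symbols of a chart are read off from global vector fields which, near the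
  point in question, have constant components in that chart. Such fields exist on a Hausdorff
  manifold, and by locality of \<open>D\<close> the choice is irrelevant.\<close>

definition coord_field ::
  "('m::topological_space, 'e::euclidean_space) chart set \<Rightarrow> ('m, 'e) chart \<Rightarrow> 'm \<Rightarrow> 'e \<Rightarrow>
   ('m, 'e) vfield" where
  "coord_field A c m u = (SOME X. X \<in> vector_fields A \<and>
     (\<exists>N. open N \<and> m \<in> N \<and> N \<subseteq> cdom c \<and> (\<forall>p\<in>N. X p c = u)))"

definition christoffel ::
  "('m::topological_space, 'e::euclidean_space) chart set \<Rightarrow> ('m, 'e) connection \<Rightarrow>
   ('m, 'e) chart \<Rightarrow> 'm \<Rightarrow> 'e \<Rightarrow> 'e \<Rightarrow> 'e" where
  "christoffel A D c m u w = D (coord_field A c m u) (coord_field A c m w) m c"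

text \<open>Curves are parametrized by \<open>[0,1]\<close>; their values outside this interval are irrelevant, and
  derivatives at the end points are one-sided.\<close>

definition velocity ::
  "('m, 'e::euclidean_space) chart set \<Rightarrow> (real \<Rightarrow> 'm) \<Rightarrow> real \<Rightarrow> ('m, 'e) tvec" where
  "velocity A \<gamma> t = (\<lambda>c. if c \<in> A \<and> \<gamma> t \<in> cdom c
     then vector_derivative (coord c \<circ> \<gamma>) (at t within {0..1}) else 0)"

definition vector_fields_along ::
  "('m::topological_space, 'e::euclidean_space) chart set \<Rightarrow> (real \<Rightarrow> 'm) \<Rightarrow>
   (real \<Rightarrow> ('m, 'e) tvec) set" where
  "vector_fields_along A \<gamma> = {V. (\<forall>t\<in>{0..1}. V t \<in> tangent_space A (\<gamma> t)) \<and>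
     (\<forall>c\<in>A. smooth_map std_atlas std_atlas {t\<in>{0..1}. \<gamma> t \<in> cdom c} (\<lambda>t. V t c))}"

definition cov_deriv_along ::
  "('m::topological_space, 'e::euclidean_space) chart set \<Rightarrow> ('m, 'e) connection \<Rightarrow>
   (real \<Rightarrow> 'm) \<Rightarrow> (real \<Rightarrow> ('m, 'e) tvec) \<Rightarrow> real \<Rightarrow> ('m, 'e) tvec" where
  "cov_deriv_along A D \<gamma> V t = (\<lambda>c. if c \<in> A \<and> \<gamma> t \<in> cdom c
     then vector_derivative (\<lambda>s. V s c) (at t within {0..1})
        + christoffel A D c (\<gamma> t) (velocity A \<gamma> t c) (V t c)
     else 0)"

definition parallel_along ::
  "('m::topological_space, 'e::euclidean_space) chart set \<Rightarrow> ('m, 'e) connection \<Rightarrow>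
   (real \<Rightarrow> 'm) \<Rightarrow> (real \<Rightarrow> ('m, 'e) tvec) \<Rightarrow> bool" where
  "parallel_along A D \<gamma> V \<longleftrightarrow> V \<in> vector_fields_along A \<gamma> \<and>
     (\<forall>t\<in>{0..1}. cov_deriv_along A D \<gamma> V t = tzero)"

definition parallel_transport ::
  "('m::topological_space, 'e::euclidean_space) chart set \<Rightarrow> ('m, 'e) connection \<Rightarrow>
   (real \<Rightarrow> 'm) \<Rightarrow> ('m, 'e) tvec \<Rightarrow> ('m, 'e) tvec" where
  "parallel_transport A D \<gamma> v = (THE w. \<exists>V. parallel_along A D \<gamma> V \<and> V 0 = v \<and> V 1 = w)"

definition geodesic ::
  "('m::topological_space, 'e::euclidean_space) chart set \<Rightarrow> ('m, 'e) connection \<Rightarrow>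
   (real \<Rightarrow> 'm) \<Rightarrow> bool" where
  "geodesic A D \<gamma> \<longleftrightarrow> smooth_map std_atlas A {0..1} \<gamma> \<and>
     (\<forall>t\<in>{0..1}. cov_deriv_along A D \<gamma> (velocity A \<gamma>) t = tzero)"


section \<open>Strong convexity\<close>

definition geodesic_segment ::
  "('m::topological_space, 'e::euclidean_space) chart set \<Rightarrow> ('m, 'e) connection \<Rightarrow>
   'm set \<Rightarrow> 'm \<Rightarrow> 'm \<Rightarrow> (real \<Rightarrow> 'm) \<Rightarrow> bool" where
  "geodesic_segment A D C m n \<gamma> \<longleftrightarrow>
     geodesic A D \<gamma> \<and> \<gamma> ` {0..1} \<subseteq> C \<and> \<gamma> 0 = m \<and> \<gamma> 1 = n"

definition geodesically_convex ::
  "('m::topological_space, 'e::euclidean_space) chart set \<Rightarrow> ('m, 'e) connection \<Rightarrow>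
   'm set \<Rightarrow> bool" where
  "geodesically_convex A D C \<longleftrightarrow> open C \<and>
     (\<forall>m\<in>C. \<forall>n\<in>C. \<forall>\<gamma> \<gamma>'. geodesic_segment A D C m n \<gamma> \<longrightarrow> geodesic_segment A D C m n \<gamma>' \<longrightarrow>
        (\<forall>t\<in>{0..1}. \<gamma> t = \<gamma>' t)) \<and>
     (\<exists>\<Gamma>. (\<forall>m\<in>C. \<forall>n\<in>C. geodesic_segment A D C m n (\<lambda>t. \<Gamma> (m, n, t))) \<and>
        smooth_map (prod_atlas A (prod_atlas A std_atlas)) A (C \<times> C \<times> {0..1}) \<Gamma>)"

definition strongly_convex_covering ::
  "('m::topological_space, 'e::euclidean_space) chart set \<Rightarrow> ('m, 'e) connection \<Rightarrow>
   'm set set \<Rightarrow> bool" where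
  "strongly_convex_covering A D \<C> \<longleftrightarrow> \<Union>\<C> = UNIV \<and>
     (\<forall>C\<in>\<C>. geodesically_convex A D C) \<and>
     (\<forall>C\<in>\<C>. \<forall>C'\<in>\<C>. C \<inter> C' = {} \<or> geodesically_convex A D (C \<inter> C'))"

definition covering_nbhd :: "'m set set \<Rightarrow> ('m \<times> 'm) set" where
  "covering_nbhd \<C> = (\<Union>C\<in>\<C>. C \<times> C)"

text \<open>The selected geodesic segment from \<open>m\<close> to \<open>n\<close>, for \<open>(m, n)\<close> in \<open>covering_nbhd \<C>\<close>.
  It is determined on \<open>[0,1]\<close>.\<close>

definition selected_geodesic ::
  "('m::topological_space, 'e::euclidean_space) chart set \<Rightarrow> ('m, 'e) connection \<Rightarrow>
   'm set set \<Rightarrow> 'm \<Rightarrow> 'm \<Rightarrow> real \<Rightarrow> 'm" where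
  "selected_geodesic A D \<C> m n =
     (SOME \<gamma>. \<forall>C\<in>\<C>. m \<in> C \<and> n \<in> C \<longrightarrow> geodesic_segment A D C m n \<gamma>)"

text \<open>Parallel transport with respect to \<open>D\<close> along \<open>D0\<close>-geodesics.\<close>

definition geodesic_transport ::
  "('m::topological_space, 'e::euclidean_space) chart set \<Rightarrow> ('m, 'e) connection \<Rightarrow>
   ('m, 'e) connection \<Rightarrow> 'm set set \<Rightarrow> 'm \<times> 'm \<Rightarrow> ('m, 'e) tvec \<Rightarrow> ('m, 'e) tvec" where
  "geodesic_transport A D D0 \<C> = (\<lambda>(m, n). parallel_transport A D (selected_geodesic A D0 \<C> m n))"


section \<open>Bi-forms\<close>

type_synonym ('m, 'e) biform = "'m \<times> 'm \<Rightarrow> ('m, 'e) tvec \<Rightarrow> ('m, 'e) tvec \<Rightarrow> real"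

definition biform_apply ::
  "('m, 'e) biform \<Rightarrow> ('m, 'e) vfield \<Rightarrow> ('m, 'e) vfield \<Rightarrow> 'm \<times> 'm \<Rightarrow> real" where
  "biform_apply \<omega> X Y = (\<lambda>(m, n). \<omega> (m, n) (X m) (Y n))"

text \<open>Smoothness of a bi-form is smoothness of its coefficients in the local trivializations of
  the bundle given by pairs of charts.\<close>

definition local_biform ::
  "('m::topological_space, 'e::euclidean_space) chart set \<Rightarrow> ('m \<times> 'm) set \<Rightarrow>
   ('m, 'e) biform \<Rightarrow> bool" where
  "local_biform A W \<omega> \<longleftrightarrow> open W \<and> (\<forall>m. (m, m) \<in> W) \<and>
     (\<forall>(m, n)\<in>W. bilinear_form_on (tangent_space A m) (tangent_space A n) (\<omega> (m, n))) \<and>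
     (\<forall>c\<in>A. \<forall>d\<in>A. \<forall>u w. smooth_map (prod_atlas A A) std_atlas (W \<inter> cdom c \<times> cdom d)
        (\<lambda>(m, n). \<omega> (m, n) (coord_vec A c m u) (coord_vec A d n w)))"

text \<open>The tangent vector \<open>(v, w)\<close> of the product manifold at \<open>(m, n)\<close>. A product chart
  \<open>(U \<times> V, map_prod \<phi> \<psi>)\<close> containing \<open>(m, n)\<close> determines its factors: \<open>U\<close> is the projection of
  \<open>U \<times> V\<close> and \<open>\<phi> p = fst (map_prod \<phi> \<psi> (p, n))\<close>, and likewise for \<open>(V, \<psi>)\<close>.\<close>

definition tangent_pair ::
  "('m, 'e::euclidean_space) chart set \<Rightarrow> 'm \<times> 'm \<Rightarrow> ('m, 'e) tvec \<Rightarrow> ('m, 'e) tvec \<Rightarrow>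
   ('m \<times> 'm, 'e \<times> 'e) tvec" where
  "tangent_pair A = (\<lambda>(m, n) v w c. if c \<in> prod_atlas A A \<and> (m, n) \<in> cdom c
     then (v (fst ` cdom c, \<lambda>p. fst (coord c (p, n))), w (snd ` cdom c, \<lambda>q. snd (coord c (m, q))))
     else 0)"

definition left_lift ::
  "('m, 'e::euclidean_space) chart set \<Rightarrow> ('m, 'e) vfield \<Rightarrow> ('m \<times> 'm, 'e \<times> 'e) vfield" where
  "left_lift A Z = (\<lambda>(m, n). tangent_pair A (m, n) (Z m) tzero)"

definition induced_metric ::
  "('m, 'e) biform \<Rightarrow> 'm \<Rightarrow> ('m, 'e) tvec \<Rightarrow> ('m, 'e) tvec \<Rightarrow> real" where
  "induced_metric \<omega> m v w = \<omega> (m, m) v w"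

definition contrast_biform ::
  "('m::topological_space, 'e::euclidean_space) chart set \<Rightarrow> ('m \<times> 'm) set \<Rightarrow>
   ('m, 'e) biform \<Rightarrow> bool" where
  "contrast_biform A W \<omega> \<longleftrightarrow>
     local_biform A W \<omega> \<and> pseudo_riemannian_metric A (induced_metric \<omega>)"

definition induced_connection ::
  "('m::topological_space, 'e::euclidean_space) chart set \<Rightarrow> ('m, 'e) biform \<Rightarrow>
   ('m, 'e) connection" where
  "induced_connection A \<omega> Z X m = (THE v. v \<in> tangent_space A m \<and>
     (\<forall>Y\<in>vector_fields A. induced_metric \<omega> m v (Y m) =
        lie_deriv (prod_atlas A A) (left_lift A Z) (biform_apply \<omega> X Y) (m, m)))"

definition integrating_biform ::
  "('m::topological_space, 'e::euclidean_space) chart set \<Rightarrow>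
   ('m \<Rightarrow> ('m, 'e) tvec \<Rightarrow> ('m, 'e) tvec \<Rightarrow> real) \<Rightarrow> ('m, 'e) connection \<Rightarrow>
   ('m \<times> 'm) set \<Rightarrow> ('m, 'e) biform \<Rightarrow> bool" where
  "integrating_biform A g D W \<omega> \<longleftrightarrow> contrast_biform A W \<omega> \<and>
     (\<forall>m. \<forall>v\<in>tangent_space A m. \<forall>w\<in>tangent_space A m. induced_metric \<omega> m v w = g m v w) \<and>
     (\<forall>Z\<in>vector_fields A. \<forall>X\<in>vector_fields A. induced_connection A \<omega> Z X = D Z X)"

end

theory Submission
  imports Defs
begin

text \<open>A parallel field solves a linear ordinary differential equation, so the smoothness of the
  transport in \<open>(m, n)\<close> is smooth dependence of linear equations on parameters: on a short time
  interval the Picard series converges uniformly, and difference quotients of solutions solve a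
  linear equation with coefficients depending continuously on the step, up to step \<open>0\<close>. Longer
  curves are subdivided, and the pieces are compared through the transformation law of the
  Christoffel symbols \<open>\<Gamma>\<close>.

  At the diagonal the selected geodesic is constant, so the transport is the identity and the induced
  metric is \<open>g\<close>. Along a variation of a constant curve \<open>m\<close> with variation field \<open>\<delta>(t)\<close>, the
  linearized transport satisfies \<open>W' = - \<Gamma>\<^sub>m(\<delta>', u)\<close>, whence
  \<open>W(1) = \<Gamma>\<^sub>m(\<delta>(0) - \<delta>(1), u)\<close>. Moving only the initial point in direction \<open>z\<close> gives \<open>\<Gamma>\<^sub>m(z, u)\<close>;
  together with the derivative of the components of \<open>X\<close> this is the coordinate expression of
  \<open>\<nabla>\<^sub>z X\<close>.\<close>

section \<open>Smooth calculus\<close>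

text \<open>Short means \<open>L * (\<beta> - \<alpha>) \<le> 1/2\<close> with \<open>L\<close> a
  bound for the coefficients: each Picard step then halves, geometric series suffice, and the same
  constant yields uniqueness. Curves are given on [0,1] while derivatives want open sets; so in a
  chart a family of curves is described by a smooth \<open>h\<close> whose open domain reaches past
  the ends. Connections act on global fields only, and the Christoffel symbols come from chosen
  ones; cutoff functions make these choices immaterial. The derivative along the left lift is taken
  in a product chart picked by choice, whose factors may differ even at (m, m); hence the two base
  points get two charts, while near the diagonal vectors at both ends are written in the left one.
  The formula for \<open>W\<close> is this simple because the coefficient is linear in the velocity,
  which vanishes on a constant curve: derivatives of \<open>\<Gamma>\<close> and of the solution
  never enter, and symmetry of second derivatives turns the varied velocity into
  \<open>\<delta>'\<close>.\<close>

lemma differentiable_upto_cong: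
  assumes "open S" "\<And>x. x \<in> S \<Longrightarrow> f x = g x" "differentiable_upto k S f"
  shows "differentiable_upto k S g"
  using assms(2,3)
proof (induction k arbitrary: f g)
  case 0
  then show ?case by (simp cong: continuous_on_cong)
next
  case (Suc k)
  have d: "(g has_derivative frechet_derivative f (at x)) (at x)" if "x \<in> S" for x
  proof -
    have "(f has_derivative frechet_derivative f (at x)) (at x)"
      using Suc.prems that frechet_derivative_works by auto
    then show ?thesis
      using has_derivative_transform_within_open[OF _ \<open>open S\<close> that] Suc.prems(1) by metis
  qed
  then have eq: "frechet_derivative f (at x) = frechet_derivative g (at x)" if "x \<in> S" for x
    using that frechet_derivative_at by blast
  have "differentiable_upto k S (\<lambda>x. frechet_derivative g (at x) v)" for v
    by (rule Suc.IH[of "\<lambda>x. frechet_derivative f (at x) v"]) (use Suc.prems eq in auto)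
  then show ?case
    using d by (auto simp: differentiable_def)
qed

text \<open>Derivatives are usually known by an explicit formula \<open>f'\<close>; uniqueness of
  the derivative lets it stand for the chosen \<open>frechet_derivative\<close> on the open
  set.\<close>

lemma differentiable_upto_SucI:
  assumes "\<And>x. x \<in> S \<Longrightarrow> (f has_derivative f' x) (at x)"
    and "open S" "\<And>v. differentiable_upto k S (\<lambda>x. f' x v)"
  shows "differentiable_upto (Suc k) S f"
proof -
  have eq: "f' x = frechet_derivative f (at x)" if "x \<in> S" for x
    using assms(1)[OF that] by (rule frechet_derivative_at)
  have "differentiable_upto k S (\<lambda>x. frechet_derivative f (at x) v)" for v
    by (rule differentiable_upto_cong[OF assms(2) _ assms(3)]) (simp add: eq)
  then show ?thesis
    using assms(1) by (auto simp: differentiable_def)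
qed

lemma differentiable_upto_SucD:
  assumes "differentiable_upto (Suc k) S f"
  shows "x \<in> S \<Longrightarrow> (f has_derivative frechet_derivative f (at x)) (at x)"
    and "differentiable_upto k S (\<lambda>x. frechet_derivative f (at x) v)"
  using assms frechet_derivative_works by auto

lemma differentiable_upto_subset:
  "differentiable_upto k T f \<Longrightarrow> S \<subseteq> T \<Longrightarrow> differentiable_upto k S f"
  by (induction k arbitrary: f) (auto intro: continuous_on_subset)

lemma differentiable_upto_lower:
  "differentiable_upto (Suc k) S f \<Longrightarrow> differentiable_upto k S f"
proof (induction k arbitrary: f)
  case 0
  then show ?case
    by (auto intro!: continuous_at_imp_continuous_on differentiable_imp_continuous_within)
next
  case (Suc k)
  have "differentiable_upto k S (\<lambda>x. frechet_derivative f (at x) v)" for v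
    using Suc.IH Suc.prems differentiable_upto_SucD(2) by blast
  then show ?case
    using Suc.prems by auto
qed

lemma differentiable_upto_continuous_on:
  "differentiable_upto k S f \<Longrightarrow> continuous_on S f"
  by (induction k) (use differentiable_upto_lower in auto)

lemma differentiable_upto_local:
  assumes "\<And>x. x \<in> S \<Longrightarrow> \<exists>U. open U \<and> x \<in> U \<and> differentiable_upto k U f"
  shows "differentiable_upto k S f"
  using assms
proof (induction k arbitrary: f)
  case 0
  then have "continuous (at x) f" if "x \<in> S" for x
  proof -
    obtain U where "open U" "x \<in> U" "continuous_on U f" using "0.prems"[OF \<open>x \<in> S\<close>] by auto
    then show ?thesis by (simp add: continuous_on_eq_continuous_at)
  qed
  then have "\<forall>x\<in>S. continuous (at x) f" by blast
  then show ?case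
    unfolding differentiable_upto.simps(1) by (rule continuous_at_imp_continuous_on)
next
  case (Suc k)
  have "differentiable_upto k S (\<lambda>x. frechet_derivative f (at x) v)" for v
  proof (rule Suc.IH)
    fix x assume "x \<in> S"
    then obtain U where U: "open U" "x \<in> U" "differentiable_upto (Suc k) U f"
      using Suc.prems by blast
    show "\<exists>U. open U \<and> x \<in> U \<and> differentiable_upto k U (\<lambda>x. frechet_derivative f (at x) v)"
      using U differentiable_upto_SucD(2)[OF U(3)] by blast
  qed
  moreover have "f differentiable (at x)" if "x \<in> S" for x
    using Suc.prems[OF that] by auto
  ultimately show ?case by simp
qed

section \<open>Closure of finite differentiability under algebraic operations and
  composition\<close>

lemma differentiable_upto_const: "open S \<Longrightarrow> differentiable_upto k S (\<lambda>x. c)"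
proof (induction k arbitrary: c)
  case (Suc k)
  show ?case
    by (rule differentiable_upto_SucI[where f' = "\<lambda>x v. 0"]) (use Suc in auto)
qed auto

lemma differentiable_upto_bounded_linear:
  assumes L: "bounded_linear L" and "open S" "differentiable_upto k S f"
  shows "differentiable_upto k S (\<lambda>x. L (f x))"
  using assms(3)
proof (induction k arbitrary: f)
  case 0
  then show ?case
    using bounded_linear.continuous_on[OF L] by auto
next
  case (Suc k)
  show ?case
    by (rule differentiable_upto_SucI
        [where f' = "\<lambda>x v. L (frechet_derivative f (at x) v)"])
      (use bounded_linear.has_derivative[OF L] differentiable_upto_SucD[OF Suc.prems] Suc.IH \<open>open S\<close> in auto)
qed

lemma differentiable_upto_ident: "open S \<Longrightarrow> differentiable_upto k S (\<lambda>x. x)"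
  by (cases k) (auto intro: differentiable_upto_SucI[where f' = "\<lambda>x v. v"] differentiable_upto_const simp del: differentiable_upto.simps(2))

lemma differentiable_upto_linear:
  "bounded_linear L \<Longrightarrow> open S \<Longrightarrow> differentiable_upto k S L"
  using differentiable_upto_bounded_linear differentiable_upto_ident by blast

lemma differentiable_upto_add:
  assumes "open S" "differentiable_upto k S f" "differentiable_upto k S g"
  shows "differentiable_upto k S (\<lambda>x. f x + g x)"
  using assms(2,3)
proof (induction k arbitrary: f g)
  case 0
  then show ?case by (auto intro: continuous_on_add)
next
  case (Suc k)
  show ?case
    by (rule differentiable_upto_SucI
        [where f' = "\<lambda>x v. frechet_derivative f (at x) v + frechet_derivative g (at x) v"])
      (use has_derivative_add differentiable_upto_SucD[OF Suc.prems(1)] differentiable_upto_SucD[OF Suc.prems(2)] Suc.IH \<open>open S\<close> in auto)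
qed

lemma differentiable_upto_sum:
  assumes "open S" "finite I" "\<And>i. i \<in> I \<Longrightarrow> differentiable_upto k S (f i)"
  shows "differentiable_upto k S (\<lambda>x. \<Sum>i\<in>I. f i x)"
  using assms(2,3)
  by (induction I) (auto intro: differentiable_upto_add differentiable_upto_const assms(1))

lemma differentiable_upto_bilinear:
  assumes B: "bounded_bilinear B" and "open S" "differentiable_upto k S f" "differentiable_upto k S g"
  shows "differentiable_upto k S (\<lambda>x. B (f x) (g x))"
  using assms(3,4)
proof (induction k arbitrary: f g)
  case 0
  then show ?case by (auto intro: bounded_bilinear.continuous_on[OF B])
next
  case (Suc k)
  note f = differentiable_upto_SucD[OF Suc.prems(1)] and g = differentiable_upto_SucD[OF Suc.prems(2)]
  show ?case
  proof (rule differentiable_upto_SucI[OF _ \<open>open S\<close>])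
    show "((\<lambda>x. B (f x) (g x)) has_derivative
        (\<lambda>v. B (f x) (frechet_derivative g (at x) v) + B (frechet_derivative f (at x) v) (g x))) (at x)"
      if "x \<in> S" for x
      using bounded_bilinear.FDERIV[OF B f(1)[OF that] g(1)[OF that]] .
    show "differentiable_upto k S
        (\<lambda>x. B (f x) (frechet_derivative g (at x) v) + B (frechet_derivative f (at x) v) (g x))" for v
      by (intro differentiable_upto_add Suc.IH f g \<open>open S\<close> differentiable_upto_lower[OF Suc.prems(1)]
         differentiable_upto_lower[OF Suc.prems(2)])
  qed
qed

lemmas differentiable_upto_scaleR = differentiable_upto_bilinear[OF bounded_bilinear_scaleR]
lemmas differentiable_upto_mult = differentiable_upto_bilinear[OF bounded_bilinear_mult]
text \<open>Regularity of a family of linear maps is only ever known for each fixed argument.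
  Expansion over the basis transfers it to a moving argument, here and in all later uses.\<close>

lemma linear_sum_Basis:
  fixes L :: "'a::euclidean_space \<Rightarrow> 'b::real_vector"
  assumes "linear L"
  shows "L v = (\<Sum>b\<in>Basis. (v \<bullet> b) *\<^sub>R L b)"
proof -
  have "L v = L (\<Sum>b\<in>Basis. (v \<bullet> b) *\<^sub>R b)"
    by (simp add: euclidean_representation)
  also have "\<dots> = (\<Sum>b\<in>Basis. (v \<bullet> b) *\<^sub>R L b)"
    by (simp add: linear_sum[OF assms] linear_cmul[OF assms] o_def)
  finally show ?thesis .
qed

text \<open>The chain rule feeds the moving vector g'(x) v into f'(g(x)). After expansion over the
  basis f' is taken in fixed directions only, and the induction hypothesis applies to each of these;
  this is why \<open>f\<close> is generalized in the induction.\<close>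

lemma differentiable_upto_compose:
  fixes g :: "'a::real_normed_vector \<Rightarrow> 'b::euclidean_space"
  assumes "open S" "open T" "g ` S \<subseteq> T" "differentiable_upto k T f" "differentiable_upto k S g"
  shows "differentiable_upto k S (\<lambda>x. f (g x))"
  using assms(4,5)
proof (induction k arbitrary: f)
  case 0
  then show ?case
    using continuous_on_compose2[OF _ _ assms(3)] by auto
next
  case (Suc k)
  note f = differentiable_upto_SucD[OF Suc.prems(1)] and g = differentiable_upto_SucD[OF Suc.prems(2)]
  let ?f' = "\<lambda>x v. \<Sum>b\<in>Basis. (frechet_derivative g (at x) v \<bullet> b) *\<^sub>R frechet_derivative f (at (g x)) b"
  have "((\<lambda>x. f (g x)) has_derivative ?f' x) (at x)" if "x \<in> S" for x
  proof -
    have "g x \<in> T" using that assms(3) by auto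
    then have f': "(f has_derivative frechet_derivative f (at (g x))) (at (g x))" using f by auto
    have "((\<lambda>x. f (g x)) has_derivative (\<lambda>v. frechet_derivative f (at (g x)) (frechet_derivative g (at x) v))) (at x)"
      using has_derivative_compose[OF g(1)[OF that] f'] .
    moreover have "(\<lambda>v. frechet_derivative f (at (g x)) (frechet_derivative g (at x) v)) = ?f' x"
      by (intro ext linear_sum_Basis has_derivative_linear[OF f'])
    ultimately show ?thesis by (simp only:)
  qed
  moreover have "differentiable_upto k S (\<lambda>x. ?f' x v)" for v
    by (intro differentiable_upto_sum differentiable_upto_scaleR assms finite_Basis
        Suc.IH f differentiable_upto_bounded_linear[OF bounded_linear_inner_left] g differentiable_upto_lower[OF Suc.prems(2)])
  ultimately show ?case
    by (intro differentiable_upto_SucI assms)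
qed

section \<open>The same closure properties for smoothness of all orders\<close>

lemma smooth_openD: "smooth_open S f \<Longrightarrow> differentiable_upto k S f"
  by (simp add: smooth_open_def)

lemma smooth_open_cong:
  "open S \<Longrightarrow> (\<And>x. x \<in> S \<Longrightarrow> f x = g x) \<Longrightarrow> smooth_open S f \<Longrightarrow> smooth_open S g"
  unfolding smooth_open_def using differentiable_upto_cong[of S f g] by auto

lemma smooth_open_subset: "smooth_open T f \<Longrightarrow> S \<subseteq> T \<Longrightarrow> smooth_open S f"
  unfolding smooth_open_def using differentiable_upto_subset[of _ T f S] by simp

lemma smooth_open_local:
  "(\<And>x. x \<in> S \<Longrightarrow> \<exists>U. open U \<and> x \<in> U \<and> smooth_open U f) \<Longrightarrow> smooth_open S f"
  unfolding smooth_open_def by (intro allI differentiable_upto_local) blast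

lemma smooth_open_const: "open S \<Longrightarrow> smooth_open S (\<lambda>x. c)"
  unfolding smooth_open_def using differentiable_upto_const[of S _ c] by simp

lemma smooth_open_linear: "bounded_linear L \<Longrightarrow> open S \<Longrightarrow> smooth_open S L"
  unfolding smooth_open_def using differentiable_upto_linear[of L S] by simp

lemma smooth_open_ident: "open S \<Longrightarrow> smooth_open S (\<lambda>x. x)"
  unfolding smooth_open_def using differentiable_upto_ident[where S = S] by simp

lemma smooth_open_bounded_linear:
  "bounded_linear L \<Longrightarrow> open S \<Longrightarrow> smooth_open S f \<Longrightarrow> smooth_open S (\<lambda>x. L (f x))"
  unfolding smooth_open_def using differentiable_upto_bounded_linear[of L S _ f] by simp

lemma smooth_open_add:
  "open S \<Longrightarrow> smooth_open S f \<Longrightarrow> smooth_open S g \<Longrightarrow> smooth_open S (\<lambda>x. f x + g x)"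
  unfolding smooth_open_def using differentiable_upto_add[of S _ f g] by simp

lemma smooth_open_minus: "open S \<Longrightarrow> smooth_open S f \<Longrightarrow> smooth_open S (\<lambda>x. - f x)"
  by (rule smooth_open_bounded_linear[OF bounded_linear_minus[OF bounded_linear_ident]])

lemma smooth_open_diff:
  "open S \<Longrightarrow> smooth_open S f \<Longrightarrow> smooth_open S g \<Longrightarrow> smooth_open S (\<lambda>x. f x - g x)"
  using smooth_open_add[OF _ _ smooth_open_minus, of S f g] by simp

lemma smooth_open_sum:
  "open S \<Longrightarrow> finite I \<Longrightarrow> (\<And>i. i \<in> I \<Longrightarrow> smooth_open S (f i)) \<Longrightarrow> smooth_open S (\<lambda>x. \<Sum>i\<in>I. f i x)"
  unfolding smooth_open_def using differentiable_upto_sum[of S I _ f] by simp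

lemma smooth_open_bilinear:
  "bounded_bilinear B \<Longrightarrow> open S \<Longrightarrow> smooth_open S f \<Longrightarrow> smooth_open S g \<Longrightarrow>
    smooth_open S (\<lambda>x. B (f x) (g x))"
  unfolding smooth_open_def using differentiable_upto_bilinear[of B S _ f g] by simp

lemmas smooth_open_scaleR = smooth_open_bilinear[OF bounded_bilinear_scaleR]
lemmas smooth_open_mult = smooth_open_bilinear[OF bounded_bilinear_mult]
lemmas smooth_open_inner = smooth_open_bilinear[OF bounded_bilinear_inner]

lemma smooth_open_compose:
  fixes g :: "'a::real_normed_vector \<Rightarrow> 'b::euclidean_space"
  assumes "smooth_open T f" "smooth_open S g" "open S" "open T" "g ` S \<subseteq> T"
  shows "smooth_open S (\<lambda>x. f (g x))"
  unfolding smooth_open_def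
  using differentiable_upto_compose[OF assms(3-5) smooth_openD[OF assms(1)] smooth_openD[OF assms(2)]]
  by blast

lemma smooth_open_has_derivative:
  "smooth_open S f \<Longrightarrow> x \<in> S \<Longrightarrow> (f has_derivative frechet_derivative f (at x)) (at x)"
  by (rule differentiable_upto_SucD(1)[OF smooth_openD])

lemma smooth_open_frechet:
  "smooth_open S f \<Longrightarrow> smooth_open S (\<lambda>x. frechet_derivative f (at x) v)"
  unfolding smooth_open_def[of S "\<lambda>x. frechet_derivative f (at x) v"]
  by (intro allI, rule differentiable_upto_SucD(2)) (rule smooth_openD)

lemma smooth_open_continuous_on: "smooth_open S f \<Longrightarrow> continuous_on S f"
  using smooth_openD[of S f 0] by auto

lemma smooth_open_Pair:
  assumes "open S" "smooth_open S f" "smooth_open S g"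
  shows "smooth_open S (\<lambda>x. (f x, g x))"
proof -
  have "smooth_open S (\<lambda>x. (f x, 0) + (0, g x))"
    by (intro smooth_open_add assms
        smooth_open_bounded_linear[OF bounded_linear_Pair[OF bounded_linear_ident bounded_linear_zero]]
        smooth_open_bounded_linear[OF bounded_linear_Pair[OF bounded_linear_zero bounded_linear_ident]])
  then show ?thesis by simp
qed

lemma smooth_within_open_iff:
  assumes "open S"
  shows "smooth_within S f \<longleftrightarrow> smooth_open S f"
proof
  assume L: "smooth_within S f"
  show "smooth_open S f"
  proof (rule smooth_open_local)
    fix x assume "x \<in> S"
    then obtain U h where U: "open U" "x \<in> U" "smooth_open U h" "\<forall>y\<in>U \<inter> S. h y = f y"
      using L unfolding smooth_within_def by blast
    have "smooth_open (U \<inter> S) h" using U smooth_open_subset by blast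
    then have "smooth_open (U \<inter> S) f"
      using U assms by (intro smooth_open_cong[of _ h f]) auto
    then show "\<exists>U. open U \<and> x \<in> U \<and> smooth_open U f"
      using U assms \<open>x \<in> S\<close> by (intro exI[of _ "U \<inter> S"]) auto
  qed
qed (use assms in \<open>auto simp: smooth_within_def\<close>)

text \<open>Walk from \<open>x\<close> to \<open>x + v\<close> along the coordinate axes and apply the mean value inequality
  on each edge.\<close>

lemma has_derivative_of_continuous_partials:
  fixes f :: "'a::euclidean_space \<Rightarrow> 'b::real_normed_vector"
  assumes "open S" "x \<in> S"
    and D: "\<And>b y. b \<in> Basis \<Longrightarrow> y \<in> S \<Longrightarrow> ((\<lambda>h. f (y + h *\<^sub>R b)) has_vector_derivative D b y) (at 0)"
    and C: "\<And>b. b \<in> Basis \<Longrightarrow> continuous_on S (D b)"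
  shows "(f has_derivative (\<lambda>v. \<Sum>b\<in>Basis. (v \<bullet> b) *\<^sub>R D b x)) (at x)"
  unfolding has_derivative_at_alt
proof (intro conjI allI impI)
  show "bounded_linear (\<lambda>v. \<Sum>b\<in>Basis. (v \<bullet> b) *\<^sub>R D b x)"
    by (intro bounded_linear_sum bounded_linear_scaleR_const bounded_linear_inner_left)
  fix e :: real assume "e > 0"
  \<comment> \<open>The walk has at most \<open>DIM('a)\<close> edges, each contributing an error of
    \<open>e' * norm v\<close>.\<close>
  define e' where "e' = e / DIM('a)"
  have "e' > 0" using \<open>e > 0\<close> by (simp add: e'_def)
  have "\<exists>d>0. \<forall>y. norm (y - x) < d \<longrightarrow> y \<in> S \<and> norm (D b y - D b x) \<le> e'" if "b \<in> Basis" for b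
  proof -
    obtain d1 where d1: "d1 > 0" "ball x d1 \<subseteq> S"
      using assms(1,2) openE by blast
    have "continuous (at x) (D b)"
      using C[OF that] assms(1,2) continuous_on_eq_continuous_at by blast
    then obtain d2 where d2: "d2 > 0" "\<forall>y. dist y x < d2 \<longrightarrow> dist (D b y) (D b x) < e'"
      using \<open>e' > 0\<close> unfolding continuous_at_eps_delta by blast
    show ?thesis
      by (rule exI[of _ "min d1 d2"]) (use d1 d2 in \<open>force simp: dist_norm norm_minus_commute\<close>)
  qed
  then obtain d where d: "\<And>b. b \<in> Basis \<Longrightarrow> d b > 0"
    "\<And>b y. b \<in> Basis \<Longrightarrow> norm (y - x) < d b \<Longrightarrow> y \<in> S \<and> norm (D b y - D b x) \<le> e'"
    by metis
  \<comment> \<open>Every point of the walk is within \<open>DIM('a) * norm v\<close> of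
    \<open>x\<close>; dividing by the dimension keeps all edges inside every radius
    \<open>d b\<close>.\<close>
  define \<delta> where "\<delta> = Min (d ` Basis) / DIM('a)"
  have \<delta>: "\<delta> > 0" "b \<in> Basis \<Longrightarrow> DIM('a) * \<delta> \<le> d b" for b
    using d(1) by (auto simp: \<delta>_def)
  show "\<exists>d>0. \<forall>y. norm (y - x) < d \<longrightarrow>
      norm (f y - f x - (\<Sum>b\<in>Basis. ((y - x) \<bullet> b) *\<^sub>R D b x)) \<le> e * norm (y - x)"
  proof (intro exI[of _ \<delta>] conjI allI impI \<delta>(1))
    fix y assume y: "norm (y - x) < \<delta>"
    define v where "v = y - x"
    define P where "P B = (\<Sum>b\<in>B. (v \<bullet> b) *\<^sub>R b)" for B
    have step: "norm (f (x + P B) - f x - (\<Sum>b\<in>B. (v \<bullet> b) *\<^sub>R D b x)) \<le> card B * e' * norm v"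
      if "B \<subseteq> Basis" for B
      using finite_subset[OF that finite_Basis] that
    proof (induction B)
      case empty
      then show ?case by (simp add: P_def)
    next
      case (insert b B)
      have bB: "b \<in> Basis" "B \<subseteq> Basis" using insert by auto
      \<comment> \<open>Subtracting the linear part leaves a function whose derivative along the
        edge is at most \<open>e'\<close>, so that the mean value inequality yields the error
        directly.\<close>
      define \<phi> where "\<phi> h = f (x + P B + h *\<^sub>R b) - h *\<^sub>R D b x" for h
      have near: "norm (P B + h *\<^sub>R b) < d b" if "h \<in> closed_segment 0 (v \<bullet> b)" for h
      proof -
        have 1: "norm (P B) \<le> (\<Sum>b\<in>B. \<bar>v \<bullet> b\<bar>)"
          unfolding P_def using bB by (intro norm_sum[THEN order_trans] sum_mono) (auto simp: subset_eq)
        have "\<bar>h\<bar> \<le> \<bar>v \<bullet> b\<bar>"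
          using that by (auto simp: closed_segment_eq_real_ivl split: if_splits)
        then have "norm (P B + h *\<^sub>R b) \<le> (\<Sum>b\<in>B. \<bar>v \<bullet> b\<bar>) + \<bar>v \<bullet> b\<bar>"
          using 1 bB by (intro norm_triangle_le) auto
        also have "\<dots> = (\<Sum>b\<in>insert b B. \<bar>v \<bullet> b\<bar>)" using insert by auto
        also have "\<dots> \<le> (\<Sum>b\<in>insert b B. norm v)"
          using insert.prems by (intro sum_mono Basis_le_norm) auto
        also have "\<dots> = card (insert b B) * norm v" by simp
        also have "\<dots> \<le> DIM('a) * norm v"
          by (intro mult_right_mono) (use card_mono[OF finite_Basis insert.prems] in auto)
        also have "\<dots> < DIM('a) * \<delta>" using y by (simp add: v_def)
        finally show ?thesis using \<delta>(2)[OF bB(1)] by linarith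
      qed
      have der: "(\<phi> has_derivative (\<lambda>s. s *\<^sub>R (D b (x + P B + h *\<^sub>R b) - D b x))) (at h within closed_segment 0 (v \<bullet> b))"
        if "h \<in> closed_segment 0 (v \<bullet> b)" for h
      proof -
        have "x + P B + h *\<^sub>R b \<in> S"
          using d(2)[OF bB(1), of "x + P B + h *\<^sub>R b"] near[OF that] by (simp add: algebra_simps)
        from D[OF bB(1) this]
        have "((\<lambda>k. f (x + P B + h *\<^sub>R b + k *\<^sub>R b)) has_vector_derivative D b (x + P B + h *\<^sub>R b)) (at (h - h))"
          by simp
        then have "((\<lambda>k. f (x + P B + h *\<^sub>R b + k *\<^sub>R b)) \<circ> (\<lambda>k. k - h) has_vector_derivative 1 *\<^sub>R D b (x + P B + h *\<^sub>R b)) (at h)"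
          by (intro vector_diff_chain_at) (auto intro!: derivative_eq_intros)
        then have "((\<lambda>k. f (x + P B + k *\<^sub>R b)) has_vector_derivative D b (x + P B + h *\<^sub>R b)) (at h)"
          by (simp add: o_def algebra_simps)
        then have "(\<phi> has_vector_derivative D b (x + P B + h *\<^sub>R b) - D b x) (at h)"
          unfolding \<phi>_def by (auto intro!: derivative_eq_intros)
        then show ?thesis
          unfolding has_vector_derivative_def by (rule has_derivative_at_withinI)
      qed
      have "norm (\<phi> (v \<bullet> b) - \<phi> 0) \<le> e' * norm (v \<bullet> b - 0)"
      proof (rule differentiable_bound[OF convex_closed_segment der])
        fix h assume h: "h \<in> closed_segment 0 (v \<bullet> b)"
        have "norm (D b (x + P B + h *\<^sub>R b) - D b x) \<le> e'"
          using d(2)[OF bB(1), of "x + P B + h *\<^sub>R b"] near[OF h] by (simp add: algebra_simps)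
        then show "onorm (\<lambda>s. s *\<^sub>R (D b (x + P B + h *\<^sub>R b) - D b x)) \<le> e'"
          by (intro onorm_le) (simp add: mult.commute[of e'] mult_left_mono)
      qed auto
      also have "\<dots> \<le> e' * norm v"
        using \<open>e' > 0\<close> Basis_le_norm[OF bB(1)] by auto
      finally have 2: "norm (f (x + P B + (v \<bullet> b) *\<^sub>R b) - f (x + P B) - (v \<bullet> b) *\<^sub>R D b x) \<le> e' * norm v"
        by (simp add: \<phi>_def algebra_simps)
      have eq: "f (x + P (insert b B)) - f x - (\<Sum>b\<in>insert b B. (v \<bullet> b) *\<^sub>R D b x)
         = (f (x + P B + (v \<bullet> b) *\<^sub>R b) - f (x + P B) - (v \<bullet> b) *\<^sub>R D b x)
           + (f (x + P B) - f x - (\<Sum>b\<in>B. (v \<bullet> b) *\<^sub>R D b x))"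
        using insert by (simp add: P_def algebra_simps)
      show ?case
        unfolding eq using norm_triangle_mono[OF 2 insert.IH[OF bB(2)]] insert
        by (simp add: algebra_simps)
    qed
    have "P Basis = v" by (simp add: P_def euclidean_representation)
    then show "norm (f y - f x - (\<Sum>b\<in>Basis. ((y - x) \<bullet> b) *\<^sub>R D b x)) \<le> e * norm (y - x)"
      using step[OF order_refl] by (simp add: v_def e'_def)
  qed
qed

text \<open>For an equation with parameters, the time and parameter derivatives are found by
  different arguments. This turns such partials into one more order of joint
  differentiability.\<close>

lemma differentiable_upto_Suc_partials:
  fixes f :: "'a::euclidean_space \<Rightarrow> 'b::real_normed_vector"
  assumes "open S"
    and D: "\<And>b y. b \<in> Basis \<Longrightarrow> y \<in> S \<Longrightarrow> ((\<lambda>h. f (y + h *\<^sub>R b)) has_vector_derivative D b y) (at 0)"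
    and C: "\<And>b. b \<in> Basis \<Longrightarrow> differentiable_upto k S (D b)"
  shows "differentiable_upto (Suc k) S f"
proof (rule differentiable_upto_SucI[OF _ \<open>open S\<close>])
  fix x assume "x \<in> S"
  show "(f has_derivative (\<lambda>v. \<Sum>b\<in>Basis. (v \<bullet> b) *\<^sub>R D b x)) (at x)"
    by (rule has_derivative_of_continuous_partials[OF assms(1) \<open>x \<in> S\<close> D])
      (use C differentiable_upto_continuous_on in auto)
next
  fix v :: 'a
  show "differentiable_upto k S (\<lambda>x. \<Sum>b\<in>Basis. (v \<bullet> b) *\<^sub>R D b x)"
    by (intro differentiable_upto_sum differentiable_upto_scaleR differentiable_upto_const assms) auto
qed

lemma has_vector_derivative_along:
  assumes "(f has_derivative f') (at x)"
  shows "((\<lambda>h. f (x + h *\<^sub>R v)) has_vector_derivative f' v) (at 0)"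
proof -
  have 1: "((\<lambda>h::real. x + h *\<^sub>R v) has_derivative (\<lambda>h. h *\<^sub>R v)) (at 0)"
    by (auto intro!: derivative_eq_intros)
  have 2: "(f has_derivative f') (at (x + 0 *\<^sub>R v))" using assms by simp
  have "((\<lambda>h. f (x + h *\<^sub>R v)) has_derivative (\<lambda>h. f' (h *\<^sub>R v))) (at 0)"
    using has_derivative_compose[OF 1 2] by simp
  then show ?thesis
    unfolding has_vector_derivative_def using linear_cmul[OF has_derivative_linear[OF assms]] by simp
qed

section \<open>Linear ordinary differential equations with parameters\<close>

text \<open>The primitive in the second variable that vanishes at \<open>s\<close>, rescaled to a fixed interval
  so that joint continuity is continuity of a parametric integral.\<close>

definition primitive :: "real \<Rightarrow> ('p \<times> real \<Rightarrow> 'e::euclidean_space) \<Rightarrow> 'p \<times> real \<Rightarrow> 'e" where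
  "primitive s f z = (snd z - s) *\<^sub>R integral {0..1} (\<lambda>r. f (fst z, s + r * (snd z - s)))"

lemma segment_mem:
  fixes s t r :: real
  assumes "s \<in> J" "t \<in> J" "convex J" "0 \<le> r" "r \<le> 1"
  shows "s + r * (t - s) \<in> J"
proof -
  have "(1 - r) *\<^sub>R s + r *\<^sub>R t \<in> J"
    using assms by (intro convexD) auto
  then show ?thesis by (simp add: algebra_simps)
qed

lemma primitive_continuous_on:
  fixes f :: "'p::topological_space \<times> real \<Rightarrow> 'e::euclidean_space"
  assumes f: "continuous_on (N \<times> J) f" and J: "convex J" "s \<in> J"
  shows "continuous_on (N \<times> J) (primitive s f)"
proof -
  have "continuous_on ((N \<times> J) \<times> cbox 0 1) (\<lambda>x. f (fst (fst x), s + snd x * (snd (fst x) - s)))"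
    by (rule continuous_on_compose2[OF f]) (auto intro!: continuous_intros segment_mem J)
  then have "continuous_on (N \<times> J) (\<lambda>z. integral (cbox 0 1) (\<lambda>r. f (fst z, s + r * (snd z - s))))"
    by (intro integral_continuous_on_param) (simp add: case_prod_beta)
  then show ?thesis
    unfolding primitive_def by (intro continuous_intros) auto
qed

lemma continuous_on_section:
  assumes "continuous_on (N \<times> J) f" "p \<in> N" "I \<subseteq> J"
  shows "continuous_on I (\<lambda>t. f (p, t))"
  by (rule continuous_on_compose2[OF assms(1)]) (use assms in \<open>auto intro!: continuous_intros\<close>)

lemma primitive_integrand_continuous:
  fixes f :: "'p::topological_space \<times> real \<Rightarrow> 'e::euclidean_space"
  assumes f: "continuous_on (N \<times> J) f" and J: "convex J" "s \<in> J" and "p \<in> N" "t \<in> J"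
  shows "continuous_on {0..1} (\<lambda>r. f (p, s + r * (t - s)))"
  by (rule continuous_on_compose2[OF f]) (use assms in \<open>auto intro!: continuous_intros segment_mem\<close>)

lemma primitive_bound:
  fixes f :: "'p::topological_space \<times> real \<Rightarrow> 'e::euclidean_space"
  assumes f: "continuous_on (N \<times> J) f" and J: "convex J" "s \<in> J" and "p \<in> N" "t \<in> J"
    and M: "\<And>\<tau>. \<tau> \<in> closed_segment s t \<Longrightarrow> norm (f (p, \<tau>)) \<le> M"
  shows "norm (primitive s f (p, t)) \<le> \<bar>t - s\<bar> * M"
proof -
  have "norm (integral {0..1} (\<lambda>r. f (p, s + r * (t - s)))) \<le> M * (1 - 0)"
  proof (rule integral_bound)
    show "continuous_on {0..1} (\<lambda>r. f (p, s + r * (t - s)))"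
      by (rule primitive_integrand_continuous[OF f J assms(4,5)])
    fix r :: real assume "r \<in> {0..1}"
    then have "s + r * (t - s) \<in> closed_segment s t"
      by (intro segment_mem) auto
    then show "norm (f (p, s + r * (t - s))) \<le> M" by (rule M)
  qed simp
  then show ?thesis
    by (simp add: primitive_def mult_left_mono)
qed

lemma primitive_add:
  fixes f g :: "'p::topological_space \<times> real \<Rightarrow> 'e::euclidean_space"
  assumes "continuous_on (N \<times> J) f" "continuous_on (N \<times> J) g"
    and J: "convex J" "s \<in> J" and "p \<in> N" "t \<in> J"
  shows "primitive s (\<lambda>z. f z + g z) (p, t) = primitive s f (p, t) + primitive s g (p, t)"
proof -
  have "integral {0..1} (\<lambda>r. f (p, s + r * (t - s)) + g (p, s + r * (t - s))) =
      integral {0..1} (\<lambda>r. f (p, s + r * (t - s))) + integral {0..1} (\<lambda>r. g (p, s + r * (t - s)))"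
    by (intro Henstock_Kurzweil_Integration.integral_add integrable_continuous_interval
        primitive_integrand_continuous[of N J] assms)
  then show ?thesis
    by (simp add: primitive_def scaleR_add_right)
qed

text \<open>On a compact interval around \<open>s\<close> and \<open>t\<close> there is an
  antiderivative \<open>g\<close>, and undoing the rescaling by substitution identifies the
  primitive with \<open>g t - g s\<close>. The factor \<open>t - s\<close> carries the sign, so
  \<open>t < s\<close> is covered as well.\<close>

lemma primitive_has_vector_derivative:
  fixes f :: "'p::topological_space \<times> real \<Rightarrow> 'e::euclidean_space"
  assumes f: "continuous_on (N \<times> {\<alpha><..<\<beta>}) f" and s: "s \<in> {\<alpha><..<\<beta>}" and p: "p \<in> N" and t: "t \<in> {\<alpha><..<\<beta>}"
  shows "((\<lambda>t. primitive s f (p, t)) has_vector_derivative f (p, t)) (at t)"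
proof -
  define a where "a = (\<alpha> + min s t) / 2"
  define b where "b = (\<beta> + max s t) / 2"
  have ab: "\<alpha> < a" "a < s" "a < t" "s < b" "t < b" "b < \<beta>"
    using s t by (auto simp: a_def b_def min_def max_def field_simps)
  have "continuous_on {a..b} (\<lambda>t. f (p, t))"
    by (rule continuous_on_section[OF f p]) (use ab in auto)
  then obtain g where g: "\<And>x. x \<in> {a..b} \<Longrightarrow> (g has_vector_derivative f (p, x)) (at x within {a..b})"
    using antiderivative_continuous by blast
  have eq: "primitive s f (p, t') = g t' - g s" if t': "t' \<in> {a<..<b}" for t'
  proof -
    have "((\<lambda>r. (t' - s) *\<^sub>R f (p, s + r * (t' - s))) has_integral
        (g \<circ> (\<lambda>r. s + r * (t' - s))) 1 - (g \<circ> (\<lambda>r. s + r * (t' - s))) 0) {0..1}"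
    proof (intro fundamental_theorem_of_calculus)
      fix r :: real assume r: "r \<in> {0..1}"
      have im: "(\<lambda>r. s + r * (t' - s)) ` {0..1} \<subseteq> {a..b}"
        using segment_mem[of s "{a..b}" t'] ab t' by (auto simp del: atLeastAtMost_iff) auto
      show "(g \<circ> (\<lambda>r. s + r * (t' - s)) has_vector_derivative
          (t' - s) *\<^sub>R f (p, s + r * (t' - s))) (at r within {0..1})"
      proof (rule vector_diff_chain_within)
        show "((\<lambda>r. s + r * (t' - s)) has_vector_derivative t' - s) (at r within {0..1})"
          by (auto intro!: derivative_eq_intros simp: has_real_derivative_iff_has_vector_derivative[symmetric])
        show "(g has_vector_derivative f (p, s + r * (t' - s))) (at (s + r * (t' - s)) within (\<lambda>r. s + r * (t' - s)) ` {0..1})"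
          by (rule has_vector_derivative_within_subset[OF g im]) (use im r in blast)
      qed
    qed auto
    then have "integral {0..1} (\<lambda>r. (t' - s) *\<^sub>R f (p, s + r * (t' - s))) = g t' - g s"
      by (intro integral_unique) simp
    then show ?thesis by (simp add: primitive_def)
  qed
  have "(g has_vector_derivative f (p, t)) (at t within {a<..<b})"
    using g[of t] ab by (intro has_vector_derivative_within_subset[OF g]) auto
  then have "(g has_vector_derivative f (p, t)) (at t)"
    using ab by (subst (asm) has_vector_derivative_within_open) auto
  then have "((\<lambda>t. g t - g s) has_vector_derivative f (p, t)) (at t)"
    by (auto intro!: derivative_eq_intros)
  then show ?thesis
    by (rule has_vector_derivative_transform_within_open[of _ _ _ "{a<..<b}"]) (use ab eq in auto)
qed

section \<open>Uniqueness, and existence by the Picard series\<close>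

text \<open>On a short interval the maximum of \<open>norm (V t - V' t)\<close> is at most half of itself.\<close>

lemma linear_ode_unique:
  fixes V V' :: "real \<Rightarrow> 'e::euclidean_space"
  assumes V: "\<And>t. t \<in> {a..b} \<Longrightarrow> (V has_vector_derivative A t (V t) + B t) (at t within {a..b})"
    and V': "\<And>t. t \<in> {a..b} \<Longrightarrow> (V' has_vector_derivative A t (V' t) + B t) (at t within {a..b})"
    and lin: "\<And>t. t \<in> {a..b} \<Longrightarrow> linear (A t)"
    and L: "\<And>t w. t \<in> {a..b} \<Longrightarrow> norm (A t w) \<le> L * norm w" "L * (b - a) \<le> 1/2"
    and s: "s \<in> {a..b}" "V s = V' s"
    and t: "t \<in> {a..b}"
  shows "V t = V' t"
proof -
  define R where "R t = V t - V' t" for t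
  have R: "(R has_vector_derivative A t (R t)) (at t within {a..b})" if "t \<in> {a..b}" for t
    unfolding R_def using has_vector_derivative_diff[OF V[OF that] V'[OF that]]
    by (simp add: linear_diff[OF lin[OF that]])
  have cont: "continuous_on {a..b} (\<lambda>t. norm (R t))"
    by (intro continuous_on_norm continuous_on_vector_derivative[of _ R "\<lambda>t. A t (R t)"] R) auto
  obtain m where m: "m \<in> {a..b}" "\<And>t. t \<in> {a..b} \<Longrightarrow> norm (R t) \<le> norm (R m)"
    using continuous_attains_sup[OF compact_Icc _ cont] s by auto
  \<comment> \<open>If \<open>L\<close> is negative, its bound at \<open>R m\<close> already forces
    \<open>R m\<close> to vanish; otherwise the mean value inequality applies.\<close>
  have "L \<ge> 0 \<or> norm (R m) = 0"
  proof -
    have "0 \<le> L * norm (R m)" using L(1)[OF m(1), of "R m"] norm_ge_zero order_trans by blast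
    then show ?thesis by (simp add: zero_le_mult_iff) (use norm_ge_zero in auto)
  qed
  moreover have "norm (R m) \<le> 1/2 * norm (R m)" if "L \<ge> 0"
  proof -
    have "norm (R m - R s) \<le> (L * norm (R m)) * norm (m - s)"
    proof (rule differentiable_bound[of "{a..b}"])
      fix x assume x: "x \<in> {a..b}"
      show "(R has_derivative (\<lambda>h. h *\<^sub>R A x (R x))) (at x within {a..b})"
        using R[OF x] by (simp add: has_vector_derivative_def)
      have "norm (A x (R x)) \<le> L * norm (R m)"
        using L(1)[OF x, of "R x"] m(2)[OF x] that by (meson mult_left_mono order_trans)
      then show "onorm (\<lambda>h. h *\<^sub>R A x (R x)) \<le> L * norm (R m)"
        by (intro onorm_le) (simp add: mult.commute[of "L * _"] mult_left_mono)
    qed (use m s in auto)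
    also have "\<dots> \<le> (L * norm (R m)) * (b - a)"
      using m s that by (intro mult_left_mono) auto
    also have "\<dots> = (L * (b - a)) * norm (R m)" by simp
    also have "\<dots> \<le> 1/2 * norm (R m)" using L(2) by (intro mult_right_mono) auto
    finally show ?thesis using s by (simp add: R_def)
  qed
  ultimately have "norm (R m) \<le> 0" by (auto simp: field_simps)
  then have "norm (R t) \<le> 0" using m(2)[OF t] by linarith
  then show ?thesis by (simp add: R_def)
qed

text \<open>The value \<open>1/2\<close> makes the integral operator of the equation halve suprema,
  whatever the initial time \<open>s\<close> in the interval. Convexity of \<open>N\<close> serves
  the difference quotients, which integrate along segments in the parameter space.\<close>

locale linear_ode =
  fixes N :: "'p::euclidean_space set" and \<alpha> \<beta> s L :: real
    and A :: "'p \<times> real \<Rightarrow> 'e::euclidean_space \<Rightarrow> 'e"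
  assumes open_N: "open N" and convex_N: "convex N" and s: "s \<in> {\<alpha><..<\<beta>}"
    and L: "0 \<le> L" "L * (\<beta> - \<alpha>) \<le> 1/2"
    and lin: "\<And>z. z \<in> N \<times> {\<alpha><..<\<beta>} \<Longrightarrow> linear (A z)"
    and bound: "\<And>z w. z \<in> N \<times> {\<alpha><..<\<beta>} \<Longrightarrow> norm (A z w) \<le> L * norm w"
    and cont: "\<And>w. continuous_on (N \<times> {\<alpha><..<\<beta>}) (\<lambda>z. A z w)"
begin

abbreviation J where "J \<equiv> {\<alpha><..<\<beta>}"

lemma open_NJ: "open (N \<times> J)"
  using open_N by (intro open_Times) auto

lemma A_Basis: "z \<in> N \<times> J \<Longrightarrow> (\<Sum>b\<in>Basis. (w \<bullet> b) *\<^sub>R A z b) = A z w"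
  using linear_sum_Basis[OF lin] by metis

lemma A_continuous:
  assumes "continuous_on (N \<times> J) f"
  shows "continuous_on (N \<times> J) (\<lambda>z. A z (f z))"
proof -
  have "continuous_on (N \<times> J) (\<lambda>z. \<Sum>b\<in>Basis. (f z \<bullet> b) *\<^sub>R A z b)"
    by (intro continuous_intros assms cont)
  then show ?thesis
    by (rule continuous_on_eq) (simp add: A_Basis)
qed

text \<open>These are the increments: the Picard approximations are the partial sums of this Neumann
  series.\<close>

primrec picard :: "('p \<times> real \<Rightarrow> 'e) \<Rightarrow> nat \<Rightarrow> 'p \<times> real \<Rightarrow> 'e" where
  "picard F 0 = F"
| "picard F (Suc n) = primitive s (\<lambda>z. A z (picard F n z))"

lemma picard_continuous:
  assumes "continuous_on (N \<times> J) F"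
  shows "continuous_on (N \<times> J) (picard F n)"
  by (induction n) (use s assms in \<open>auto intro!: primitive_continuous_on A_continuous\<close>)

text \<open>Each further primitive costs \<open>L\<close> times the elapsed time, at most
  \<open>1/2\<close>. The box must contain \<open>s\<close>, because the primitive at
  \<open>t\<close> uses all times between \<open>s\<close> and \<open>t\<close>.\<close>

lemma picard_bound:
  assumes F: "continuous_on (N \<times> J) F" and "K \<subseteq> N" "{a..b} \<subseteq> J" "s \<in> {a..b}"
    and M: "\<And>z. z \<in> K \<times> {a..b} \<Longrightarrow> norm (F z) \<le> M"
  shows "z \<in> K \<times> {a..b} \<Longrightarrow> norm (picard F n z) \<le> M * (1/2)^n"
proof (induction n arbitrary: z)
  case 0
  then show ?case using M by auto
next
  case (Suc n)
  obtain p t where z: "z = (p, t)" "p \<in> K" "t \<in> {a..b}" using Suc.prems by auto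
  have "norm (primitive s (\<lambda>z. A z (picard F n z)) (p, t)) \<le> \<bar>t - s\<bar> * (L * (M * (1/2)^n))"
  proof (rule primitive_bound[of N J])
    fix \<tau> assume "\<tau> \<in> closed_segment s t"
    then have "\<tau> \<in> {a..b}"
      using closed_segment_subset[of s "{a..b}" t] z assms(4) by auto
    then have in1: "(p, \<tau>) \<in> K \<times> {a..b}" using z by auto
    then have "(p, \<tau>) \<in> N \<times> J" using assms by auto
    then have "norm (A (p, \<tau>) (picard F n (p, \<tau>))) \<le> L * norm (picard F n (p, \<tau>))"
      by (rule bound)
    also have "\<dots> \<le> L * (M * (1/2)^n)"
      using Suc.IH[OF in1] L by (intro mult_left_mono)
    finally show "norm (A (p, \<tau>) (picard F n (p, \<tau>))) \<le> L * (M * (1/2)^n)" .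
  qed (use s z assms in \<open>auto intro!: A_continuous picard_continuous F\<close>)
  also have "\<dots> = (L * \<bar>t - s\<bar>) * (M * (1/2)^n)" by simp
  also have "\<dots> \<le> 1/2 * (M * (1/2)^n)"
  proof (rule mult_right_mono)
    have "t \<in> J" using z assms by auto
    then have "\<bar>t - s\<bar> \<le> \<beta> - \<alpha>" using s by auto
    then have "L * \<bar>t - s\<bar> \<le> L * (\<beta> - \<alpha>)" using L by (intro mult_left_mono) auto
    then show "L * \<bar>t - s\<bar> \<le> 1/2" using L by linarith
    have "0 \<le> M" using M[of "(p, t)"] z norm_ge_zero order_trans by blast
    then show "0 \<le> M * (1/2)^n" by simp
  qed
  finally show ?case by (simp add: z)
qed

lemma picard_uniform_limit:
  assumes F: "continuous_on (N \<times> J) F" and K: "compact K" "K \<subseteq> N" "{a..b} \<subseteq> J" "s \<in> {a..b}"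
  shows "uniform_limit (K \<times> {a..b}) (\<lambda>n z. \<Sum>i<n. picard F i z) (\<lambda>z. \<Sum>i. picard F i z) sequentially"
proof -
  have "compact (F ` (K \<times> {a..b}))"
    using K by (intro compact_continuous_image continuous_on_subset[OF F] compact_Times) auto
  then obtain M where M: "\<And>z. z \<in> K \<times> {a..b} \<Longrightarrow> norm (F z) \<le> M"
    using compact_imp_bounded bounded_iff by (metis (no_types, lifting) imageI)
  show ?thesis
    by (rule Weierstrass_m_test[OF picard_bound[OF F K(2-4) M]])
      (auto intro!: summable_mult summable_geometric)
qed

text \<open>\<open>F\<close> may be unbounded on the open box, so convergence is uniform on compact
  pieces only. Such a piece has to contain the initial time besides having (p, t) in its
  interior.\<close>

lemma compact_nbhd:
  assumes "p \<in> N" "t \<in> J"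
  obtains K a b where "compact K" "K \<subseteq> N" "{a..b} \<subseteq> J" "s \<in> {a<..<b}" "p \<in> interior K" "t \<in> {a<..<b}"
proof -
  obtain e where e: "e > 0" "cball p e \<subseteq> N" using assms open_N open_contains_cball by blast
  define a where "a = (\<alpha> + min s t) / 2"
  define b where "b = (\<beta> + max s t) / 2"
  have ab: "\<alpha> < a" "a < s" "a < t" "s < b" "t < b" "b < \<beta>"
    using s assms by (auto simp: a_def b_def min_def max_def field_simps)
  show ?thesis
    by (rule that[of "cball p e" a b]) (use e ab in auto)
qed

text \<open>The fixed point is the sum of the Picard series: uniform convergence on compact boxes
  gives continuity, and the equation is the limit of its version for partial sums.\<close>

lemma ex_continuous_fixpoint:
  assumes F: "continuous_on (N \<times> J) F"
  shows "\<exists>V. continuous_on (N \<times> J) V \<and>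
    (\<forall>z\<in>N \<times> J. V z = F z + primitive s (\<lambda>z. A z (V z)) z)"
proof -
  define V where "V z = (\<Sum>i. picard F i z)" for z
  define S where "S n z = (\<Sum>i<n. picard F i z)" for n z
  have S_cont: "continuous_on (N \<times> J) (S n)" for n
    unfolding S_def by (intro continuous_on_sum picard_continuous F)
  have contV: "continuous_on (N \<times> J) V"
    unfolding continuous_on_eq_continuous_at[OF open_NJ]
  proof
    fix z assume "z \<in> N \<times> J"
    then obtain p t where z: "z = (p, t)" "p \<in> N" "t \<in> J" by auto
    obtain K a b where K: "compact K" "K \<subseteq> N" "{a..b} \<subseteq> J" "s \<in> {a<..<b}" "p \<in> interior K" "t \<in> {a<..<b}"
      using compact_nbhd[OF z(2,3)] .
    have "continuous_on (K \<times> {a..b}) V"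
    proof (rule uniform_limit_theorem[of _ S])
      show "uniform_limit (K \<times> {a..b}) S V sequentially"
        using picard_uniform_limit[OF F K(1-3)] K(4) unfolding S_def V_def by (simp add: less_imp_le)
      show "\<forall>\<^sub>F n in sequentially. continuous_on (K \<times> {a..b}) (S n)"
        using K by (intro always_eventually allI continuous_on_subset[OF S_cont]) auto
    qed auto
    moreover have "z \<in> interior (K \<times> {a..b})"
      unfolding interior_Times using z K by auto
    ultimately show "isCont V z"
      using continuous_on_interior by blast
  qed
  have S_Suc: "S (Suc n) z = F z + primitive s (\<lambda>z. A z (S n z)) z" if "z \<in> N \<times> J" for n z
  proof (induction n)
    case 0
    have A0: "A z 0 = 0" if "z \<in> N \<times> J" for z using linear_0[OF lin[OF that]] .
    obtain p t where z: "z = (p, t)" "p \<in> N" "t \<in> J" using \<open>z \<in> N \<times> J\<close> by auto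
    have "A (p, s + r * (t - s)) 0 = 0" if "r \<in> {0..1}" for r :: real
      by (rule A0) (use segment_mem[OF s z(3), of r] z(2) that in simp)
    then have "integral {0..1} (\<lambda>r. A (p, s + r * (t - s)) 0) = integral {0..1::real} (\<lambda>r. 0::'e)"
      by (intro Henstock_Kurzweil_Integration.integral_cong) auto
    then show ?case using z by (simp add: S_def primitive_def)
  next
    case (Suc n)
    obtain p t where z: "z = (p, t)" "p \<in> N" "t \<in> J" using \<open>z \<in> N \<times> J\<close> by auto
    have "S (Suc (Suc n)) z = S (Suc n) z + picard F (Suc n) z"
      by (simp add: S_def)
    also have "\<dots> = F z + (primitive s (\<lambda>z. A z (S n z)) z + primitive s (\<lambda>z. A z (picard F n z)) z)"
      using Suc by simp
    also have "\<dots> = F z + primitive s (\<lambda>z. A z (S n z) + A z (picard F n z)) z"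
      using z s by (simp add: primitive_add[of N J] A_continuous S_cont picard_continuous F)
    also have "primitive s (\<lambda>z. A z (S n z) + A z (picard F n z)) z = primitive s (\<lambda>z. A z (S (Suc n) z)) z"
    proof -
      have "A (p, s + r * (t - s)) (S n (p, s + r * (t - s))) + A (p, s + r * (t - s)) (picard F n (p, s + r * (t - s)))
         = A (p, s + r * (t - s)) (S (Suc n) (p, s + r * (t - s)))" if "r \<in> {0..1}" for r :: real
        using lin[of "(p, s + r * (t - s))"] segment_mem[OF s z(3), of r] z that
        by (simp add: S_def linear_add)
      then have "integral {0..1} (\<lambda>r. A (p, s + r * (t - s)) (S n (p, s + r * (t - s))) + A (p, s + r * (t - s)) (picard F n (p, s + r * (t - s))))
         = integral {0..1} (\<lambda>r. A (p, s + r * (t - s)) (S (Suc n) (p, s + r * (t - s))))"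
        by (intro Henstock_Kurzweil_Integration.integral_cong) auto
      then show ?thesis by (simp add: primitive_def z(1))
    qed
    finally show ?case .
  qed
  have "V z = F z + primitive s (\<lambda>z. A z (V z)) z" if "z \<in> N \<times> J" for z
  proof -
    obtain p t where z: "z = (p, t)" "p \<in> N" "t \<in> J" using \<open>z \<in> N \<times> J\<close> by auto
    obtain K a b where K: "compact K" "K \<subseteq> N" "{a..b} \<subseteq> J" "s \<in> {a<..<b}" "p \<in> interior K" "t \<in> {a<..<b}"
      using compact_nbhd[OF z(2,3)] .
    have ul: "uniform_limit (K \<times> {a..b}) S V sequentially"
      using picard_uniform_limit[OF F K(1-3)] K(4) unfolding S_def V_def by (simp add: less_imp_le)
    have zK: "(p, \<tau>) \<in> K \<times> {a..b}" if "\<tau> \<in> closed_segment s t" for \<tau>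
      using that closed_segment_subset[of s "{a..b}" t] K interior_subset[of K] by auto
    have 1: "(\<lambda>n. S (Suc n) z) \<longlonglongrightarrow> V z"
      using LIMSEQ_Suc[OF tendsto_uniform_limitI[OF ul zK[of t]]] z by simp
    \<comment> \<open>By linearity the difference of the two primitives is that of \<open>A\<close>
      applied to \<open>S n - V\<close>, which is uniformly below \<open>e\<close> between
      \<open>s\<close> and \<open>t\<close>; the halving leaves at most
      \<open>e / 2\<close>.\<close>
    have "(\<lambda>n. primitive s (\<lambda>z. A z (S n z)) z) \<longlonglongrightarrow> primitive s (\<lambda>z. A z (V z)) z"
    proof (rule metric_LIMSEQ_I)
      fix e :: real assume e: "e > 0"
      have "\<forall>\<^sub>F n in sequentially. \<forall>z\<in>K \<times> {a..b}. dist (S n z) (V z) < e"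
        using uniform_limitD[OF ul e] .
      then obtain n0 where n0: "\<And>n z. n \<ge> n0 \<Longrightarrow> z \<in> K \<times> {a..b} \<Longrightarrow> dist (S n z) (V z) < e"
        unfolding eventually_sequentially by blast
      have "dist (primitive s (\<lambda>z. A z (S n z)) z) (primitive s (\<lambda>z. A z (V z)) z) < e" if n: "n \<ge> n0" for n
      proof -
        let ?d = "\<lambda>z. A z (S n z - V z)"
        have cd: "continuous_on (N \<times> J) ?d"
          by (intro A_continuous continuous_on_diff S_cont contV)
        have "primitive s (\<lambda>z. ?d z + A z (V z)) z = primitive s ?d z + primitive s (\<lambda>z. A z (V z)) z"
          unfolding z(1) using z s by (intro primitive_add[of N J] cd A_continuous contV) auto
        moreover have "primitive s (\<lambda>z. ?d z + A z (V z)) z = primitive s (\<lambda>z. A z (S n z)) z"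
        proof -
          have "?d (p, s + r * (t - s)) + A (p, s + r * (t - s)) (V (p, s + r * (t - s)))
             = A (p, s + r * (t - s)) (S n (p, s + r * (t - s)))" if "r \<in> {0..1}" for r :: real
            using lin[of "(p, s + r * (t - s))"] segment_mem[OF s z(3), of r] z that
            by (simp add: linear_diff)
          then have "integral {0..1} (\<lambda>r. ?d (p, s + r * (t - s)) + A (p, s + r * (t - s)) (V (p, s + r * (t - s))))
             = integral {0..1} (\<lambda>r. A (p, s + r * (t - s)) (S n (p, s + r * (t - s))))"
            by (intro Henstock_Kurzweil_Integration.integral_cong) auto
          then show ?thesis by (simp add: primitive_def z(1))
        qed
        ultimately have eq: "primitive s (\<lambda>z. A z (S n z)) z - primitive s (\<lambda>z. A z (V z)) z = primitive s ?d z"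
          by simp
        have "norm (primitive s ?d (p, t)) \<le> \<bar>t - s\<bar> * (L * e)"
        proof (rule primitive_bound[of N J, OF cd])
          fix \<tau> assume \<tau>: "\<tau> \<in> closed_segment s t"
          have in1: "(p, \<tau>) \<in> N \<times> J" using zK[OF \<tau>] K by auto
          have "norm (A (p, \<tau>) (S n (p, \<tau>) - V (p, \<tau>))) \<le> L * norm (S n (p, \<tau>) - V (p, \<tau>))"
            using bound[OF in1] .
          also have "\<dots> \<le> L * e"
            using n0[OF n zK[OF \<tau>]] L by (intro mult_left_mono) (auto simp: dist_norm)
          finally show "norm (A (p, \<tau>) (S n (p, \<tau>) - V (p, \<tau>))) \<le> L * e" .
        qed (use z s in auto)
        also have "\<bar>t - s\<bar> * (L * e) \<le> 1/2 * e"
        proof -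
          have "\<bar>t - s\<bar> * L \<le> (\<beta> - \<alpha>) * L" using z s L by (intro mult_right_mono) auto
          then have "\<bar>t - s\<bar> * L \<le> 1/2" using L by (simp add: mult.commute)
          then have "(\<bar>t - s\<bar> * L) * e \<le> 1/2 * e" using e by (intro mult_right_mono) auto
          then show ?thesis by (simp add: mult.assoc)
        qed
        finally have "norm (primitive s ?d z) \<le> 1/2 * e" by (simp only: z(1))
        then show ?thesis using e unfolding dist_norm eq by linarith
      qed
      then show "\<exists>no. \<forall>n\<ge>no. dist (primitive s (\<lambda>z. A z (S n z)) z) (primitive s (\<lambda>z. A z (V z)) z) < e"
        by blast
    qed
    then have "(\<lambda>n. F z + primitive s (\<lambda>z. A z (S n z)) z) \<longlonglongrightarrow> F z + primitive s (\<lambda>z. A z (V z)) z"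
      by (intro tendsto_intros)
    then have "(\<lambda>n. S (Suc n) z) \<longlonglongrightarrow> F z + primitive s (\<lambda>z. A z (V z)) z"
      unfolding S_Suc[OF that] .
    then show ?thesis using 1 LIMSEQ_unique by blast
  qed
  then show ?thesis using contV by blast
qed

text \<open>Only the time derivative is prescribed; regularity in the parameter is deduced
  afterwards, from uniqueness.\<close>

definition is_solution :: "('p \<times> real \<Rightarrow> 'e) \<Rightarrow> ('p \<Rightarrow> 'e) \<Rightarrow> ('p \<times> real \<Rightarrow> 'e) \<Rightarrow> bool" where
  "is_solution V c B \<longleftrightarrow> (\<forall>p\<in>N. V (p, s) = c p) \<and>
     (\<forall>p\<in>N. \<forall>t\<in>J. ((\<lambda>t. V (p, t)) has_vector_derivative A (p, t) (V (p, t)) + B (p, t)) (at t))"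

lemma ex_solution:
  assumes c: "continuous_on N c" and B: "continuous_on (N \<times> J) B"
  shows "\<exists>V. continuous_on (N \<times> J) V \<and> is_solution V c B"
proof -
  \<comment> \<open>Initial value and inhomogeneity are absorbed into the free term; all primitives
    vanish at \<open>s\<close>, which leaves the initial value there.\<close>
  define F where "F z = c (fst z) + primitive s B z" for z
  have "continuous_on (N \<times> J) (\<lambda>z. c (fst z))"
    by (rule continuous_on_compose2[OF c]) (auto intro!: continuous_intros)
  then have "continuous_on (N \<times> J) F"
    unfolding F_def using s B by (intro continuous_on_add primitive_continuous_on) auto
  then obtain V where V: "continuous_on (N \<times> J) V"
    and eq: "\<And>z. z \<in> N \<times> J \<Longrightarrow> V z = F z + primitive s (\<lambda>z. A z (V z)) z"
    using ex_continuous_fixpoint by metis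
  have "V (p, s) = c p" if "p \<in> N" for p
    using eq[of "(p, s)"] that s by (simp add: F_def primitive_def)
  moreover have "((\<lambda>t. V (p, t)) has_vector_derivative A (p, t) (V (p, t)) + B (p, t)) (at t)"
    if "p \<in> N" "t \<in> J" for p t
  proof -
    have "((\<lambda>t. (c p + primitive s B (p, t)) + primitive s (\<lambda>z. A z (V z)) (p, t))
        has_vector_derivative (0 + B (p, t)) + A (p, t) (V (p, t))) (at t)"
      using that s B V
      by (intro has_vector_derivative_add has_vector_derivative_const
          primitive_has_vector_derivative[of N \<alpha> \<beta>, THEN has_vector_derivative_eq_rhs] A_continuous) auto
    then have "((\<lambda>t. V (p, t)) has_vector_derivative (0 + B (p, t)) + A (p, t) (V (p, t))) (at t)"
      by (rule has_vector_derivative_transform_within_open[of _ _ _ J])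
        (use that eq in \<open>auto simp: F_def\<close>)
    then show ?thesis by (simp add: add.commute)
  qed
  ultimately show ?thesis using V unfolding is_solution_def by blast
qed

lemma solution_unique_at:
  assumes p: "p \<in> N"
    and V: "\<And>t. t \<in> J \<Longrightarrow> (V has_vector_derivative A (p, t) (V t) + B t) (at t)"
    and V': "\<And>t. t \<in> J \<Longrightarrow> (V' has_vector_derivative A (p, t) (V' t) + B t) (at t)"
    and eq: "V r = V' r" "r \<in> J" and t: "t \<in> J"
  shows "V t = V' t"
proof -
  have J: "{min r t..max r t} \<subseteq> J" using t eq by auto
  have "L * (max r t - min r t) \<le> L * (\<beta> - \<alpha>)"
    using t eq L by (intro mult_left_mono) auto
  then have L': "L * (max r t - min r t) \<le> 1/2" using L by linarith
  show ?thesis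
    by (rule linear_ode_unique[of "min r t" "max r t" V "\<lambda>t. A (p, t)" B V' L r])
      (use J p L' eq in \<open>auto intro!: has_vector_derivative_at_within[OF V] has_vector_derivative_at_within[OF V'] lin bound\<close>)
qed

lemma solution_unique:
  assumes "is_solution V c B" "is_solution V' c B" "z \<in> N \<times> J"
  shows "V z = V' z"
proof -
  obtain p t where z: "z = (p, t)" "p \<in> N" "t \<in> J" using assms by auto
  show ?thesis
    unfolding z(1)
    by (rule solution_unique_at[of p "\<lambda>t. V (p, t)" "\<lambda>t. B (p, t)" "\<lambda>t. V' (p, t)" s])
      (use assms z s in \<open>auto simp: is_solution_def\<close>)
qed

text \<open>A continuous solution with the same data exists, and uniqueness identifies it with the
  given one.\<close>

lemma solution_continuous:
  assumes c: "continuous_on N c" and B: "continuous_on (N \<times> J) B" and V: "is_solution V c B"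
  shows "continuous_on (N \<times> J) V"
proof -
  obtain V' where V': "continuous_on (N \<times> J) V'" "is_solution V' c B"
    using ex_solution[OF c B] by blast
  show ?thesis
    by (rule continuous_on_eq[OF V'(1)]) (rule solution_unique[OF V'(2) V])
qed

end

section \<open>Differentiable dependence on parameters\<close>

lemma differentiable_upto_Suc_0:
  assumes "differentiable_upto (Suc k) S f"
  shows "differentiable_upto (Suc 0) S f"
  using assms differentiable_upto_continuous_on[OF differentiable_upto_SucD(2)[OF assms]] by simp

text \<open>The quotient \<open>g\<close> is the mean of the derivative along the segment.\<close>

lemma difference_quotient:
  fixes f :: "'p::euclidean_space \<times> real \<Rightarrow> 'e::euclidean_space"
  assumes N: "open N" "convex N" and J: "open J" and f: "differentiable_upto (Suc 0) (N \<times> J) f"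
    and p: "p \<in> N"
  shows "\<exists>g. continuous_on ({h. p + h *\<^sub>R q \<in> N} \<times> J) g \<and>
    (\<forall>h t. p + h *\<^sub>R q \<in> N \<longrightarrow> t \<in> J \<longrightarrow> f (p + h *\<^sub>R q, t) = f (p, t) + h *\<^sub>R g (h, t)) \<and>
    (\<forall>t\<in>J. g (0, t) = frechet_derivative f (at (p, t)) (q, 0))"
proof -
  let ?H = "{h. p + h *\<^sub>R q \<in> N}"
  let ?f' = "\<lambda>z. frechet_derivative f (at z) (q, 0)"
  define g where "g z = integral {0..1} (\<lambda>r. ?f' (p + (r * fst z) *\<^sub>R q, snd z))" for z :: "real \<times> real"
  have mem: "p + (r * h) *\<^sub>R q \<in> N" if "p + h *\<^sub>R q \<in> N" "r \<in> {0..1}" for r h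
  proof -
    have "(1 - r) *\<^sub>R p + r *\<^sub>R (p + h *\<^sub>R q) \<in> N"
      using that p N by (intro convexD) auto
    then show ?thesis by (simp add: algebra_simps)
  qed
  have f': "continuous_on (N \<times> J) ?f'"
    using f by simp
  have fd: "(f has_derivative frechet_derivative f (at z)) (at z)" if "z \<in> N \<times> J" for z
    by (rule differentiable_upto_SucD(1)[OF f that])
  have cont: "continuous_on ((?H \<times> J) \<times> cbox 0 1) (\<lambda>x. ?f' (p + (snd x * fst (fst x)) *\<^sub>R q, snd (fst x)))"
    by (rule continuous_on_compose2[OF f']) (auto intro!: continuous_intros mem)
  then have "continuous_on (?H \<times> J) (\<lambda>z. integral (cbox 0 1) (\<lambda>r. ?f' (p + (r * fst z) *\<^sub>R q, snd z)))"
    by (intro integral_continuous_on_param) (simp add: case_prod_beta)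
  then have 1: "continuous_on (?H \<times> J) g" by (simp add: g_def[abs_def])
  have 2: "f (p + h *\<^sub>R q, t) = f (p, t) + h *\<^sub>R g (h, t)" if h: "p + h *\<^sub>R q \<in> N" and t: "t \<in> J" for h t
  proof -
    have "((\<lambda>r. h *\<^sub>R ?f' (p + (r * h) *\<^sub>R q, t)) has_integral
        f (p + (1 * h) *\<^sub>R q, t) - f (p + (0 * h) *\<^sub>R q, t)) {0..1}"
    proof (rule fundamental_theorem_of_calculus)
      fix r :: real assume r: "r \<in> {0..1}"
      have in1: "(p + (r * h) *\<^sub>R q, t) \<in> N \<times> J" using mem[OF h r] t by auto
      have 1: "((\<lambda>r. (p + (r * h) *\<^sub>R q, t)) has_derivative (\<lambda>d. d *\<^sub>R (h *\<^sub>R (q, 0)))) (at r within {0..1})"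
        by (auto intro!: derivative_eq_intros simp: algebra_simps)
      have "((\<lambda>r. f (p + (r * h) *\<^sub>R q, t)) has_derivative
          (\<lambda>d. frechet_derivative f (at (p + (r * h) *\<^sub>R q, t)) (d *\<^sub>R (h *\<^sub>R (q, 0))))) (at r within {0..1})"
        by (rule has_derivative_compose[OF 1 fd[OF in1]])
      then show "((\<lambda>r. f (p + (r * h) *\<^sub>R q, t)) has_vector_derivative h *\<^sub>R ?f' (p + (r * h) *\<^sub>R q, t)) (at r within {0..1})"
        unfolding has_vector_derivative_def linear_cmul[OF has_derivative_linear[OF fd[OF in1]]] .
    qed simp
    then have "integral {0..1} (\<lambda>r. h *\<^sub>R ?f' (p + (r * h) *\<^sub>R q, t)) = f (p + h *\<^sub>R q, t) - f (p, t)"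
      by (intro integral_unique) simp
    then show ?thesis by (simp add: g_def)
  qed
  have 3: "g (0, t) = ?f' (p, t)" for t
    by (simp add: g_def)
  show ?thesis using 1 2 3 by blast
qed

text \<open>This is Caratheodory's form of differentiability: the quotient extends continuously to
  step 0, and its value there is the derivative.\<close>

lemma has_vector_derivative_of_quotient:
  fixes f g :: "real \<Rightarrow> 'e::real_normed_vector"
  assumes "open H" "0 \<in> H" "\<And>h. h \<in> H \<Longrightarrow> f h = f 0 + h *\<^sub>R g h" "isCont g 0"
  shows "(f has_vector_derivative g 0) (at 0)"
proof -
  have "((\<lambda>h. norm (g h - g 0)) \<longlongrightarrow> 0) (at 0)"
    using assms(4) by (simp add: isCont_def LIM_zero tendsto_norm_zero)
  then have "((\<lambda>h. norm (f (0 + h) - f 0 - h *\<^sub>R g 0) / norm h) \<longlongrightarrow> 0) (at 0)"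
  proof (rule Lim_transform_within_open[OF _ assms(1,2)])
    fix h assume h: "h \<in> H" "h \<noteq> 0"
    have "f (0 + h) - f 0 - h *\<^sub>R g 0 = h *\<^sub>R (g h - g 0)"
      using assms(3)[OF h(1)] by (simp add: algebra_simps)
    then show "norm (g h - g 0) = norm (f (0 + h) - f 0 - h *\<^sub>R g 0) / norm h"
      using h by simp
  qed
  then show ?thesis
    unfolding has_vector_derivative_def has_derivative_at
    by (simp add: bounded_linear_scaleR_left)
qed

context linear_ode
begin

text \<open>The difference quotient of a solution solves a linear equation whose coefficients depend
  continuously on the step \<open>h\<close>, up to \<open>h = 0\<close>. Hence it converges as \<open>h\<close> tends to \<open>0\<close>, to the
  solution of the linearized equation.\<close>

lemma solution_directional_derivative:
  assumes A: "\<And>w. differentiable_upto (Suc 0) (N \<times> J) (\<lambda>z. A z w)"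
    and B: "differentiable_upto (Suc 0) (N \<times> J) B" and c: "differentiable_upto (Suc 0) N c"
    and V: "continuous_on (N \<times> J) V" "is_solution V c B"
    and W: "is_solution W (\<lambda>p. frechet_derivative c (at p) q)
      (\<lambda>z. (\<Sum>b\<in>Basis. (V z \<bullet> b) *\<^sub>R frechet_derivative (\<lambda>z. A z b) (at z) (q, 0)) + frechet_derivative B (at z) (q, 0))"
    and p: "p \<in> N" and t: "t \<in> J"
  shows "((\<lambda>h. V (p + h *\<^sub>R q, t)) has_vector_derivative W (p, t)) (at 0)"
proof -
  define H where "H = {h. p + h *\<^sub>R q \<in> N}"
  have openH: "open H"
    using open_vimage[OF open_N, of "\<lambda>h. p + h *\<^sub>R q"]
    by (simp add: H_def vimage_def continuous_intros)
  have convexH: "convex H"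
  proof (rule convexI)
    fix x y u v :: real assume *: "x \<in> H" "y \<in> H" "0 \<le> u" "0 \<le> v" "u + v = 1"
    then have "u *\<^sub>R (p + x *\<^sub>R q) + v *\<^sub>R (p + y *\<^sub>R q) \<in> N"
      using convex_N by (intro convexD) (auto simp: H_def)
    also have "u *\<^sub>R (p + x *\<^sub>R q) + v *\<^sub>R (p + y *\<^sub>R q) = (u + v) *\<^sub>R p + (u * x + v * y) *\<^sub>R q"
      by (simp add: algebra_simps)
    finally show "u *\<^sub>R x + v *\<^sub>R y \<in> H" using * by (simp add: H_def)
  qed
  have H0: "0 \<in> H" using p by (simp add: H_def)
  note quot = difference_quotient[OF open_N convex_N open_greaterThanLessThan _ p, where q = q, folded H_def]
  have "\<exists>g. \<forall>b. continuous_on (H \<times> J) (g b) \<and>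
    (\<forall>h t. h \<in> H \<longrightarrow> t \<in> J \<longrightarrow> A (p + h *\<^sub>R q, t) b = A (p, t) b + h *\<^sub>R g b (h, t)) \<and>
    (\<forall>t\<in>J. g b (0, t) = frechet_derivative (\<lambda>z. A z b) (at (p, t)) (q, 0))"
    using quot[OF A] unfolding H_def mem_Collect_eq by (intro choice allI)
  then obtain gA where gA: "\<And>b. continuous_on (H \<times> J) (gA b)"
    "\<And>b h t. h \<in> H \<Longrightarrow> t \<in> J \<Longrightarrow> A (p + h *\<^sub>R q, t) b = A (p, t) b + h *\<^sub>R gA b (h, t)"
    "\<And>b t. t \<in> J \<Longrightarrow> gA b (0, t) = frechet_derivative (\<lambda>z. A z b) (at (p, t)) (q, 0)"
    by blast
  obtain gB where gB: "continuous_on (H \<times> J) gB"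
    "\<And>h t. h \<in> H \<Longrightarrow> t \<in> J \<Longrightarrow> B (p + h *\<^sub>R q, t) = B (p, t) + h *\<^sub>R gB (h, t)"
    "\<And>t. t \<in> J \<Longrightarrow> gB (0, t) = frechet_derivative B (at (p, t)) (q, 0)"
    using quot[OF B] unfolding H_def mem_Collect_eq by blast
  have cd: "((\<lambda>z. c (fst z)) has_derivative (\<lambda>v. frechet_derivative c (at (fst z)) (fst v))) (at z)"
    if "z \<in> N \<times> J" for z
  proof -
    have "(c has_derivative frechet_derivative c (at (fst z))) (at (fst z))"
      using differentiable_upto_SucD(1)[OF c] that by auto
    then show ?thesis
      using has_derivative_compose[OF has_derivative_fst[OF has_derivative_ident]] by blast
  qed
  \<comment> \<open>The quotient lemma concerns functions on the product, so the initial value is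
    regarded as independent of time.\<close>
  have "differentiable_upto (Suc 0) (N \<times> J) (\<lambda>z. c (fst z))"
    by (rule differentiable_upto_compose[OF open_NJ open_N _ c])
      (auto intro!: differentiable_upto_linear bounded_linear_fst open_NJ simp del: differentiable_upto.simps)
  from quot[OF this]
  obtain gc where gc: "continuous_on (H \<times> J) gc"
    "\<And>h t. h \<in> H \<Longrightarrow> t \<in> J \<Longrightarrow> c (p + h *\<^sub>R q) = c p + h *\<^sub>R gc (h, t)"
    "\<And>t. t \<in> J \<Longrightarrow> gc (0, t) = frechet_derivative (\<lambda>z. c (fst z)) (at (p, t)) (q, 0)"
    unfolding H_def mem_Collect_eq fst_conv by blast
  have gc0: "gc (0, s) = frechet_derivative c (at p) q"
    using gc(3)[OF s] frechet_derivative_at[OF cd[of "(p, s)"]] p s by (metis SigmaI fst_conv)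
  \<comment> \<open>The coefficient is frozen at the parameter \<open>p\<close>, so that the
    equation for the quotient has a linear part independent of \<open>h\<close>; the change of the
    coefficient enters through the inhomogeneity \<open>B'\<close>, where the known solution at
    \<open>p + h *\<^sub>R q\<close> appears.\<close>
  define A' where "A' z = A (p, snd z)" for z :: "real \<times> real"
  interpret Q: linear_ode H \<alpha> \<beta> s L A'
  proof (rule linear_ode.intro)
    show "continuous_on (H \<times> J) (\<lambda>z. A' z w)" for w
      unfolding A'_def using p by (intro continuous_on_compose2[OF cont]) (auto intro!: continuous_intros)
  qed (use openH convexH s L p lin bound in \<open>auto simp: A'_def\<close>)
  define B' where "B' z = (\<Sum>b\<in>Basis. (V (p + fst z *\<^sub>R q, snd z) \<bullet> b) *\<^sub>R gA b z) + gB z" for z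
  have "continuous_on (H \<times> J) (\<lambda>z. V (p + fst z *\<^sub>R q, snd z))"
    by (rule continuous_on_compose2[OF V(1)]) (auto intro!: continuous_intros simp: H_def)
  then have "continuous_on (H \<times> J) B'"
    unfolding B'_def by (intro continuous_intros gA gB)
  moreover have "continuous_on H (\<lambda>h. gc (h, s))"
    by (rule continuous_on_compose2[OF gc(1)]) (use s in \<open>auto intro!: continuous_intros\<close>)
  ultimately obtain Y where Y: "continuous_on (H \<times> J) Y" "Q.is_solution Y (\<lambda>h. gc (h, s)) B'"
    using Q.ex_solution by blast
  have Vh: "V (p + h *\<^sub>R q, t) = V (p, t) + h *\<^sub>R Y (h, t)" if h: "h \<in> H" for h
  proof -
    \<comment> \<open>The defect of the expected expansion solves the homogeneous equation at
      \<open>p\<close> with initial value 0.\<close>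
    define U where "U t = V (p + h *\<^sub>R q, t) - V (p, t) - h *\<^sub>R Y (h, t)" for t
    have ph: "p + h *\<^sub>R q \<in> N" using h by (simp add: H_def)
    have "U t = 0"
    proof (rule solution_unique_at[OF p, where B = "\<lambda>t. 0" and r = s and V' = "\<lambda>t. 0"])
      show "U s = 0"
        using V(2) Y(2) p ph h gc(2)[OF h s] by (simp add: is_solution_def Q.is_solution_def U_def)
      fix t assume t: "t \<in> J"
      have "(U has_vector_derivative
          (A (p + h *\<^sub>R q, t) (V (p + h *\<^sub>R q, t)) + B (p + h *\<^sub>R q, t)) - (A (p, t) (V (p, t)) + B (p, t))
            - h *\<^sub>R (A' (h, t) (Y (h, t)) + B' (h, t))) (at t)"
        unfolding U_def
        by (intro has_vector_derivative_diff bounded_linear.has_vector_derivative[OF bounded_linear_scaleR_right])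
          (use V(2) Y(2) p ph h t in \<open>auto simp: is_solution_def Q.is_solution_def\<close>)
      note U' = this
      have Aq: "A (p + h *\<^sub>R q, t) w = A (p, t) w + h *\<^sub>R (\<Sum>b\<in>Basis. (w \<bullet> b) *\<^sub>R gA b (h, t))" for w
      proof -
        have "A (p + h *\<^sub>R q, t) w = (\<Sum>b\<in>Basis. (w \<bullet> b) *\<^sub>R (A (p, t) b + h *\<^sub>R gA b (h, t)))"
          using A_Basis[of "(p + h *\<^sub>R q, t)" w] ph t gA(2)[OF h t] by simp
        also have "\<dots> = (\<Sum>b\<in>Basis. (w \<bullet> b) *\<^sub>R A (p, t) b) + h *\<^sub>R (\<Sum>b\<in>Basis. (w \<bullet> b) *\<^sub>R gA b (h, t))"
          by (simp add: scaleR_add_right sum.distrib scaleR_sum_right mult.commute)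
        also have "(\<Sum>b\<in>Basis. (w \<bullet> b) *\<^sub>R A (p, t) b) = A (p, t) w"
          using A_Basis[of "(p, t)" w] p t by simp
        finally show ?thesis .
      qed
      have AU: "A (p, t) (U t) = A (p, t) (V (p + h *\<^sub>R q, t)) - A (p, t) (V (p, t)) - h *\<^sub>R A (p, t) (Y (h, t))"
        using lin[of "(p, t)"] p t by (simp add: U_def linear_diff linear_cmul)
      show "(U has_vector_derivative A (p, t) (U t) + 0) (at t)"
        by (rule has_vector_derivative_eq_rhs[OF U'])
          (simp add: AU Aq gB(2)[OF h t] A'_def B'_def algebra_simps)
      show "((\<lambda>t. 0) has_vector_derivative A (p, t) 0 + 0) (at t)"
        using linear_0[OF lin[of "(p, t)"]] p t by simp
    qed (use s t in auto)
    then show ?thesis by (simp add: U_def algebra_simps)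
  qed
  have "isCont (\<lambda>h. Y (h, t)) 0"
  proof -
    have "continuous_on H (\<lambda>h. Y (h, t))"
      by (rule continuous_on_compose2[OF Y(1)]) (use t in \<open>auto intro!: continuous_intros\<close>)
    then show ?thesis using openH H0 continuous_on_eq_continuous_at by blast
  qed
  then have "((\<lambda>h. V (p + h *\<^sub>R q, t)) has_vector_derivative Y (0, t)) (at 0)"
    using Vh by (intro has_vector_derivative_of_quotient[OF openH H0, where g = "\<lambda>h. Y (h, t)"]) auto
  \<comment> \<open>At step 0 the difference quotients of the data become their derivatives, so
    \<open>Y\<close> satisfies the linearized equation solved by \<open>W\<close>.\<close>
  moreover have "Y (0, t) = W (p, t)"
  proof (rule solution_unique_at[OF p, where B = "\<lambda>t. B' (0, t)" and r = s and V = "\<lambda>t. Y (0, t)" and V' = "\<lambda>t. W (p, t)"])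
    show "Y (0, s) = W (p, s)"
      using Y(2) W H0 p gc0 by (simp add: is_solution_def Q.is_solution_def)
    fix t assume t: "t \<in> J"
    show "((\<lambda>t. Y (0, t)) has_vector_derivative A (p, t) (Y (0, t)) + B' (0, t)) (at t)"
      using Y(2) H0 t by (simp add: Q.is_solution_def A'_def)
    show "((\<lambda>t. W (p, t)) has_vector_derivative A (p, t) (W (p, t)) + B' (0, t)) (at t)"
      using W p t gA(3)[OF t] gB(3)[OF t] by (simp add: is_solution_def B'_def)
  qed (use s t in auto)
  ultimately show ?thesis by simp
qed

text \<open>The parameter derivatives solve an equation with the same linear part and data of one
  order less, and the time derivative is given by the equation itself. The new inhomogeneity
  contains \<open>V\<close>, hence the induction runs over all \<open>B\<close>, \<open>c\<close>
  and \<open>V\<close> at once.\<close>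

lemma solution_differentiable_upto:
  assumes A: "\<And>w. smooth_open (N \<times> J) (\<lambda>z. A z w)"
  shows "\<lbrakk>differentiable_upto k (N \<times> J) B; differentiable_upto k N c; is_solution V c B\<rbrakk> \<Longrightarrow>
    differentiable_upto k (N \<times> J) V"
proof (induction k arbitrary: B c V)
  case 0
  then show ?case by (simp add: solution_continuous)
next
  case (Suc k)
  have B1: "differentiable_upto (Suc 0) (N \<times> J) B" and c1: "differentiable_upto (Suc 0) N c"
    by (rule differentiable_upto_Suc_0[OF Suc.prems(1)], rule differentiable_upto_Suc_0[OF Suc.prems(2)])
  \<comment> \<open>The induction hypothesis is used twice: here for \<open>V\<close> itself, so
    that the linearized inhomogeneity has order \<open>k\<close>, and below for the solutions of the
    linearized equation.\<close>
  have V: "differentiable_upto k (N \<times> J) V"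
    by (rule Suc.IH[OF differentiable_upto_lower differentiable_upto_lower]) (rule Suc.prems)+
  then have Vc: "continuous_on (N \<times> J) V" by (rule differentiable_upto_continuous_on)
  define Bq where "Bq q z = (\<Sum>b\<in>Basis. (V z \<bullet> b) *\<^sub>R frechet_derivative (\<lambda>z. A z b) (at z) (q, 0)) + frechet_derivative B (at z) (q, 0)" for q z
  have Bq: "differentiable_upto k (N \<times> J) (Bq q)" for q
    unfolding Bq_def
    by (intro differentiable_upto_add differentiable_upto_sum differentiable_upto_scaleR open_NJ finite_Basis
        differentiable_upto_bounded_linear[OF bounded_linear_inner_left] V
        smooth_openD[OF smooth_open_frechet[OF A]] differentiable_upto_SucD(2)[OF Suc.prems(1)])
  have cq: "differentiable_upto k N (\<lambda>p. frechet_derivative c (at p) q)" for q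
    by (rule differentiable_upto_SucD(2)[OF Suc.prems(2)])
  have "\<exists>W. is_solution W (\<lambda>p. frechet_derivative c (at p) q) (Bq q)" for q
    using ex_solution[OF differentiable_upto_continuous_on[OF cq] differentiable_upto_continuous_on[OF Bq]] by blast
  then obtain W where W: "\<And>q. is_solution (W q) (\<lambda>p. frechet_derivative c (at p) q) (Bq q)"
    by metis
  have Wk: "differentiable_upto k (N \<times> J) (W q)" for q
    by (rule Suc.IH[OF Bq cq W])
  \<comment> \<open>A basis vector of the product is either (b, 0), a parameter direction, or (0,
    1), the time direction.\<close>
  define D where "D b z = (if snd b = 0 then W (fst b) z else A z (V z) + B z)" for b :: "'p \<times> real" and z
  have Ak: "differentiable_upto k (N \<times> J) (\<lambda>z. A z (V z))"
  proof (rule differentiable_upto_cong[OF open_NJ A_Basis])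
    show "differentiable_upto k (N \<times> J) (\<lambda>z. \<Sum>b\<in>Basis. (V z \<bullet> b) *\<^sub>R A z b)"
      by (intro differentiable_upto_sum differentiable_upto_scaleR open_NJ finite_Basis
        differentiable_upto_bounded_linear[OF bounded_linear_inner_left] V smooth_openD[OF A])
  qed
  show ?case
  proof (rule differentiable_upto_Suc_partials[OF open_NJ, of V D])
    fix b z :: "'p \<times> real" assume b: "b \<in> Basis" and z: "z \<in> N \<times> J"
    then obtain p t where z: "z = (p, t)" "p \<in> N" "t \<in> J" by auto
    show "((\<lambda>h. V (z + h *\<^sub>R b)) has_vector_derivative D b z) (at 0)"
    proof (cases "snd b = 0")
      case True
      then obtain q where q: "b = (q, 0)" by (cases b) auto
      have "((\<lambda>h. V (p + h *\<^sub>R q, t)) has_vector_derivative W q (p, t)) (at 0)"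
        by (rule solution_directional_derivative[OF smooth_openD[OF A] B1 c1 Vc Suc.prems(3) W[unfolded Bq_def] z(2,3)])
      then show ?thesis
        by (simp add: D_def z(1) q)
    next
      case False
      then have b1: "b = (0, 1)" using b by (auto simp: Basis_prod_def)
      have "((\<lambda>t. V (p, t)) has_vector_derivative A (p, t) (V (p, t)) + B (p, t)) (at (t + 0))"
        using Suc.prems(3) z by (simp add: is_solution_def)
      moreover have "((\<lambda>h. t + h) has_vector_derivative 1) (at 0)"
        by (auto intro!: derivative_eq_intros)
      ultimately have "((\<lambda>t. V (p, t)) \<circ> (\<lambda>h. t + h) has_vector_derivative 1 *\<^sub>R (A (p, t) (V (p, t)) + B (p, t))) (at 0)"
        by (intro vector_diff_chain_at) auto
      then show ?thesis
        using False by (simp add: D_def z b1 o_def)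
    qed
  next
    show "differentiable_upto k (N \<times> J) (D b)" for b
      unfolding D_def using Wk differentiable_upto_add[OF open_NJ Ak differentiable_upto_lower[OF Suc.prems(1)]]
      by (cases "snd b = 0") (auto simp del: differentiable_upto.simps)
  qed
qed

text \<open>Sums and multiples of solutions solve the same homogeneous equation, so uniqueness gives
  linearity in the initial value; smoothness holds as the data, a constant and zero, have all
  orders.\<close>

theorem fundamental_solution:
  assumes A: "\<And>w. smooth_open (N \<times> J) (\<lambda>z. A z w)"
  shows "\<exists>\<Psi>. (\<forall>u. smooth_open (N \<times> J) (\<lambda>z. \<Psi> z u)) \<and> (\<forall>z\<in>N \<times> J. linear (\<Psi> z)) \<and>
    (\<forall>p\<in>N. \<forall>u. \<Psi> (p, s) u = u) \<and>
    (\<forall>p\<in>N. \<forall>t\<in>J. \<forall>u. ((\<lambda>t. \<Psi> (p, t) u) has_vector_derivative A (p, t) (\<Psi> (p, t) u)) (at t))"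
proof -
  have "\<exists>V. is_solution V (\<lambda>p. u) (\<lambda>z. 0)" for u
    using ex_solution[of "\<lambda>p. u" "\<lambda>z. 0"] by auto
  then obtain V where V: "\<And>u. is_solution (V u) (\<lambda>p. u) (\<lambda>z. 0)" by metis
  have ode: "((\<lambda>t. V u (p, t)) has_vector_derivative A (p, t) (V u (p, t))) (at t)" if "p \<in> N" "t \<in> J" for u p t
    using V[of u] that by (simp add: is_solution_def)
  have V0: "V u (p, s) = u" if "p \<in> N" for u p
    using V[of u] that by (simp add: is_solution_def)
  have "smooth_open (N \<times> J) (V u)" for u
    unfolding smooth_open_def
    by (intro allI solution_differentiable_upto[OF A _ _ V] differentiable_upto_const open_NJ open_N)
  moreover have "linear (\<lambda>u. V u z)" if z: "z \<in> N \<times> J" for z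
  proof
    obtain p t where z: "z = (p, t)" "p \<in> N" "t \<in> J" using z by auto
    have l: "linear (A (p, t))" if "t \<in> J" for t using lin z that by auto
    show "V (u + v) z = V u z + V v z" for u v
      unfolding z(1)
    proof (rule solution_unique_at[OF z(2), where B = "\<lambda>t. 0" and r = s and V = "\<lambda>t. V (u + v) (p, t)" and V' = "\<lambda>t. V u (p, t) + V v (p, t)"])
      fix t assume "t \<in> J"
      then show "((\<lambda>t. V u (p, t) + V v (p, t)) has_vector_derivative A (p, t) (V u (p, t) + V v (p, t)) + 0) (at t)"
        using has_vector_derivative_add[OF ode[OF z(2)] ode[OF z(2)]] by (simp add: linear_add[OF l])
    qed (use ode z s V0 in auto)
    show "V (a *\<^sub>R u) z = a *\<^sub>R V u z" for a u
      unfolding z(1)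
    proof (rule solution_unique_at[OF z(2), where B = "\<lambda>t. 0" and r = s and V = "\<lambda>t. V (a *\<^sub>R u) (p, t)" and V' = "\<lambda>t. a *\<^sub>R V u (p, t)"])
      fix t assume t: "t \<in> J"
      have "((\<lambda>t. a *\<^sub>R V u (p, t)) has_vector_derivative a *\<^sub>R A (p, t) (V u (p, t))) (at t)"
        by (rule bounded_linear.has_vector_derivative[OF bounded_linear_scaleR_right ode[OF z(2) t]])
      then show "((\<lambda>t. a *\<^sub>R V u (p, t)) has_vector_derivative A (p, t) (a *\<^sub>R V u (p, t)) + 0) (at t)"
        by (simp add: linear_cmul[OF l[OF t]])
    qed (use ode z s V0 in auto)
  qed
  ultimately show ?thesis
    using ode V0 by (intro exI[of _ "\<lambda>z u. V u z"]) auto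
qed

end

section \<open>Symmetry of second derivatives\<close>

text \<open>Let k(s) be the derivative of \<open>f\<close> in direction \<open>w\<close> at x + s v.
  Writing f(x + s v + t w) - f(x + t w) as an integral of the derivative in direction
  \<open>v\<close>, and differentiating under the integral at t = 0, gives k(s) = k(0) + s m(s) with
  \<open>m\<close> continuous. So k'(0) = m(0), and these are the two mixed derivatives.\<close>

lemma second_derivative_symmetric:
  fixes f :: "'a::euclidean_space \<Rightarrow> 'b::euclidean_space"
  assumes f: "smooth_open U f" and U: "open U" and x: "x \<in> U"
  shows "frechet_derivative (\<lambda>y. frechet_derivative f (at y) v) (at x) w
       = frechet_derivative (\<lambda>y. frechet_derivative f (at y) w) (at x) v"
proof -
  let ?F = "\<lambda>s t::real. x + s *\<^sub>R v + t *\<^sub>R w"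
  let ?fv = "\<lambda>y. frechet_derivative f (at y) v"
  let ?fvw = "\<lambda>y. frechet_derivative ?fv (at y) w"
  obtain e where e: "e > 0" "ball x e \<subseteq> U" using U x openE by blast
  \<comment> \<open>The parallelogram with sides of length up to \<open>d\<close> along
    \<open>v\<close> and \<open>w\<close> then lies in the ball; the summand 1 keeps the denominator
    positive and the estimate strict.\<close>
  define d where "d = e / (norm v + norm w + 1)"
  have d: "d > 0" using e by (simp add: d_def add_nonneg_pos)
  have FU: "?F s t \<in> U" if "\<bar>s\<bar> < d" "\<bar>t\<bar> < d" for s t
  proof -
    have "norm (s *\<^sub>R v + t *\<^sub>R w) \<le> \<bar>s\<bar> * norm v + \<bar>t\<bar> * norm w"
      by (metis norm_scaleR norm_triangle_ineq)
    also have "\<dots> \<le> d * norm v + d * norm w"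
      using that by (intro add_mono mult_right_mono) auto
    also have "\<dots> < d * (norm v + norm w + 1)" using d by (simp add: algebra_simps)
    also have "\<dots> = e" using add_nonneg_pos[of "norm v + norm w" 1] by (simp add: d_def)
    finally have "norm (?F s t - x) < e" by (simp add: algebra_simps)
    then have "dist (?F s t) x < e" by (simp only: dist_norm)
    then have "?F s t \<in> ball x e" by (simp only: mem_ball dist_commute)
    then show ?thesis using e by blast
  qed
  have small: "\<bar>r * s\<bar> < d" if "\<bar>s\<bar> < d" "r \<in> {0..1}" for r s :: real
  proof -
    have "\<bar>r * s\<bar> \<le> 1 * \<bar>s\<bar>" unfolding abs_mult using that by (intro mult_right_mono) auto
    then show ?thesis using that by simp
  qed
  have fd: "(f has_derivative frechet_derivative f (at y)) (at y)" if "y \<in> U" for y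
    using smooth_open_has_derivative[OF f that] .
  have fvd: "(?fv has_derivative frechet_derivative ?fv (at y)) (at y)" if "y \<in> U" for y
    using smooth_open_has_derivative[OF smooth_open_frechet[OF f] that] .
  have fv_cont: "continuous_on U ?fv" and fvw_cont: "continuous_on U ?fvw"
    by (intro smooth_open_continuous_on smooth_open_frechet f)+
  define k where "k s = frechet_derivative f (at (?F s 0)) w" for s
  define m where "m s = integral {0..1} (\<lambda>r. ?fvw (?F (r * s) 0))" for s
  have along: "((\<lambda>t. g (?F s t)) has_vector_derivative g' w) (at t)" if "(g has_derivative g') (at (?F s t))"
    for g :: "'a \<Rightarrow> 'b" and g' s t
  proof -
    have "((\<lambda>t. ?F s t) has_derivative (\<lambda>h. h *\<^sub>R w)) (at t)"
      by (auto intro!: derivative_eq_intros)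
    from has_derivative_compose[OF this that] show ?thesis
      by (simp add: has_vector_derivative_def linear_cmul[OF has_derivative_linear[OF that]])
  qed
  have k: "k s = k 0 + s *\<^sub>R m s" if s: "\<bar>s\<bar> < d" for s
  proof -
    let ?T = "{-d<..<d}"
    have eq: "f (?F s t) - f (?F 0 t) = integral {0..1} (\<lambda>r. s *\<^sub>R ?fv (?F (r * s) t))" if t: "t \<in> ?T" for t
    proof -
      have "((\<lambda>r. s *\<^sub>R ?fv (?F (r * s) t)) has_integral f (?F (1 * s) t) - f (?F (0 * s) t)) {0..1}"
      proof (rule fundamental_theorem_of_calculus)
        fix r :: real assume r: "r \<in> {0..1}"
        have in1: "?F (r * s) t \<in> U" using FU small[OF s r] t by auto
        have 1: "((\<lambda>r. ?F (r * s) t) has_derivative (\<lambda>h. h *\<^sub>R (s *\<^sub>R v))) (at r within {0..1})"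
          by (auto intro!: derivative_eq_intros)
        from has_derivative_compose[OF 1 fd[OF in1]]
        show "((\<lambda>r. f (?F (r * s) t)) has_vector_derivative s *\<^sub>R ?fv (?F (r * s) t)) (at r within {0..1})"
          unfolding has_vector_derivative_def by (simp only: linear_cmul[OF has_derivative_linear[OF fd[OF in1]]])
      qed simp
      from integral_unique[OF this] show ?thesis by simp
    qed
    have cont1: "continuous_on {0..1} (\<lambda>r. s *\<^sub>R ?fv (?F (r * s) t))" if "t \<in> ?T" for t
      by (intro continuous_intros continuous_on_compose2[OF fv_cont]) (use FU small[OF s] that in auto)
    have "((\<lambda>t. integral (cbox 0 1) (\<lambda>r. s *\<^sub>R ?fv (?F (r * s) t))) has_vector_derivative
        integral (cbox 0 1) (\<lambda>r. s *\<^sub>R ?fvw (?F (r * s) 0))) (at 0 within ?T)"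
    proof (rule leibniz_rule_vector_derivative)
      fix t r :: real assume *: "t \<in> ?T" "r \<in> cbox 0 1"
      have in1: "?F (r * s) t \<in> U" using FU small[OF s, of r] * by auto
      show "((\<lambda>t. s *\<^sub>R ?fv (?F (r * s) t)) has_vector_derivative s *\<^sub>R ?fvw (?F (r * s) t)) (at t within ?T)"
        by (rule has_vector_derivative_at_within, rule bounded_linear.has_vector_derivative[OF bounded_linear_scaleR_right],
            rule along[where g = ?fv and s = "r * s", OF fvd[OF in1]])
    next
      show "continuous_on (?T \<times> cbox 0 1) (\<lambda>(t, r). s *\<^sub>R ?fvw (?F (r * s) t))"
        unfolding case_prod_beta
        by (rule continuous_on_scaleR[OF continuous_on_const], rule continuous_on_compose2[OF fvw_cont])
          (use FU small[OF s] in \<open>auto intro!: continuous_intros\<close>)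
    qed (use d cont1 in \<open>auto intro!: integrable_continuous_interval\<close>)
    then have R: "((\<lambda>t. integral (cbox 0 1) (\<lambda>r. s *\<^sub>R ?fv (?F (r * s) t))) has_vector_derivative s *\<^sub>R m s) (at 0)"
      using d by (subst (asm) has_vector_derivative_within_open) (auto simp: m_def)
    have "((\<lambda>t. f (?F s t) - f (?F 0 t)) has_vector_derivative k s - k 0) (at 0)"
      unfolding k_def using FU[of s 0] FU[of 0 0] s d
      by (intro has_vector_derivative_diff along[where g = f, OF fd]) auto
    then have "((\<lambda>t. integral (cbox 0 1) (\<lambda>r. s *\<^sub>R ?fv (?F (r * s) t))) has_vector_derivative k s - k 0) (at 0)"
      by (rule has_vector_derivative_transform_within_open[of _ _ _ ?T]) (use d eq in auto)
    from vector_derivative_unique_at[OF this R] show ?thesis by (simp add: algebra_simps)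
  qed
  have "continuous_on ({-d<..<d} \<times> cbox 0 1) (\<lambda>(s, r). ?fvw (?F (r * s) 0))"
    unfolding case_prod_beta
    by (rule continuous_on_compose2[OF fvw_cont])
      (use FU[of _ 0] small d in \<open>auto intro!: continuous_intros\<close>)
  then have "continuous_on {-d<..<d} m"
    unfolding m_def box_real(2)[symmetric] by (rule integral_continuous_on_param)
  then have m0: "isCont m 0" using d by (simp add: continuous_on_eq_continuous_at)
  have k1: "(k has_vector_derivative m 0) (at 0)"
    by (rule has_vector_derivative_of_quotient[of "{-d<..<d}", OF _ _ k m0]) (use d in auto)
  have "k = (\<lambda>h. frechet_derivative f (at (x + h *\<^sub>R v)) w)"
    by (simp add: k_def[abs_def])
  then have k2: "(k has_vector_derivative frechet_derivative (\<lambda>y. frechet_derivative f (at y) w) (at x) v) (at 0)"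
    by (simp only: has_vector_derivative_along[OF smooth_open_has_derivative[OF smooth_open_frechet[OF f] x]])
  have "m 0 = frechet_derivative (\<lambda>y. frechet_derivative f (at y) w) (at x) v"
    by (rule vector_derivative_unique_at[OF k1 k2])
  then show ?thesis by (simp add: m_def)
qed

section \<open>Smooth bump functions\<close>

text \<open>The classical flat function is the case \<open>k = 0\<close>; with the powers the family
  is closed under differentiation up to linear combinations, so smoothness becomes an induction over
  all \<open>k\<close>.\<close>

definition exp_inverse :: "nat \<Rightarrow> real \<Rightarrow> real" where
  "exp_inverse k x = (if x \<le> 0 then 0 else inverse x ^ k * exp (- inverse x))"

lemma exp_inverse_tendsto_0: "(exp_inverse k \<longlongrightarrow> 0) (at 0)"
proof (rule filterlim_split_at)
  show "(exp_inverse k \<longlongrightarrow> 0) (at_left 0)"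
    by (rule tendsto_eventually) (auto simp: exp_inverse_def eventually_at_filter)
  have "((\<lambda>x. inverse x ^ k / exp (inverse x)) \<longlongrightarrow> 0) (at_right (0::real))"
    by (rule filterlim_compose[OF tendsto_power_div_exp_0 filterlim_inverse_at_top_right])
  then show "(exp_inverse k \<longlongrightarrow> 0) (at_right 0)"
    by (rule Lim_transform_eventually)
      (auto simp: exp_inverse_def eventually_at_filter exp_minus divide_inverse)
qed

lemma exp_inverse_has_derivative:
  "(exp_inverse k has_real_derivative exp_inverse (k + 2) x - k * exp_inverse (k + 1) x) (at x)"
proof (cases x "0::real" rule: linorder_cases)
  case less
  have "((\<lambda>x. 0) has_real_derivative 0) (at x)" by simp
  then have "(exp_inverse k has_real_derivative 0) (at x)"
    by (rule has_field_derivative_transform_within_open[of _ _ _ "{..<0}"]) (use less in \<open>auto simp: exp_inverse_def\<close>)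
  then show ?thesis using less by (simp add: exp_inverse_def)
next
  case greater
  have "((\<lambda>x. inverse x ^ k * exp (- inverse x)) has_real_derivative
      exp_inverse (k + 2) x - k * exp_inverse (k + 1) x) (at x)"
  proof (cases k)
    case 0
    show ?thesis
      using greater 0
      by (auto intro!: derivative_eq_intros simp: exp_inverse_def power2_eq_square field_simps)
  next
    case (Suc n)
    show ?thesis
      using greater Suc
      by (auto intro!: derivative_eq_intros simp: exp_inverse_def power2_eq_square field_simps)
        (cases n; simp)
  qed
  then show ?thesis
    by (rule has_field_derivative_transform_within_open[of _ _ _ "{0<..}"]) (use greater in \<open>auto simp: exp_inverse_def\<close>)
next
  case equal
  \<comment> \<open>At 0 the difference quotient is the next member of the family, which tends to
    0.\<close>
  have "((\<lambda>h. exp_inverse k h / h) \<longlongrightarrow> 0) (at 0)"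
    by (rule Lim_transform_eventually[OF exp_inverse_tendsto_0[of "Suc k"]])
      (auto simp: exp_inverse_def eventually_at_filter divide_inverse)
  then show ?thesis
    using equal by (simp add: has_field_derivative_iff exp_inverse_def)
qed

lemma differentiable_upto_exp_inverse: "differentiable_upto n UNIV (exp_inverse k)"
proof (induction n arbitrary: k)
  case 0
  then show ?case
    using DERIV_continuous_on[of UNIV "exp_inverse k", OF exp_inverse_has_derivative[THEN DERIV_subset]] by auto
next
  case (Suc n)
  show ?case
  proof (rule differentiable_upto_SucI)
    show "(exp_inverse k has_derivative (\<lambda>v. (exp_inverse (k + 2) x - k * exp_inverse (k + 1) x) * v)) (at x)" for x
      using exp_inverse_has_derivative by (simp add: has_field_derivative_def)
    show "differentiable_upto n UNIV (\<lambda>x. (exp_inverse (k + 2) x - k * exp_inverse (k + 1) x) * v)" for v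
    proof -
      have "differentiable_upto n UNIV (\<lambda>x. v * exp_inverse (k + 2) x + (- k * v) * exp_inverse (k + 1) x)"
        by (intro differentiable_upto_add differentiable_upto_mult differentiable_upto_const Suc.IH open_UNIV)
      then show ?thesis by (simp add: algebra_simps)
    qed
  qed simp
qed

text \<open>The flat function is composed with itself, so that only a constant is divided by. Its
  value at 1 is \<open>exp (-1)\<close>: the inner difference equals that constant for x \<le> 0, is
  nonpositive for x \<ge> 1, and the denominator normalizes the first value to 1.\<close>

definition smooth_step :: "real \<Rightarrow> real" where
  "smooth_step x = exp_inverse 0 (exp (-1) - exp_inverse 0 x) / exp_inverse 0 (exp (-1))"

lemma smooth_step_1: "x \<le> 0 \<Longrightarrow> smooth_step x = 1"
  by (simp add: smooth_step_def exp_inverse_def)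

lemma smooth_step_0: "1 \<le> x \<Longrightarrow> smooth_step x = 0"
  by (simp add: smooth_step_def exp_inverse_def inverse_le_1_iff)

lemma smooth_open_smooth_step: "smooth_open UNIV smooth_step"
proof -
  have e: "smooth_open UNIV (exp_inverse 0)"
    using differentiable_upto_exp_inverse by (simp add: smooth_open_def)
  have "smooth_open UNIV (\<lambda>x. exp_inverse 0 (exp (-1) - exp_inverse 0 x) * inverse (exp_inverse 0 (exp (-1))))"
    by (intro smooth_open_mult smooth_open_const open_UNIV smooth_open_compose[OF e] smooth_open_diff e subset_UNIV)
  then show ?thesis by (simp add: smooth_step_def[abs_def] divide_inverse)
qed

lemma ex_bump_function:
  fixes a :: "'e::euclidean_space"
  assumes r: "r > 0"
  shows "\<exists>f :: 'e \<Rightarrow> real. smooth_open UNIV f \<and> (\<forall>x\<in>cball a r. f x = 1) \<and> (\<forall>x. x \<notin> ball a (2 * r) \<longrightarrow> f x = 0)"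
proof -
  \<comment> \<open>The argument is at most 0 on the ball of radius \<open>r\<close> and at least 1
    from radius \<open>sqrt 2 * r\<close> on; the squared norm keeps it smooth at the
    centre.\<close>
  define f where "f x = smooth_step (inverse (r\<^sup>2) * ((x - a) \<bullet> (x - a)) - 1)" for x
  have "smooth_open UNIV f"
    unfolding f_def
    by (intro smooth_open_compose[OF smooth_open_smooth_step] smooth_open_mult smooth_open_const open_UNIV
        smooth_open_diff smooth_open_inner smooth_open_ident subset_UNIV)
  moreover have "f x = 1" if "x \<in> cball a r" for x
  proof -
    have "norm (x - a) ^ 2 \<le> r ^ 2" using that r by (intro power_mono) (auto simp: dist_norm norm_minus_commute)
    then show ?thesis
      unfolding f_def using r by (intro smooth_step_1) (simp add: dot_square_norm field_simps)
  qed
  moreover have "f x = 0" if "x \<notin> ball a (2 * r)" for x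
  proof -
    have "(2 * r) ^ 2 \<le> norm (x - a) ^ 2" using that r by (intro power_mono) (auto simp: dist_norm norm_minus_commute)
    then have "4 * r\<^sup>2 \<le> norm (x - a) ^ 2" by (simp add: power_mult_distrib)
    then have "2 * r\<^sup>2 \<le> norm (x - a) ^ 2" using zero_le_power2[of r] by linarith
    then show ?thesis
      unfolding f_def using r by (intro smooth_step_0) (simp add: dot_square_norm field_simps)
  qed
  ultimately show ?thesis by blast
qed

section \<open>Charts and tangent vectors\<close>

definition jac :: "('m, 'e::euclidean_space) chart \<Rightarrow> ('m, 'e) chart \<Rightarrow> 'm \<Rightarrow> 'e \<Rightarrow> 'e" where
  "jac c d m = frechet_derivative (coord d \<circ> param c) (at (coord c m))"

locale manifold =
  fixes A :: "('m::t2_space, 'e::euclidean_space) chart set"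
  assumes atlas: "smooth_atlas A"
begin

lemma open_cdom: "c \<in> A \<Longrightarrow> open (cdom c)"
  using atlas by (simp add: smooth_atlas_def)

lemma chart_homeomorphism:
  "c \<in> A \<Longrightarrow> homeomorphism (cdom c) (coord c ` cdom c) (coord c) (param c)"
  using atlas by (simp add: smooth_atlas_def)

lemma open_coord_cdom: "c \<in> A \<Longrightarrow> open (coord c ` cdom c)"
  using atlas by (simp add: smooth_atlas_def)

lemma ex_chart: obtains c where "c \<in> A" "m \<in> cdom c"
  using atlas unfolding smooth_atlas_def by blast

lemma param_coord [simp]: "c \<in> A \<Longrightarrow> m \<in> cdom c \<Longrightarrow> param c (coord c m) = m"
  using chart_homeomorphism by (simp add: homeomorphism_def)

lemma param_in_cdom: "c \<in> A \<Longrightarrow> y \<in> coord c ` cdom c \<Longrightarrow> param c y \<in> cdom c"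
  by (rule inv_into_into)

lemma continuous_on_coord: "c \<in> A \<Longrightarrow> continuous_on (cdom c) (coord c)"
  using chart_homeomorphism by (simp add: homeomorphism_def)

lemma continuous_on_param: "c \<in> A \<Longrightarrow> continuous_on (coord c ` cdom c) (param c)"
  using chart_homeomorphism by (simp add: homeomorphism_def)

lemma open_coord_image:
  assumes c: "c \<in> A" and S: "open S"
  shows "open (coord c ` (S \<inter> cdom c))"
proof -
  have "coord c ` (S \<inter> cdom c) = coord c ` cdom c \<inter> param c -` S"
    using c by (auto simp: rev_image_eqI)
  then show ?thesis
    using continuous_open_preimage[OF continuous_on_param[OF c] open_coord_cdom[OF c] S] by simp
qed

lemma open_coord_preimage:
  assumes c: "c \<in> A" and V: "open V"
  shows "open (cdom c \<inter> coord c -` V)"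
  using continuous_open_preimage[OF continuous_on_coord[OF c] open_cdom[OF c] V] .

lemma smooth_transition:
  assumes "c \<in> A" "d \<in> A"
  shows "smooth_open (coord c ` (cdom c \<inter> cdom d)) (coord d \<circ> param c)"
  using assms atlas by (simp add: smooth_atlas_def)

lemma open_overlap:
  assumes "c \<in> A" "d \<in> A"
  shows "open (coord c ` (cdom c \<inter> cdom d))"
  using open_coord_image[OF assms(1) open_cdom[OF assms(2)]] by (simp add: Int_commute)

lemma transition_has_derivative:
  assumes "c \<in> A" "d \<in> A" "m \<in> cdom c" "m \<in> cdom d"
  shows "((coord d \<circ> param c) has_derivative jac c d m) (at (coord c m))"
  unfolding jac_def by (rule smooth_open_has_derivative[OF smooth_transition]) (use assms in auto)

lemma linear_jac:
  assumes "c \<in> A" "d \<in> A" "m \<in> cdom c" "m \<in> cdom d"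
  shows "linear (jac c d m)"
  using has_derivative_linear[OF transition_has_derivative[OF assms]] .

lemma jac_trans:
  assumes "c \<in> A" "d \<in> A" "e \<in> A" "m \<in> cdom c" "m \<in> cdom d" "m \<in> cdom e"
  shows "jac d e m (jac c d m u) = jac c e m u"
proof -
  have "((coord e \<circ> param d) has_derivative jac d e m) (at ((coord d \<circ> param c) (coord c m)))"
    using transition_has_derivative[of d e m] assms by simp
  from diff_chain_at[OF transition_has_derivative[OF assms(1,2,4,5)] this]
  have 1: "((coord e \<circ> param d) \<circ> (coord d \<circ> param c) has_derivative jac d e m \<circ> jac c d m) (at (coord c m))"
    .
  have "((coord e \<circ> param c) has_derivative jac d e m \<circ> jac c d m) (at (coord c m))"
    by (rule has_derivative_transform_within_open[OF 1 open_overlap[of c d]])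
      (use assms in auto)
  then have "jac d e m \<circ> jac c d m = jac c e m"
    using has_derivative_unique transition_has_derivative[of c e m] assms by blast
  then show ?thesis by (metis comp_apply)
qed

lemma jac_same:
  assumes "c \<in> A" "m \<in> cdom c"
  shows "jac c c m u = u"
proof -
  have "((\<lambda>x. x) has_derivative (\<lambda>x. x)) (at (coord c m))" by simp
  then have "((coord c \<circ> param c) has_derivative (\<lambda>x. x)) (at (coord c m))"
    by (rule has_derivative_transform_within_open[OF _ open_coord_cdom[OF assms(1)]])
      (use assms in auto)
  then show ?thesis
    using has_derivative_unique transition_has_derivative[of c c m] assms by metis
qed

lemma coord_vec_apply: "d \<in> A \<Longrightarrow> m \<in> cdom d \<Longrightarrow> coord_vec A c m u d = jac c d m u"
  by (simp add: coord_vec_def jac_def)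

lemma coord_vec_outside: "\<not> (d \<in> A \<and> m \<in> cdom d) \<Longrightarrow> coord_vec A c m u d = 0"
  by (auto simp: coord_vec_def)

lemma coord_vec_same: "c \<in> A \<Longrightarrow> m \<in> cdom c \<Longrightarrow> coord_vec A c m u c = u"
  by (simp add: coord_vec_apply jac_same)

lemma coord_vec_in_tangent_space:
  assumes "c \<in> A" "m \<in> cdom c"
  shows "coord_vec A c m u \<in> tangent_space A m"
  unfolding tangent_space_def
proof (intro CollectI ballI impI ext)
  fix d e assume d: "d \<in> A" "m \<in> cdom d"
  show "coord_vec A c m u e = coord_vec A d m (coord_vec A c m u d) e"
    using assms d by (cases "e \<in> A \<and> m \<in> cdom e") (simp_all add: coord_vec_apply jac_trans coord_vec_outside)
qed

lemma tangent_vec_eq: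
  "v \<in> tangent_space A m \<Longrightarrow> c \<in> A \<Longrightarrow> m \<in> cdom c \<Longrightarrow> v = coord_vec A c m (v c)"
  by (simp add: tangent_space_def)

lemma tangent_vec_jac:
  "v \<in> tangent_space A m \<Longrightarrow> c \<in> A \<Longrightarrow> m \<in> cdom c \<Longrightarrow> d \<in> A \<Longrightarrow> m \<in> cdom d \<Longrightarrow> v d = jac c d m (v c)"
  by (metis tangent_vec_eq coord_vec_apply)

lemma tangent_vec_eqI:
  "v \<in> tangent_space A m \<Longrightarrow> w \<in> tangent_space A m \<Longrightarrow> c \<in> A \<Longrightarrow> m \<in> cdom c \<Longrightarrow> v c = w c \<Longrightarrow> v = w"
  by (metis tangent_vec_eq)

lemma coord_vec_add:
  assumes "c \<in> A" "m \<in> cdom c"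
  shows "coord_vec A c m (u + v) = tadd (coord_vec A c m u) (coord_vec A c m v)"
proof
  fix d
  show "coord_vec A c m (u + v) d = tadd (coord_vec A c m u) (coord_vec A c m v) d"
    using assms linear_add[OF linear_jac[of c d m]]
    by (cases "d \<in> A \<and> m \<in> cdom d") (auto simp: coord_vec_apply coord_vec_outside tadd_def)
qed

lemma coord_vec_scale:
  assumes "c \<in> A" "m \<in> cdom c"
  shows "coord_vec A c m (a *\<^sub>R u) = tscale a (coord_vec A c m u)"
proof
  fix d
  show "coord_vec A c m (a *\<^sub>R u) d = tscale a (coord_vec A c m u) d"
    using assms linear_cmul[OF linear_jac[of c d m]]
    by (cases "d \<in> A \<and> m \<in> cdom d") (auto simp: coord_vec_apply coord_vec_outside tscale_def)
qed

lemma tangent_add: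
  assumes "v \<in> tangent_space A m" "w \<in> tangent_space A m"
  shows "tadd v w \<in> tangent_space A m"
proof -
  obtain c where c: "c \<in> A" "m \<in> cdom c" by (rule ex_chart)
  then have "tadd v w = coord_vec A c m (v c + w c)"
    using assms by (metis tangent_vec_eq coord_vec_add)
  then show ?thesis using coord_vec_in_tangent_space c by simp
qed

lemma tangent_scale:
  assumes "v \<in> tangent_space A m"
  shows "tscale a v \<in> tangent_space A m"
proof -
  obtain c where c: "c \<in> A" "m \<in> cdom c" by (rule ex_chart)
  then have "tscale a v = coord_vec A c m (a *\<^sub>R v c)"
    using assms by (metis tangent_vec_eq coord_vec_scale)
  then show ?thesis using coord_vec_in_tangent_space c by simp
qed

lemma tangent_zero: "tzero \<in> tangent_space A m"
proof -
  obtain c where c: "c \<in> A" "m \<in> cdom c" by (rule ex_chart)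
  then have "tscale 0 (coord_vec A c m 0) \<in> tangent_space A m"
    by (intro tangent_scale coord_vec_in_tangent_space)
  then show ?thesis by (simp add: tscale_def tzero_def)
qed

section \<open>Smooth functions and vector fields\<close>

text \<open>A pointwise notion tested in one chart: gluing then needs only a neighbourhood of each
  point, and \<open>smooth_nearD\<close> passes to any other chart.\<close>

definition smooth_near :: "('m \<Rightarrow> 'f::real_normed_vector) \<Rightarrow> 'm \<Rightarrow> bool" where
  "smooth_near f m \<longleftrightarrow> (\<exists>c\<in>A. m \<in> cdom c \<and>
     (\<exists>V. open V \<and> coord c m \<in> V \<and> V \<subseteq> coord c ` cdom c \<and> smooth_open V (\<lambda>y. f (param c y))))"

lemma smooth_nearI:
  assumes "c \<in> A" "m \<in> cdom c" "open V" "coord c m \<in> V" "smooth_open V (\<lambda>y. f (param c y))"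
  shows "smooth_near f m"
  unfolding smooth_near_def
proof (intro bexI[of _ c] conjI exI[of _ "V \<inter> coord c ` cdom c"])
  show "smooth_open (V \<inter> coord c ` cdom c) (\<lambda>y. f (param c y))"
    using assms(5) smooth_open_subset by blast
qed (use assms open_coord_cdom in auto)

text \<open>Precomposition with the smooth transition map moves the representation from the chart
  \<open>d\<close> to the chart \<open>c\<close>, on the part of the overlap that \<open>d\<close>
  sends into \<open>V\<close>.\<close>

lemma smooth_nearD:
  assumes f: "smooth_near f m" and c: "c \<in> A" "m \<in> cdom c"
  obtains V where "open V" "coord c m \<in> V" "V \<subseteq> coord c ` cdom c" "smooth_open V (\<lambda>y. f (param c y))"
proof -
  obtain d V where d: "d \<in> A" "m \<in> cdom d" and V: "open V" "coord d m \<in> V" "V \<subseteq> coord d ` cdom d"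
    "smooth_open V (\<lambda>y. f (param d y))"
    using f unfolding smooth_near_def by blast
  define W where "W = coord c ` ((cdom d \<inter> coord d -` V) \<inter> cdom c)"
  have W: "open W" unfolding W_def by (intro open_coord_image open_coord_preimage c d V)
  have "smooth_open W (\<lambda>y. f (param d ((coord d \<circ> param c) y)))"
  proof (rule smooth_open_compose[OF V(4) _ W V(1)])
    show "smooth_open W (coord d \<circ> param c)"
      by (rule smooth_open_subset[OF smooth_transition[OF c(1) d(1)]]) (auto simp: W_def)
    show "(coord d \<circ> param c) ` W \<subseteq> V" using c by (auto simp: W_def)
  qed
  then have "smooth_open W (\<lambda>y. f (param c y))"
    by (rule smooth_open_cong[OF W, rotated]) (use c d in \<open>auto simp: W_def\<close>)
  then show ?thesis
    by (rule that[OF W, rotated 2]) (use c d V in \<open>auto simp: W_def\<close>)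
qed

lemma smooth_near_cong:
  assumes f: "smooth_near f m" and U: "open U" "m \<in> U" "\<And>p. p \<in> U \<Longrightarrow> f p = g p"
  shows "smooth_near g m"
proof -
  obtain c where c: "c \<in> A" "m \<in> cdom c" by (rule ex_chart)
  obtain V where V: "open V" "coord c m \<in> V" "V \<subseteq> coord c ` cdom c" "smooth_open V (\<lambda>y. f (param c y))"
    using smooth_nearD[OF f c] .
  define W where "W = V \<inter> coord c ` (U \<inter> cdom c)"
  have W: "open W" unfolding W_def using V open_coord_image c U by blast
  have "smooth_open W (\<lambda>y. g (param c y))"
    by (rule smooth_open_cong[OF W _ smooth_open_subset[OF V(4)]]) (use U c in \<open>auto simp: W_def\<close>)
  then show ?thesis by (rule smooth_nearI[OF c W, rotated]) (use V U c in \<open>auto simp: W_def\<close>)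
qed

lemma smooth_near_binop:
  assumes f: "smooth_near f m" and g: "smooth_near g m"
    and op: "\<And>(V :: 'e set) F G. open V \<Longrightarrow> smooth_open V F \<Longrightarrow> smooth_open V G \<Longrightarrow> smooth_open V (\<lambda>y. h (F y) (G y))"
  shows "smooth_near (\<lambda>p. h (f p) (g p)) m"
proof -
  obtain c where c: "c \<in> A" "m \<in> cdom c" by (rule ex_chart)
  obtain V where V: "open V" "coord c m \<in> V" "V \<subseteq> coord c ` cdom c" "smooth_open V (\<lambda>y. f (param c y))"
    using smooth_nearD[OF f c] .
  obtain W where W: "open W" "coord c m \<in> W" "W \<subseteq> coord c ` cdom c" "smooth_open W (\<lambda>y. g (param c y))"
    using smooth_nearD[OF g c] .
  have "smooth_open (V \<inter> W) (\<lambda>y. h (f (param c y)) (g (param c y)))"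
    using V W by (intro op smooth_open_subset[OF V(4)] smooth_open_subset[OF W(4)]) auto
  then show ?thesis using c V W by (intro smooth_nearI[of c m "V \<inter> W"]) auto
qed

lemma smooth_near_const: "smooth_near (\<lambda>p. k) m"
proof -
  obtain c where c: "c \<in> A" "m \<in> cdom c" by (rule ex_chart)
  then show ?thesis by (intro smooth_nearI[of c m UNIV] smooth_open_const) auto
qed

lemma smooth_near_add: "smooth_near f m \<Longrightarrow> smooth_near g m \<Longrightarrow> smooth_near (\<lambda>p. f p + g p) m"
  by (rule smooth_near_binop[where h = "(+)"]) (auto intro: smooth_open_add)

lemma smooth_near_scaleR: "smooth_near f m \<Longrightarrow> smooth_near g m \<Longrightarrow> smooth_near (\<lambda>p. f p *\<^sub>R g p) m"
  by (rule smooth_near_binop[where h = "(*\<^sub>R)"]) (auto intro: smooth_open_scaleR)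

lemma smooth_near_inner: "smooth_near f m \<Longrightarrow> smooth_near g m \<Longrightarrow> smooth_near (\<lambda>p. f p \<bullet> g p) m"
  by (rule smooth_near_binop[where h = "(\<bullet>)"]) (auto intro: smooth_open_inner)

lemma smooth_near_sum:
  "finite I \<Longrightarrow> (\<And>i. i \<in> I \<Longrightarrow> smooth_near (f i) m) \<Longrightarrow> smooth_near (\<lambda>p. \<Sum>i\<in>I. f i p) m"
  by (induction I rule: finite_induct) (auto intro: smooth_near_const smooth_near_add)

lemma smooth_near_isCont:
  assumes "smooth_near f m"
  shows "isCont f m"
proof -
  obtain c where c: "c \<in> A" "m \<in> cdom c" by (rule ex_chart)
  obtain V where V: "open V" "coord c m \<in> V" "V \<subseteq> coord c ` cdom c" "smooth_open V (\<lambda>y. f (param c y))"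
    using smooth_nearD[OF assms c] .
  let ?U = "cdom c \<inter> coord c -` V"
  have "continuous_on ?U (\<lambda>p. f (param c (coord c p)))"
    by (rule continuous_on_compose2[OF smooth_open_continuous_on[OF V(4)]])
      (auto intro: continuous_on_subset[OF continuous_on_coord[OF c(1)]])
  then have "continuous_on ?U f"
    by (rule continuous_on_eq) (use c in auto)
  then show ?thesis
    using open_coord_preimage[OF c(1) V(1)] c V by (simp add: continuous_on_eq_continuous_at)
qed

lemma smooth_map_iff:
  fixes f :: "'m \<Rightarrow> 'f::euclidean_space"
  assumes S: "open S"
  shows "smooth_map A std_atlas S f \<longleftrightarrow> (\<forall>m\<in>S. smooth_near f m)"
proof
  assume L: "smooth_map A std_atlas S f"
  show "\<forall>m\<in>S. smooth_near f m"
  proof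
    fix m assume m: "m \<in> S"
    obtain c where c: "c \<in> A" "m \<in> cdom c" by (rule ex_chart)
    have "smooth_within (coord c ` (S \<inter> cdom c)) (\<lambda>y. f (param c y))"
      using L c by (auto simp: smooth_map_def std_atlas_def o_def)
    then have "smooth_open (coord c ` (S \<inter> cdom c)) (\<lambda>y. f (param c y))"
      by (simp add: smooth_within_open_iff open_coord_image c S)
    then show "smooth_near f m"
      by (rule smooth_nearI[OF c open_coord_image[OF c(1) S], rotated]) (use c m in auto)
  qed
next
  assume R: "\<forall>m\<in>S. smooth_near f m"
  have "continuous_on S f"
    by (intro continuous_at_imp_continuous_on ballI smooth_near_isCont) (use R in blast)
  moreover have "smooth_within (coord c ` (S \<inter> cdom c)) (\<lambda>y. f (param c y))" if c: "c \<in> A" for c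
    unfolding smooth_within_open_iff[OF open_coord_image[OF c S]]
  proof (rule smooth_open_local)
    fix y assume "y \<in> coord c ` (S \<inter> cdom c)"
    then obtain m where m: "y = coord c m" "m \<in> S" "m \<in> cdom c" by auto
    then obtain V where V: "open V" "coord c m \<in> V" "V \<subseteq> coord c ` cdom c" "smooth_open V (\<lambda>y. f (param c y))"
      using smooth_nearD[of f m c] R c by blast
    then show "\<exists>U. open U \<and> y \<in> U \<and> smooth_open U (\<lambda>y. f (param c y))" using m by blast
  qed
  ultimately show "smooth_map A std_atlas S f"
    by (simp add: smooth_map_def std_atlas_def o_def)
qed

lemma smooth_near_jac:
  assumes c: "c \<in> A" "m \<in> cdom c" and d: "d \<in> A" "m \<in> cdom d"
  shows "smooth_near (\<lambda>p. jac c d p u) m"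
proof (rule smooth_nearI[OF c open_overlap[OF c(1) d(1)]])
  have "smooth_open (coord c ` (cdom c \<inter> cdom d)) (\<lambda>y. frechet_derivative (coord d \<circ> param c) (at y) u)"
    by (rule smooth_open_frechet[OF smooth_transition[OF c(1) d(1)]])
  then show "smooth_open (coord c ` (cdom c \<inter> cdom d)) (\<lambda>y. jac c d (param c y) u)"
    by (rule smooth_open_cong[OF open_overlap[OF c(1) d(1)], rotated]) (use c in \<open>auto simp: jac_def\<close>)
qed (use c d in auto)

text \<open>Components in another chart are obtained through the Jacobian, whose columns are smooth
  near each point, so one chart per point decides smoothness. Fields built by cutting off are
  checked in this form.\<close>

lemma vector_fields_iff:
  "X \<in> vector_fields A \<longleftrightarrow> (\<forall>m. X m \<in> tangent_space A m) \<and>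
     (\<forall>m. \<exists>c\<in>A. m \<in> cdom c \<and> smooth_near (\<lambda>p. X p c) m)" (is "?L = ?R")
proof
  assume ?L
  then show ?R
    unfolding vector_fields_def using ex_chart smooth_map_iff[OF open_cdom] by (metis (no_types, lifting) mem_Collect_eq)
next
  assume R: ?R
  have "smooth_near (\<lambda>p. X p d) m" if d: "d \<in> A" "m \<in> cdom d" for m d
  proof -
    obtain c where c: "c \<in> A" "m \<in> cdom c" "smooth_near (\<lambda>p. X p c) m" using R by blast
    have "smooth_near (\<lambda>p. \<Sum>b\<in>Basis. (X p c \<bullet> b) *\<^sub>R jac c d p b) m"
      by (intro smooth_near_sum smooth_near_scaleR smooth_near_inner smooth_near_const smooth_near_jac c d finite_Basis)
    then show ?thesis
    proof (rule smooth_near_cong)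
      show "open (cdom c \<inter> cdom d)" using c d open_cdom by blast
      fix p assume p: "p \<in> cdom c \<inter> cdom d"
      then have "X p d = jac c d p (X p c)" using R c d by (intro tangent_vec_jac[of "X p" p]) auto
      also have "\<dots> = (\<Sum>b\<in>Basis. (X p c \<bullet> b) *\<^sub>R jac c d p b)"
        using p c d by (intro linear_sum_Basis linear_jac) auto
      finally show "(\<Sum>b\<in>Basis. (X p c \<bullet> b) *\<^sub>R jac c d p b) = X p d" by simp
    qed (use c d in auto)
  qed
  then show ?L
    using R smooth_map_iff[OF open_cdom] unfolding vector_fields_def by blast
qed

lemma vector_field_tangent: "X \<in> vector_fields A \<Longrightarrow> X m \<in> tangent_space A m"
  by (simp add: vector_fields_def)

lemma vector_field_smooth: "X \<in> vector_fields A \<Longrightarrow> c \<in> A \<Longrightarrow> m \<in> cdom c \<Longrightarrow> smooth_near (\<lambda>p. X p c) m"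
  using smooth_map_iff[OF open_cdom] unfolding vector_fields_def by blast

lemma vector_field_add:
  assumes "X \<in> vector_fields A" "Y \<in> vector_fields A"
  shows "(\<lambda>m. tadd (X m) (Y m)) \<in> vector_fields A"
  unfolding vector_fields_iff
proof (intro conjI allI)
  fix m
  obtain c where c: "c \<in> A" "m \<in> cdom c" by (rule ex_chart)
  then show "\<exists>c\<in>A. m \<in> cdom c \<and> smooth_near (\<lambda>p. tadd (X p) (Y p) c) m"
    using assms by (auto simp: tadd_def intro!: bexI[of _ c] smooth_near_add vector_field_smooth)
qed (use assms in \<open>auto intro: tangent_add vector_field_tangent\<close>)

lemma vector_field_scale:
  assumes "X \<in> vector_fields A" "\<And>m. smooth_near f m"
  shows "(\<lambda>m. tscale (f m) (X m)) \<in> vector_fields A"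
  unfolding vector_fields_iff
proof (intro conjI allI)
  fix m
  obtain c where c: "c \<in> A" "m \<in> cdom c" by (rule ex_chart)
  then show "\<exists>c\<in>A. m \<in> cdom c \<and> smooth_near (\<lambda>p. tscale (f p) (X p) c) m"
    using assms by (auto simp: tscale_def intro!: bexI[of _ c] smooth_near_scaleR vector_field_smooth)
qed (use assms in \<open>auto intro: tangent_scale vector_field_tangent\<close>)

section \<open>Cutoff functions and globalization of local data\<close>

lemma ex_manifold_bump:
  assumes U: "open U" "m \<in> U"
  shows "\<exists>f :: 'm \<Rightarrow> real. \<exists>N K. (\<forall>p. smooth_near f p) \<and> open N \<and> m \<in> N \<and> N \<subseteq> U \<and> (\<forall>p\<in>N. f p = 1) \<and>
    closed K \<and> K \<subseteq> U \<and> (\<forall>p. p \<notin> K \<longrightarrow> f p = 0)"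
proof -
  obtain c where c: "c \<in> A" "m \<in> cdom c" by (rule ex_chart)
  obtain r where r: "r > 0" "cball (coord c m) r \<subseteq> coord c ` (U \<inter> cdom c)"
    using open_contains_cball open_coord_image[OF c(1) U(1)] U c by (metis IntI imageI)
  define r2 where "r2 = r / 2"
  have r2: "r2 > 0" "2 * r2 = r" using r by (auto simp: r2_def)
  obtain F :: "'e \<Rightarrow> real" where F: "smooth_open UNIV F" "\<And>x. x \<in> cball (coord c m) r2 \<Longrightarrow> F x = 1"
    "\<And>x. x \<notin> ball (coord c m) r \<Longrightarrow> F x = 0"
    using ex_bump_function[OF r2(1), of "coord c m"] r2(2) by auto
  define f where "f p = (if p \<in> U \<inter> cdom c then F (coord c p) else 0)" for p
  define K where "K = param c ` cball (coord c m) r"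
  define N where "N = U \<inter> (cdom c \<inter> coord c -` ball (coord c m) r2)"
  \<comment> \<open>The image of a closed coordinate ball is compact, hence closed in the Hausdorff
    space. Its complement is then an open set on which the function is 0, which makes the extension
    by 0 smooth across the edge of the chart.\<close>
  have "compact K"
    unfolding K_def using r c
    by (intro compact_continuous_image continuous_on_subset[OF continuous_on_param[OF c(1)]]) auto
  then have K: "closed K" by (rule compact_imp_closed)
  have KU: "K \<subseteq> U \<inter> cdom c"
    using r c unfolding K_def by auto
  have f0: "f p = 0" if "p \<notin> K" for p
  proof (cases "p \<in> U \<inter> cdom c")
    case True
    then have "coord c p \<notin> cball (coord c m) r"
      using that c by (auto simp: K_def rev_image_eqI)
    then have "coord c p \<notin> ball (coord c m) r" by auto
    then show ?thesis using F by (simp add: f_def)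
  qed (auto simp: f_def)
  have "smooth_near f p" for p
  proof (cases "p \<in> U \<inter> cdom c")
    case True
    have "smooth_open (coord c ` (U \<inter> cdom c)) (\<lambda>y. f (param c y))"
      by (rule smooth_open_cong[OF open_coord_image[OF c(1) U(1)] _ smooth_open_subset[OF F(1)]])
        (use c in \<open>auto simp: f_def\<close>)
    then show ?thesis
      by (rule smooth_nearI[OF c(1) _ open_coord_image[OF c(1) U(1)], rotated 2]) (use True in auto)
  next
    case False
    then have "p \<in> - K" using KU by blast
    then show ?thesis
      using K f0 by (intro smooth_near_cong[OF smooth_near_const[of 0], of "- K"]) auto
  qed
  moreover have "open N" unfolding N_def by (intro open_Int U open_coord_preimage c open_ball)
  moreover have "f p = 1" if "p \<in> N" for p
    using that F(2) by (auto simp: N_def f_def)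
  ultimately show ?thesis
    using K KU f0 U c r2 by (intro exI[of _ f] exI[of _ N] exI[of _ K]) (auto simp: N_def)
qed

lemma extend_function:
  fixes g :: "'m \<Rightarrow> real"
  assumes U: "open U" "m \<in> U" and g: "\<And>p. p \<in> U \<Longrightarrow> smooth_near g p"
  obtains f N where "\<And>p. smooth_near f p" "open N" "m \<in> N" "N \<subseteq> U" "\<And>p. p \<in> N \<Longrightarrow> f p = g p"
proof -
  obtain \<phi> :: "'m \<Rightarrow> real" and N K where \<phi>: "\<And>p. smooth_near \<phi> p" "open N" "m \<in> N" "N \<subseteq> U" "\<forall>p\<in>N. \<phi> p = 1"
    "closed K" "K \<subseteq> U" "\<And>p. p \<notin> K \<Longrightarrow> \<phi> p = 0"
    using ex_manifold_bump[OF U] by blast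
  define f where "f p = (if p \<in> U then \<phi> p *\<^sub>R g p else 0)" for p
  have "smooth_near f p" for p
  proof (cases "p \<in> U")
    case True
    show ?thesis
      by (rule smooth_near_cong[OF smooth_near_scaleR[OF \<phi>(1) g[OF True]] U(1) True]) (simp add: f_def)
  next
    case False
    then show ?thesis
      using \<phi> by (intro smooth_near_cong[OF smooth_near_const[of 0], of "- K"]) (auto simp: f_def)
  qed
  then show ?thesis using \<phi> by (intro that[of f N]) (auto simp: f_def)
qed

text \<open>Multiplication by a cutoff changes the field away from \<open>m\<close> but makes its
  extension by zero smooth; a local field thereby becomes an admissible argument of a
  connection.\<close>

lemma extend_vector_field:
  assumes U: "open U" "m \<in> U" and X: "\<And>p. p \<in> U \<Longrightarrow> X p \<in> tangent_space A p"
    "\<And>p. p \<in> U \<Longrightarrow> \<exists>c\<in>A. p \<in> cdom c \<and> smooth_near (\<lambda>q. X q c) p"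
  obtains X' N where "X' \<in> vector_fields A" "open N" "m \<in> N" "N \<subseteq> U" "\<And>p. p \<in> N \<Longrightarrow> X' p = X p"
proof -
  obtain \<phi> :: "'m \<Rightarrow> real" and N K where \<phi>: "\<And>p. smooth_near \<phi> p" "open N" "m \<in> N" "N \<subseteq> U" "\<forall>p\<in>N. \<phi> p = 1"
    "closed K" "K \<subseteq> U" "\<And>p. p \<notin> K \<Longrightarrow> \<phi> p = 0"
    using ex_manifold_bump[OF U] by blast
  define X' where "X' p = (if p \<in> U then tscale (\<phi> p) (X p) else tzero)" for p
  have "X' \<in> vector_fields A"
    unfolding vector_fields_iff
  proof (intro conjI allI)
    show "X' p \<in> tangent_space A p" for p
      using X by (auto simp: X'_def intro: tangent_scale tangent_zero)
    show "\<exists>c\<in>A. p \<in> cdom c \<and> smooth_near (\<lambda>q. X' q c) p" for p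
    proof (cases "p \<in> U")
      case True
      then obtain c where c: "c \<in> A" "p \<in> cdom c" "smooth_near (\<lambda>q. X q c) p" using X by blast
      have "smooth_near (\<lambda>q. X' q c) p"
        by (rule smooth_near_cong[OF smooth_near_scaleR[OF \<phi>(1) c(3)] U(1) True]) (simp add: X'_def tscale_def)
      then show ?thesis using c by blast
    next
      case False
      obtain c where c: "c \<in> A" "p \<in> cdom c" by (rule ex_chart)
      have "smooth_near (\<lambda>q. X' q c) p"
        using \<phi> False
        by (intro smooth_near_cong[OF smooth_near_const[of 0], of "- K"]) (auto simp: X'_def tscale_def tzero_def)
      then show ?thesis using c by blast
    qed
  qed
  then show ?thesis using \<phi> by (intro that[of X' N]) (auto simp: X'_def tscale_def)
qed

text \<open>A field that is constant in the chart, cut off around \<open>m\<close>, shows that the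
  choice in \<open>coord_field\<close> is not void.\<close>

lemma coord_field:
  assumes c: "c \<in> A" "m \<in> cdom c"
  shows "coord_field A c m u \<in> vector_fields A"
    and "\<exists>N. open N \<and> m \<in> N \<and> N \<subseteq> cdom c \<and> (\<forall>p\<in>N. coord_field A c m u p c = u)"
proof -
  have "\<exists>c'\<in>A. p \<in> cdom c' \<and> smooth_near (\<lambda>q. coord_vec A c q u c') p" if "p \<in> cdom c" for p
    using that c by (intro bexI[of _ c] conjI smooth_near_cong[OF smooth_near_const[of u] open_cdom])
      (auto simp: coord_vec_same)
  from extend_vector_field[of "cdom c" m "\<lambda>q. coord_vec A c q u", OF open_cdom[OF c(1)] c(2) coord_vec_in_tangent_space[OF c(1)] this]
  obtain X N where X: "X \<in> vector_fields A" "open N" "m \<in> N" "N \<subseteq> cdom c" "\<And>p. p \<in> N \<Longrightarrow> X p = coord_vec A c p u" by metis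
  have "X p c = u" if "p \<in> N" for p
    using X(5)[OF that] X(4) that coord_vec_same[OF c(1), of p u] by auto
  then have "\<exists>X. X \<in> vector_fields A \<and> (\<exists>N. open N \<and> m \<in> N \<and> N \<subseteq> cdom c \<and> (\<forall>p\<in>N. X p c = u))"
    using X by blast
  from someI_ex[OF this]
  show "coord_field A c m u \<in> vector_fields A"
    and "\<exists>N. open N \<and> m \<in> N \<and> N \<subseteq> cdom c \<and> (\<forall>p\<in>N. coord_field A c m u p c = u)"
    unfolding coord_field_def by auto
qed

lemma coord_field_at: "c \<in> A \<Longrightarrow> m \<in> cdom c \<Longrightarrow> coord_field A c m u m c = u"
  using coord_field(2) by blast

lemma ex_vector_field_through:
  assumes "v \<in> tangent_space A m"
  obtains X where "X \<in> vector_fields A" "X m = v"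
proof -
  obtain c where c: "c \<in> A" "m \<in> cdom c" by (rule ex_chart)
  have "coord_field A c m (v c) m = v"
    by (rule tangent_vec_eqI[OF vector_field_tangent[OF coord_field(1)[OF c]] assms c coord_field_at[OF c]])
  then show ?thesis using that coord_field(1)[OF c] by blast
qed

text \<open>The chain rule brings in the same Jacobian that relates the components of
  \<open>X m\<close>, so the chart chosen inside \<open>lie_deriv\<close> may be exchanged for any
  other.\<close>

lemma lie_deriv_eq:
  assumes f: "smooth_near f m" and X: "X m \<in> tangent_space A m" and c: "c \<in> A" "m \<in> cdom c"
  shows "lie_deriv A X f m = frechet_derivative (\<lambda>y. f (param c y)) (at (coord c m)) (X m c)"
proof -
  define d where "d = (SOME d. d \<in> A \<and> m \<in> cdom d)"
  have "\<exists>d. d \<in> A \<and> m \<in> cdom d" using c by blast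
  then have d: "d \<in> A" "m \<in> cdom d" unfolding d_def by (metis (mono_tags, lifting) someI_ex)+
  obtain V where V: "open V" "coord d m \<in> V" "V \<subseteq> coord d ` cdom d" "smooth_open V (\<lambda>y. f (param d y))"
    using smooth_nearD[OF f d] .
  let ?F = "\<lambda>y. f (param d y)"
  have F: "(?F has_derivative frechet_derivative ?F (at (coord d m))) (at ((coord d \<circ> param c) (coord c m)))"
    using smooth_open_has_derivative[OF V(4,2)] c by simp
  from diff_chain_at[OF transition_has_derivative[OF c(1) d(1) c(2) d(2)] this]
  have 1: "(?F \<circ> (coord d \<circ> param c) has_derivative frechet_derivative ?F (at (coord d m)) \<circ> jac c d m) (at (coord c m))" .
  have "((\<lambda>y. f (param c y)) has_derivative frechet_derivative ?F (at (coord d m)) \<circ> jac c d m) (at (coord c m))"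
    by (rule has_derivative_transform_within_open[OF 1 open_overlap[OF c(1) d(1)]]) (use c d in auto)
  then have "frechet_derivative (\<lambda>y. f (param c y)) (at (coord c m)) = frechet_derivative ?F (at (coord d m)) \<circ> jac c d m"
    by (rule frechet_derivative_at[symmetric])
  then show ?thesis
    using tangent_vec_jac[OF X c d] by (simp add: lie_deriv_def d_def[symmetric] Let_def o_def)
qed

end

section \<open>Affine connections in charts\<close>

locale connection_manifold = manifold A
  for A :: "('m::t2_space, 'e::euclidean_space) chart set" +
  fixes D :: "('m, 'e) connection"
  assumes conn: "affine_connection A D"
begin

lemma conn_field: "X \<in> vector_fields A \<Longrightarrow> Y \<in> vector_fields A \<Longrightarrow> D X Y \<in> vector_fields A"
  using conn by (simp add: affine_connection_def)

lemma conn_add_left: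
  "X \<in> vector_fields A \<Longrightarrow> X' \<in> vector_fields A \<Longrightarrow> Y \<in> vector_fields A \<Longrightarrow>
    D (\<lambda>m. tadd (X m) (X' m)) Y = (\<lambda>m. tadd (D X Y m) (D X' Y m))"
  using conn by (simp add: affine_connection_def)

lemma conn_add_right:
  "X \<in> vector_fields A \<Longrightarrow> Y \<in> vector_fields A \<Longrightarrow> Y' \<in> vector_fields A \<Longrightarrow>
    D X (\<lambda>m. tadd (Y m) (Y' m)) = (\<lambda>m. tadd (D X Y m) (D X Y' m))"
  using conn by (simp add: affine_connection_def)

lemma conn_scale_left:
  "X \<in> vector_fields A \<Longrightarrow> Y \<in> vector_fields A \<Longrightarrow> (\<And>m. smooth_near f m) \<Longrightarrow>
    D (\<lambda>m. tscale (f m) (X m)) Y = (\<lambda>m. tscale (f m) (D X Y m))"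
  using conn smooth_map_iff[OF open_UNIV, of f] by (simp add: affine_connection_def)

lemma conn_scale_right:
  "X \<in> vector_fields A \<Longrightarrow> Y \<in> vector_fields A \<Longrightarrow> (\<And>m. smooth_near f m) \<Longrightarrow>
    D X (\<lambda>m. tscale (f m) (Y m)) = (\<lambda>m. tadd (tscale (lie_deriv A X f m) (Y m)) (tscale (f m) (D X Y m)))"
  using conn smooth_map_iff[OF open_UNIV, of f] by (simp add: affine_connection_def)

text \<open>With a cutoff \<open>f\<close> supported in \<open>U\<close> the fields f X and f X' are
  equal, and the scaling rule in the direction brings \<open>f\<close> out with value 1 at
  \<open>m\<close>.\<close>

lemma conn_local_left:
  assumes X: "X \<in> vector_fields A" "X' \<in> vector_fields A" and Y: "Y \<in> vector_fields A"
    and U: "open U" "m \<in> U" "\<And>p. p \<in> U \<Longrightarrow> X p = X' p"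
  shows "D X Y m = D X' Y m"
proof -
  obtain f :: "'m \<Rightarrow> real" and N K where f: "\<And>p. smooth_near f p" "open N" "m \<in> N" "N \<subseteq> U" "\<forall>p\<in>N. f p = 1"
    "closed K" "K \<subseteq> U" "\<And>p. p \<notin> K \<Longrightarrow> f p = 0"
    using ex_manifold_bump[OF U(1,2)] by blast
  have "(\<lambda>p. tscale (f p) (X p)) = (\<lambda>p. tscale (f p) (X' p))"
  proof
    show "tscale (f p) (X p) = tscale (f p) (X' p)" for p
      using f(7,8) U(3) by (cases "p \<in> K") (auto simp: tscale_def)
  qed
  then have "tscale (f m) (D X Y m) = tscale (f m) (D X' Y m)"
    using conn_scale_left[OF X(1) Y f(1)] conn_scale_left[OF X(2) Y f(1)] by metis
  then show ?thesis using f(3,5) by (simp add: tscale_def)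
qed

text \<open>The same cutoff works: the additional Leibniz term (X f) Y involves only the value of
  the field at \<open>m\<close>, where both fields agree.\<close>

lemma conn_local_right:
  assumes X: "X \<in> vector_fields A" and Y: "Y \<in> vector_fields A" "Y' \<in> vector_fields A"
    and U: "open U" "m \<in> U" "\<And>p. p \<in> U \<Longrightarrow> Y p = Y' p"
  shows "D X Y m = D X Y' m"
proof -
  obtain f :: "'m \<Rightarrow> real" and N K where f: "\<And>p. smooth_near f p" "open N" "m \<in> N" "N \<subseteq> U" "\<forall>p\<in>N. f p = 1"
    "closed K" "K \<subseteq> U" "\<And>p. p \<notin> K \<Longrightarrow> f p = 0"
    using ex_manifold_bump[OF U(1,2)] by blast
  have "(\<lambda>p. tscale (f p) (Y p)) = (\<lambda>p. tscale (f p) (Y' p))"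
  proof
    show "tscale (f p) (Y p) = tscale (f p) (Y' p)" for p
      using f(7,8) U(3) by (cases "p \<in> K") (auto simp: tscale_def)
  qed
  then have "tadd (tscale (lie_deriv A X f m) (Y m)) (tscale (f m) (D X Y m))
     = tadd (tscale (lie_deriv A X f m) (Y' m)) (tscale (f m) (D X Y' m))"
    using conn_scale_right[OF X Y(1) f(1)] conn_scale_right[OF X Y(2) f(1)] by metis
  then show ?thesis using f(3,5) U(2,3) by (auto simp: tscale_def tadd_def fun_eq_iff)
qed

section \<open>Coordinate frames and Christoffel symbols\<close>

definition lincomb :: "('e \<Rightarrow> 'm \<Rightarrow> real) \<Rightarrow> ('e \<Rightarrow> ('m, 'e) vfield) \<Rightarrow> 'e set \<Rightarrow> ('m, 'e) vfield" where
  "lincomb F E I = (\<lambda>m d. \<Sum>b\<in>I. F b m *\<^sub>R E b m d)"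

text \<open>Written as the multiple by 0 of some field, the zero field falls under the scaling rules
  of a connection.\<close>

lemma lincomb_empty: "lincomb F E {} = (\<lambda>m. tscale 0 (X m))"
  by (simp add: lincomb_def tscale_def)

lemma lincomb_insert:
  "finite I \<Longrightarrow> b \<notin> I \<Longrightarrow>
    lincomb F E (insert b I) = (\<lambda>m. tadd (tscale (F b m) (E b m)) (lincomb F E I m))"
  by (simp add: lincomb_def tadd_def tscale_def)

lemma lincomb_field:
  assumes "finite I" "\<And>b m. smooth_near (F b) m" "\<And>b. E b \<in> vector_fields A"
  shows "lincomb F E I \<in> vector_fields A"
  using assms(1)
proof (induction I)
  case empty
  show ?case
    unfolding lincomb_empty[of F E "E 0"] by (intro vector_field_scale assms smooth_near_const)
next
  case (insert b I)
  then show ?case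
    unfolding lincomb_insert[OF insert(1,2)] by (intro vector_field_add vector_field_scale assms)
qed

lemma lie_deriv_const: "X \<in> vector_fields A \<Longrightarrow> lie_deriv A X (\<lambda>m. k) m = 0"
proof -
  assume X: "X \<in> vector_fields A"
  obtain c where c: "c \<in> A" "m \<in> cdom c" by (rule ex_chart)
  show ?thesis
    using lie_deriv_eq[where X = X, OF smooth_near_const vector_field_tangent[OF X] c] by simp
qed

lemma conn_lincomb_left:
  assumes "finite I" "\<And>b m. smooth_near (F b) m" "\<And>b. E b \<in> vector_fields A" "Y \<in> vector_fields A"
  shows "D (lincomb F E I) Y m d = (\<Sum>b\<in>I. F b m *\<^sub>R D (E b) Y m d)"
  using assms(1)
proof (induction I)
  case empty
  show ?case
    unfolding lincomb_empty[of F E "E 0"] conn_scale_left[OF assms(3,4) smooth_near_const]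
    by (simp add: tscale_def)
next
  case (insert b I)
  then show ?case
    unfolding lincomb_insert[OF insert(1,2)]
    using conn_add_left[OF vector_field_scale[OF assms(3,2)] lincomb_field[OF insert(1) assms(2,3)] assms(4)]
      conn_scale_left[OF assms(3,4,2)]
    by (simp add: tadd_def tscale_def)
qed

lemma conn_lincomb_right:
  assumes "finite I" "\<And>b m. smooth_near (F b) m" "\<And>b. E b \<in> vector_fields A" "X \<in> vector_fields A"
  shows "D X (lincomb F E I) m d = (\<Sum>b\<in>I. lie_deriv A X (F b) m *\<^sub>R E b m d + F b m *\<^sub>R D X (E b) m d)"
  using assms(1)
proof (induction I)
  case empty
  show ?case
    unfolding lincomb_empty[of F E "E 0"] conn_scale_right[OF assms(4,3) smooth_near_const]
    by (simp add: tscale_def tadd_def lie_deriv_const assms)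
next
  case (insert b I)
  then show ?case
    unfolding lincomb_insert[OF insert(1,2)]
    using conn_add_right[OF assms(4) vector_field_scale[OF assms(3,2)] lincomb_field[OF insert(1) assms(2,3)]]
      conn_scale_right[OF assms(4,3,2)]
    by (simp add: tadd_def tscale_def)
qed

text \<open>Components of \<open>Y\<close> exist on the chart domain only. Each is replaced by a
  global function that agrees with it near \<open>m\<close>, so that the expansion of
  \<open>Y\<close> near \<open>m\<close> is a combination to which the axioms of a connection
  apply.\<close>

lemma coord_frame:
  assumes c: "c \<in> A" "m \<in> cdom c" and Y: "Y \<in> vector_fields A"
  obtains F N where "\<And>b p. smooth_near (F b) p" "open N" "m \<in> N" "N \<subseteq> cdom c"
    "\<And>p. p \<in> N \<Longrightarrow> Y p = lincomb F (coord_field A c m) Basis p"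
    "\<And>b p. b \<in> Basis \<Longrightarrow> p \<in> N \<Longrightarrow> F b p = Y p c \<bullet> b"
proof -
  obtain U where U: "\<And>b. open (U b)" "\<And>b. m \<in> U b" "\<And>b. U b \<subseteq> cdom c"
    "\<And>b p. p \<in> U b \<Longrightarrow> coord_field A c m b p c = b"
    using coord_field(2)[OF c] by metis
  have Yb: "smooth_near (\<lambda>p. Y p c \<bullet> b) p" if "p \<in> cdom c" for b p
    by (intro smooth_near_inner smooth_near_const vector_field_smooth[OF Y c(1) that])
  have "\<exists>f N. (\<forall>p. smooth_near f p) \<and> open N \<and> m \<in> N \<and> N \<subseteq> U b \<and> (\<forall>p\<in>N. f p = Y p c \<bullet> b)" for b
    using extend_function[of "U b" m "\<lambda>p. Y p c \<bullet> b", OF U(1,2) Yb] U(3) by (metis subsetD)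
  then obtain F M where FM: "\<And>b p. smooth_near (F b) p" "\<And>b. open (M b)" "\<And>b. m \<in> M b" "\<And>b. M b \<subseteq> U b"
    "\<And>b p. p \<in> M b \<Longrightarrow> F b p = Y p c \<bullet> b"
    by metis
  define N where "N = (\<Inter>b\<in>Basis. M b)"
  have N: "open N" "m \<in> N" "\<And>b. b \<in> Basis \<Longrightarrow> N \<subseteq> M b"
    unfolding N_def using FM by auto
  obtain b0 :: 'e where "b0 \<in> Basis" using nonempty_Basis by blast
  then have Nc: "N \<subseteq> cdom c" using N(3) FM(4) U(3) by blast
  have "Y p = lincomb F (coord_field A c m) Basis p" if p: "p \<in> N" for p
  proof (rule tangent_vec_eqI[OF vector_field_tangent[OF Y] _ c(1)])
    show "lincomb F (coord_field A c m) Basis p \<in> tangent_space A p"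
      by (intro vector_field_tangent lincomb_field coord_field(1) c FM finite_Basis)
    show "p \<in> cdom c" using p Nc by blast
    have "F b p *\<^sub>R coord_field A c m b p c = (Y p c \<bullet> b) *\<^sub>R b" if b: "b \<in> Basis" for b
      using N(3)[OF b] FM(4,5) U(4) p by (metis subsetD)
    then show "Y p c = lincomb F (coord_field A c m) Basis p c"
      by (simp add: lincomb_def euclidean_representation)
  qed
  moreover have "F b p = Y p c \<bullet> b" if "b \<in> Basis" "p \<in> N" for b p
    using FM(5) N(3) that by blast
  ultimately show ?thesis using that[of F N] FM(1) N Nc by blast
qed

lemma conn_coord_left:
  assumes c: "c \<in> A" "m \<in> cdom c" and X: "X \<in> vector_fields A" and Y: "Y \<in> vector_fields A"
  shows "D X Y m d = (\<Sum>a\<in>Basis. (X m c \<bullet> a) *\<^sub>R D (coord_field A c m a) Y m d)"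
proof -
  obtain F N where F: "\<And>b p. smooth_near (F b) p" "open N" "m \<in> N" "N \<subseteq> cdom c"
    "\<And>p. p \<in> N \<Longrightarrow> X p = lincomb F (coord_field A c m) Basis p"
    "\<And>b p. b \<in> Basis \<Longrightarrow> p \<in> N \<Longrightarrow> F b p = X p c \<bullet> b"
    using coord_frame[OF c X] by blast
  have "D X Y m = D (lincomb F (coord_field A c m) Basis) Y m"
    by (rule conn_local_left[OF X _ Y F(2,3,5)]) (intro lincomb_field F coord_field c finite_Basis)
  then show ?thesis
    using conn_lincomb_left[OF finite_Basis F(1) coord_field(1)[OF c] Y] F(3,6) by simp
qed

lemma vector_field_has_derivative:
  assumes c: "c \<in> A" "m \<in> cdom c" and Y: "Y \<in> vector_fields A" and d: "d \<in> A" "m \<in> cdom d"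
  shows "((\<lambda>y. Y (param c y) d) has_derivative frechet_derivative (\<lambda>y. Y (param c y) d) (at (coord c m))) (at (coord c m))"
proof -
  obtain V where V: "open V" "coord c m \<in> V" "V \<subseteq> coord c ` cdom c" "smooth_open V (\<lambda>y. Y (param c y) d)"
    using smooth_nearD[OF vector_field_smooth[OF Y d] c] .
  then show ?thesis using smooth_open_has_derivative by blast
qed

lemma conn_coord_right:
  assumes c: "c \<in> A" "m \<in> cdom c" and X: "X \<in> vector_fields A" and Y: "Y \<in> vector_fields A"
  shows "D X Y m c = frechet_derivative (\<lambda>y. Y (param c y) c) (at (coord c m)) (X m c) +
    (\<Sum>b\<in>Basis. (Y m c \<bullet> b) *\<^sub>R D X (coord_field A c m b) m c)"
proof -
  let ?dY = "frechet_derivative (\<lambda>y. Y (param c y) c) (at (coord c m))"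
  obtain F N where F: "\<And>b p. smooth_near (F b) p" "open N" "m \<in> N" "N \<subseteq> cdom c"
    "\<And>p. p \<in> N \<Longrightarrow> Y p = lincomb F (coord_field A c m) Basis p"
    "\<And>b p. b \<in> Basis \<Longrightarrow> p \<in> N \<Longrightarrow> F b p = Y p c \<bullet> b"
    using coord_frame[OF c Y] by blast
  have lie: "lie_deriv A X (F b) m = ?dY (X m c) \<bullet> b" if b: "b \<in> Basis" for b
  proof -
    have "((\<lambda>y. Y (param c y) c \<bullet> b) has_derivative (\<lambda>v. ?dY v \<bullet> b)) (at (coord c m))"
      by (rule bounded_linear.has_derivative[OF bounded_linear_inner_left vector_field_has_derivative[OF c Y c]])
    then have "((\<lambda>y. F b (param c y)) has_derivative (\<lambda>v. ?dY v \<bullet> b)) (at (coord c m))"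
      by (rule has_derivative_transform_within_open[OF _ open_coord_image[OF c(1) F(2)]])
        (use c F b in auto)
    then show ?thesis
      using lie_deriv_eq[where X = X, OF F(1) vector_field_tangent[OF X] c] frechet_derivative_at by metis
  qed
  have "D X Y m = D X (lincomb F (coord_field A c m) Basis) m"
    by (rule conn_local_right[OF X Y _ F(2,3,5)]) (intro lincomb_field F coord_field c finite_Basis)
  then have "D X Y m c = D X (lincomb F (coord_field A c m) Basis) m c" by simp
  also have "\<dots> = (\<Sum>b\<in>Basis. lie_deriv A X (F b) m *\<^sub>R coord_field A c m b m c + F b m *\<^sub>R D X (coord_field A c m b) m c)"
    by (rule conn_lincomb_right[OF finite_Basis F(1) coord_field(1)[OF c] X])
  also have "\<dots> = (\<Sum>b\<in>Basis. (?dY (X m c) \<bullet> b) *\<^sub>R b + (Y m c \<bullet> b) *\<^sub>R D X (coord_field A c m b) m c)"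
    by (intro sum.cong refl) (simp add: lie F(6)[OF _ F(3)] coord_field_at c)
  finally show ?thesis by (simp add: sum.distrib euclidean_representation)
qed

abbreviation chr where "chr \<equiv> christoffel A D"

lemma coord_field_derivative:
  assumes c: "c \<in> A" "m \<in> cdom c"
  shows "frechet_derivative (\<lambda>y. coord_field A c m w (param c y) c) (at (coord c m)) v = 0"
proof -
  obtain N where N: "open N" "m \<in> N" "N \<subseteq> cdom c" "\<And>p. p \<in> N \<Longrightarrow> coord_field A c m w p c = w"
    using coord_field(2)[OF c, of w] by blast
  have "((\<lambda>y. w) has_derivative (\<lambda>v. 0)) (at (coord c m))" by simp
  then have "((\<lambda>y. coord_field A c m w (param c y) c) has_derivative (\<lambda>v. 0)) (at (coord c m))"
    by (rule has_derivative_transform_within_open[OF _ open_coord_image[OF c(1) N(1)]])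
      (use N c in auto)
  then show ?thesis using frechet_derivative_at by metis
qed

text \<open>Bilinearity is not visible in the definition, as the coordinate field of a sum is chosen
  independently of those of the summands. Locality and the expansion in a frame supply it; the
  derivative term drops out because coordinate fields are constant in the chart near
  \<open>m\<close>.\<close>

lemma christoffel_Basis:
  assumes c: "c \<in> A" "m \<in> cdom c"
  shows "chr c m u w = (\<Sum>a\<in>Basis. \<Sum>b\<in>Basis. (u \<bullet> a) *\<^sub>R (w \<bullet> b) *\<^sub>R chr c m a b)"
proof -
  have left: "chr c m u b = (\<Sum>a\<in>Basis. (u \<bullet> a) *\<^sub>R chr c m a b)" for b
    unfolding christoffel_def
    using conn_coord_left[OF c coord_field(1)[OF c, of u] coord_field(1)[OF c, of b], of c]
    by (simp only: coord_field_at[OF c])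
  have "chr c m u w = (\<Sum>b\<in>Basis. (w \<bullet> b) *\<^sub>R chr c m u b)"
    unfolding christoffel_def
    using conn_coord_right[OF c coord_field(1)[OF c, of u] coord_field(1)[OF c, of w]]
    by (simp only: coord_field_at[OF c] coord_field_derivative[OF c] add_0_left)
  also have "\<dots> = (\<Sum>b\<in>Basis. (w \<bullet> b) *\<^sub>R (\<Sum>a\<in>Basis. (u \<bullet> a) *\<^sub>R chr c m a b))"
    by (intro sum.cong refl arg_cong[where f = "scaleR _"] left)
  also have "\<dots> = (\<Sum>b\<in>Basis. \<Sum>a\<in>Basis. (u \<bullet> a) *\<^sub>R (w \<bullet> b) *\<^sub>R chr c m a b)"
    by (simp add: scaleR_sum_right mult.commute)
  also have "\<dots> = (\<Sum>a\<in>Basis. \<Sum>b\<in>Basis. (u \<bullet> a) *\<^sub>R (w \<bullet> b) *\<^sub>R chr c m a b)"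
    by (rule sum.swap)
  finally show ?thesis .
qed

lemma linear_christoffel_left:
  assumes c: "c \<in> A" "m \<in> cdom c"
  shows "linear (\<lambda>u. chr c m u w)"
proof
  show "chr c m (u + v) w = chr c m u w + chr c m v w" for u v
    unfolding christoffel_Basis[OF c, of "u + v"] christoffel_Basis[OF c, of u] christoffel_Basis[OF c, of v]
    by (simp add: inner_add_left scaleR_add_left distrib_right sum.distrib)
  show "chr c m (r *\<^sub>R u) w = r *\<^sub>R chr c m u w" for r u
    unfolding christoffel_Basis[OF c, of "r *\<^sub>R u"] christoffel_Basis[OF c, of u]
    by (simp add: scaleR_sum_right mult.assoc)
qed

lemma linear_christoffel_right:
  assumes c: "c \<in> A" "m \<in> cdom c"
  shows "linear (chr c m u)"
proof
  show "chr c m u (w + v) = chr c m u w + chr c m u v" for w v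
    unfolding christoffel_Basis[OF c, of u "w + v"] christoffel_Basis[OF c, of u w] christoffel_Basis[OF c, of u v]
    by (simp add: inner_add_left scaleR_add_left scaleR_add_right distrib_left sum.distrib)
  show "chr c m u (r *\<^sub>R w) = r *\<^sub>R chr c m u w" for r w
    unfolding christoffel_Basis[OF c, of u "r *\<^sub>R w"] christoffel_Basis[OF c, of u w]
    by (simp add: scaleR_sum_right mult.left_commute mult.assoc)
qed

lemma conn_chart:
  assumes c: "c \<in> A" "m \<in> cdom c" and X: "X \<in> vector_fields A" and Y: "Y \<in> vector_fields A"
  shows "D X Y m c = frechet_derivative (\<lambda>y. Y (param c y) c) (at (coord c m)) (X m c) + chr c m (X m c) (Y m c)"
proof -
  have "D X (coord_field A c m b) m c = (\<Sum>a\<in>Basis. (X m c \<bullet> a) *\<^sub>R chr c m a b)" for b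
    unfolding christoffel_def by (rule conn_coord_left[OF c X coord_field(1)[OF c]])
  then have "(\<Sum>b\<in>Basis. (Y m c \<bullet> b) *\<^sub>R D X (coord_field A c m b) m c)
     = (\<Sum>b\<in>Basis. \<Sum>a\<in>Basis. (X m c \<bullet> a) *\<^sub>R (Y m c \<bullet> b) *\<^sub>R chr c m a b)"
    by (simp add: scaleR_sum_right mult.commute)
  also have "\<dots> = chr c m (X m c) (Y m c)"
    unfolding christoffel_Basis[OF c, of "X m c"] by (rule sum.swap)
  finally show ?thesis using conn_coord_right[OF c X Y] by simp
qed

text \<open>The fields behind the symbols are chosen anew at every point. By locality the pair
  chosen at \<open>m\<close> serves all nearby points, and there the symbol is a component of one
  smooth field.\<close>

lemma smooth_near_christoffel:
  assumes c: "c \<in> A" "m \<in> cdom c"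
  shows "smooth_near (\<lambda>p. chr c p u w) m"
proof -
  obtain N where N: "open N" "m \<in> N" "N \<subseteq> cdom c" "\<And>p. p \<in> N \<Longrightarrow> coord_field A c m u p c = u"
    using coord_field(2)[OF c, of u] by blast
  obtain N' where N': "open N'" "m \<in> N'" "N' \<subseteq> cdom c" "\<And>p. p \<in> N' \<Longrightarrow> coord_field A c m w p c = w"
    using coord_field(2)[OF c, of w] by blast
  let ?X = "coord_field A c m u" and ?Y = "coord_field A c m w"
  have "smooth_near (\<lambda>p. D ?X ?Y p c) m"
    by (intro vector_field_smooth conn_field coord_field c)
  then show ?thesis
  proof (rule smooth_near_cong)
    show "open (N \<inter> N')" "m \<in> N \<inter> N'" using N N' by auto
    fix p assume p: "p \<in> N \<inter> N'"
    have pc: "p \<in> cdom c" using p N by auto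
    have eq: "\<exists>U. open U \<and> p \<in> U \<and> (\<forall>q\<in>U. Z q = coord_field A c p z q)"
      if Z: "Z \<in> vector_fields A" "open M" "p \<in> M" "M \<subseteq> cdom c" "\<And>q. q \<in> M \<Longrightarrow> Z q c = z" for Z M z
    proof -
      obtain V where V: "open V" "p \<in> V" "V \<subseteq> cdom c" "\<And>q. q \<in> V \<Longrightarrow> coord_field A c p z q c = z"
        using coord_field(2)[OF c(1) pc, of z] by blast
      have "Z q = coord_field A c p z q" if "q \<in> M \<inter> V" for q
        by (rule tangent_vec_eqI[OF vector_field_tangent[OF Z(1)] vector_field_tangent[OF coord_field(1)[OF c(1) pc]] c(1)])
          (use that Z V in auto)
      then show ?thesis using Z V by (intro exI[of _ "M \<inter> V"]) auto
    qed
    obtain U where U: "open U" "p \<in> U" "\<And>q. q \<in> U \<Longrightarrow> ?X q = coord_field A c p u q"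
      using eq[of ?X N u] coord_field(1)[OF c] N p by blast
    obtain U' where U': "open U'" "p \<in> U'" "\<And>q. q \<in> U' \<Longrightarrow> ?Y q = coord_field A c p w q"
      using eq[of ?Y N' w] coord_field(1)[OF c] N' p by blast
    have "D ?X ?Y p = D (coord_field A c p u) ?Y p"
      by (rule conn_local_left[OF _ _ _ U]) (use coord_field(1) c pc in auto)
    also have "\<dots> = D (coord_field A c p u) (coord_field A c p w) p"
      by (rule conn_local_right[OF _ _ _ U']) (use coord_field(1) c pc in auto)
    finally show "D ?X ?Y p c = chr c p u w" by (simp add: christoffel_def)
  qed
qed

text \<open>The chart formula in \<open>d\<close> is applied to the coordinate fields of
  \<open>c\<close>. Their components in \<open>d\<close> are first derivatives of the transition
  map, so differentiating them produces the second derivative.\<close>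

lemma christoffel_transform:
  assumes c: "c \<in> A" "m \<in> cdom c" and d: "d \<in> A" "m \<in> cdom d"
  shows "chr d m (jac c d m u) (jac c d m w) = jac c d m (chr c m u w) -
    frechet_derivative (\<lambda>y. frechet_derivative (coord d \<circ> param c) (at y) w) (at (coord c m)) u"
proof -
  let ?X = "coord_field A c m u" and ?Y = "coord_field A c m w"
  let ?G = "\<lambda>y. frechet_derivative (coord d \<circ> param c) (at y) w"
  let ?G' = "frechet_derivative ?G (at (coord c m))"
  have XY: "?X \<in> vector_fields A" "?Y \<in> vector_fields A" using coord_field(1)[OF c] by auto
  have "D ?X ?Y m d = jac c d m (chr c m u w)"
    unfolding christoffel_def by (intro tangent_vec_jac vector_field_tangent conn_field XY c d)
  moreover have "?X m d = jac c d m u" "?Y m d = jac c d m w"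
    using tangent_vec_jac[OF vector_field_tangent[OF XY(1)] c d] tangent_vec_jac[OF vector_field_tangent[OF XY(2)] c d]
      coord_field_at[OF c] by auto
  moreover have "frechet_derivative (\<lambda>z. ?Y (param d z) d) (at (coord d m)) (jac c d m u) = ?G' u"
  proof -
    obtain N where N: "open N" "m \<in> N" "N \<subseteq> cdom c" "\<And>p. p \<in> N \<Longrightarrow> ?Y p c = w"
      using coord_field(2)[OF c, of w] by blast
    have "(?G has_derivative ?G') (at ((coord c \<circ> param d) (coord d m)))"
      using smooth_open_has_derivative[OF smooth_open_frechet[OF smooth_transition[OF c(1) d(1)]], of "coord c m"] c d
      by auto
    from diff_chain_at[OF transition_has_derivative[OF d(1) c(1) d(2) c(2)] this]
    have 1: "(?G \<circ> (coord c \<circ> param d) has_derivative ?G' \<circ> jac d c m) (at (coord d m))" .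
    have "((\<lambda>z. ?Y (param d z) d) has_derivative ?G' \<circ> jac d c m) (at (coord d m))"
    proof (rule has_derivative_transform_within_open[OF 1])
      show "open (coord d ` ((N \<inter> cdom c) \<inter> cdom d))" by (intro open_coord_image open_Int N open_cdom c d)
      show "coord d m \<in> coord d ` ((N \<inter> cdom c) \<inter> cdom d)" using c d N by auto
      fix z assume "z \<in> coord d ` ((N \<inter> cdom c) \<inter> cdom d)"
      then obtain p where p: "z = coord d p" "p \<in> N" "p \<in> cdom c" "p \<in> cdom d" by auto
      have "?Y p d = jac c d p w"
        using tangent_vec_jac[OF vector_field_tangent[OF XY(2)] c(1) p(3) d(1) p(4)] N(4)[OF p(2)] by simp
      then show "(?G \<circ> (coord c \<circ> param d)) z = ?Y (param d z) d"
        using p c d by (simp add: jac_def)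
    qed
    then have "frechet_derivative (\<lambda>z. ?Y (param d z) d) (at (coord d m)) = ?G' \<circ> jac d c m"
      by (rule frechet_derivative_at[symmetric])
    then show ?thesis
      using jac_trans[OF c(1) d(1) c(1) c(2) d(2) c(2)] jac_same[OF c] by simp
  qed
  ultimately show ?thesis
    using conn_chart[OF d XY] by (simp add: eq_diff_eq add.commute)
qed

end

section \<open>Parallel transport along smooth families of curves\<close>

context connection_manifold
begin

text \<open>The velocity remains that of the curve on [0,1] even if [a,b] is shorter, so restriction
  and gluing do not alter the equation. It is demanded in all charts, so that no chart has to
  contain the whole piece.\<close>

definition solves :: "(real \<Rightarrow> 'm) \<Rightarrow> real \<Rightarrow> real \<Rightarrow> (real \<Rightarrow> ('m, 'e) tvec) \<Rightarrow> bool" where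
  "solves \<gamma> a b V \<longleftrightarrow> (\<forall>t\<in>{a..b}. V t \<in> tangent_space A (\<gamma> t)) \<and>
     (\<forall>t\<in>{a..b}. \<forall>e\<in>A. \<gamma> t \<in> cdom e \<longrightarrow>
        ((\<lambda>s. V s e) has_vector_derivative - chr e (\<gamma> t) (velocity A \<gamma> t e) (V t e)) (at t within {a..b}))"

lemma solves_subinterval:
  "solves \<gamma> a b V \<Longrightarrow> {a'..b'} \<subseteq> {a..b} \<Longrightarrow> solves \<gamma> a' b' V"
  unfolding solves_def by (blast intro: has_vector_derivative_within_subset)

text \<open>At the common time \<open>b\<close> the two one-sided derivatives agree, because the
  equation expresses both through the same vector.\<close>

lemma solves_glue:
  assumes V: "solves \<gamma> a b V" and V': "solves \<gamma> b c V'" and eq: "V b = V' b" and ab: "a \<le> b" "b \<le> c"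
  shows "solves \<gamma> a c (\<lambda>t. if t \<in> {a..b} then V t else V' t)"
  unfolding solves_def
proof (intro conjI ballI impI)
  fix t assume t: "t \<in> {a..c}"
  then show "(if t \<in> {a..b} then V t else V' t) \<in> tangent_space A (\<gamma> t)"
    using V V' by (auto simp: solves_def)
  fix e assume e: "e \<in> A" "\<gamma> t \<in> cdom e"
  have "((\<lambda>s. if s \<in> {a..b} then V s e else V' s e) has_vector_derivative
      (if t \<in> {a..b} then - chr e (\<gamma> t) (velocity A \<gamma> t e) (V t e) else - chr e (\<gamma> t) (velocity A \<gamma> t e) (V' t e)))
      (at t within {a..c})"
  proof (rule has_vector_derivative_If_within_closures[where T = "{b..c}"])
    show "t \<in> {a..b} \<union> {b..c}" "{a..c} = {a..b} \<union> {b..c}" using t ab by auto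
    have ab': "{a..b} \<union> (closure {a..b} \<inter> closure {b..c}) = {a..b}" "{b..c} \<union> (closure {a..b} \<inter> closure {b..c}) = {b..c}"
      using ab by auto
    show "((\<lambda>s. V s e) has_vector_derivative - chr e (\<gamma> t) (velocity A \<gamma> t e) (V t e))
        (at t within {a..b} \<union> (closure {a..b} \<inter> closure {b..c}))"
      if "t \<in> {a..b} \<union> (closure {a..b} \<inter> closure {b..c})"
      using that V e unfolding ab' by (simp add: solves_def)
    show "((\<lambda>s. V' s e) has_vector_derivative - chr e (\<gamma> t) (velocity A \<gamma> t e) (V' t e))
        (at t within {b..c} \<union> (closure {a..b} \<inter> closure {b..c}))"
      if "t \<in> {b..c} \<union> (closure {a..b} \<inter> closure {b..c})"
      using that V' e unfolding ab' by (simp add: solves_def)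
    have tb: "t = b" if "t \<in> closure {a..b}" "t \<in> closure {b..c}" using that by auto
    show "V t e = V' t e" if "t \<in> closure {a..b}" "t \<in> closure {b..c}"
      using tb[OF that] eq by simp
    show "- chr e (\<gamma> t) (velocity A \<gamma> t e) (V t e) = - chr e (\<gamma> t) (velocity A \<gamma> t e) (V' t e)"
      if "t \<in> closure {a..b}" "t \<in> closure {b..c}"
      using tb[OF that] eq by simp
  qed
  moreover have "(\<lambda>s. if s \<in> {a..b} then V s e else V' s e) = (\<lambda>s. (if s \<in> {a..b} then V s else V' s) e)"
    by auto
  ultimately show "((\<lambda>s. (if s \<in> {a..b} then V s else V' s) e) has_vector_derivative
      - chr e (\<gamma> t) (velocity A \<gamma> t e) ((if t \<in> {a..b} then V t else V' t) e)) (at t within {a..c})"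
    by (cases "t \<in> {a..b}") (simp_all del: atLeastAtMost_iff)
qed

lemma smooth_open_christoffel:
  assumes e: "e \<in> A"
  shows "smooth_open (coord e ` cdom e) (\<lambda>y. chr e (param e y) u w)"
proof (rule smooth_open_local)
  fix y assume "y \<in> coord e ` cdom e"
  then obtain m where m: "y = coord e m" "m \<in> cdom e" by auto
  obtain V where "open V" "coord e m \<in> V" "V \<subseteq> coord e ` cdom e" "smooth_open V (\<lambda>y. chr e (param e y) u w)"
    using smooth_nearD[OF smooth_near_christoffel[OF e m(2), of u w] e m(2)] .
  then show "\<exists>U. open U \<and> y \<in> U \<and> smooth_open U (\<lambda>y. chr e (param e y) u w)" using m by blast
qed

text \<open>The coefficient of the equation of parallel transport in the chart \<open>e\<close>, along curves
  \<open>t \<mapsto> h (p, t)\<close>.\<close>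

definition coeff :: "('m, 'e) chart \<Rightarrow> ('p::real_normed_vector \<times> real \<Rightarrow> 'e) \<Rightarrow> 'p \<times> real \<Rightarrow> 'e \<Rightarrow> 'e" where
  "coeff e h z w = - chr e (param e (h z)) (frechet_derivative h (at z) (0, 1)) w"

lemma smooth_open_coeff:
  fixes h :: "'p::euclidean_space \<times> real \<Rightarrow> 'e"
  assumes e: "e \<in> A" and U: "open U" and h: "smooth_open U h" "h ` U \<subseteq> coord e ` cdom e"
  shows "smooth_open U (\<lambda>z. coeff e h z w)"
proof -
  have "smooth_open U (\<lambda>z. \<Sum>a\<in>Basis. \<Sum>b\<in>Basis. (frechet_derivative h (at z) (0, 1) \<bullet> a) *\<^sub>R (w \<bullet> b) *\<^sub>R chr e (param e (h z)) a b)"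
    by (intro smooth_open_sum U finite_Basis smooth_open_scaleR smooth_open_inner smooth_open_const
        smooth_open_frechet h smooth_open_compose[OF smooth_open_christoffel[OF e] h(1) U open_coord_cdom[OF e] h(2)])
  then have "smooth_open U (\<lambda>z. chr e (param e (h z)) (frechet_derivative h (at z) (0, 1)) w)"
  proof (rule smooth_open_cong[OF U, rotated])
    fix z assume "z \<in> U"
    then have "param e (h z) \<in> cdom e" using h(2) param_in_cdom[OF e] by auto
    from christoffel_Basis[OF e this, of "frechet_derivative h (at z) (0, 1)" w]
    show "(\<Sum>a\<in>Basis. \<Sum>b\<in>Basis. (frechet_derivative h (at z) (0, 1) \<bullet> a) *\<^sub>R (w \<bullet> b) *\<^sub>R chr e (param e (h z)) a b)
      = chr e (param e (h z)) (frechet_derivative h (at z) (0, 1)) w" by (rule sym)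
  qed
  then show ?thesis unfolding coeff_def by (intro smooth_open_minus U)
qed

lemma linear_coeff:
  assumes "e \<in> A" "h z \<in> coord e ` cdom e"
  shows "linear (coeff e h z)"
proof -
  have "linear (\<lambda>w. - chr e (param e (h z)) (frechet_derivative h (at z) (0, 1)) w)"
    by (intro linear_compose_neg linear_christoffel_right param_in_cdom assms)
  then show ?thesis by (simp add: coeff_def[abs_def])
qed

end

section \<open>Smooth families of curves\<close>

lemma has_vector_derivative_second:
  assumes "smooth_open U h" "(p, t) \<in> U"
  shows "((\<lambda>t. h (p, t)) has_vector_derivative frechet_derivative h (at (p, t)) (0, 1)) (at t)"
proof -
  note h = smooth_open_has_derivative[OF assms]
  have "((\<lambda>t. (p, t)) has_derivative (\<lambda>d. d *\<^sub>R (0, 1))) (at t)"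
    by (auto intro!: derivative_eq_intros)
  from has_derivative_compose[OF this h] show ?thesis
    by (simp only: has_vector_derivative_def linear_cmul[OF has_derivative_linear[OF h]])
qed

lemma open_Pair_section:
  assumes "open U"
  shows "open {p. (p, t) \<in> U}"
proof -
  have "open ((\<lambda>p. (p, t)) -` U)" by (intro open_vimage assms continuous_intros)
  then show ?thesis by (simp add: vimage_def)
qed

lemma smooth_open_section:
  fixes h :: "'p::euclidean_space \<times> real \<Rightarrow> 'e::real_normed_vector"
  assumes "open U" "smooth_open U h"
  shows "smooth_open {p. (p, t) \<in> U} (\<lambda>p. h (p, t))"
  by (rule smooth_open_compose[OF assms(2) _ open_Pair_section[OF assms(1)] assms(1)])
    (auto intro!: smooth_open_Pair open_Pair_section assms smooth_open_ident smooth_open_const)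

text \<open>The domain of \<open>h\<close> is open and may reach outside [0,1], so derivatives at
  the end times are ordinary ones. Its image is kept in the chart so that the Christoffel symbols
  make sense along \<open>h\<close> also where no curve is given.\<close>

locale smooth_family = connection_manifold A D
  for A :: "('m::t2_space, 'e::euclidean_space) chart set" and D :: "('m, 'e) connection" +
  fixes P :: "'p::euclidean_space set" and G :: "'p \<Rightarrow> real \<Rightarrow> 'm"
  assumes open_P: "open P"
    and fam: "\<And>p t e. p \<in> P \<Longrightarrow> t \<in> {0..1} \<Longrightarrow> e \<in> A \<Longrightarrow> G p t \<in> cdom e \<Longrightarrow>
      \<exists>U h. open U \<and> (p, t) \<in> U \<and> smooth_open U h \<and> h ` U \<subseteq> coord e ` cdom e \<and>
        (\<forall>p' t'. (p', t') \<in> U \<longrightarrow> p' \<in> P \<longrightarrow> t' \<in> {0..1} \<longrightarrow> G p' t' \<in> cdom e \<and> coord e (G p' t') = h (p', t'))"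
begin

lemma open_slice:
  assumes "open U" "(p, t) \<in> U"
  obtains \<delta> where "\<delta> > 0" "\<And>t'. dist t' t < \<delta> \<Longrightarrow> (p, t') \<in> U"
proof -
  have "open ((\<lambda>t. (p, t)) -` U)" by (intro open_vimage assms continuous_intros)
  then obtain \<delta> where "\<delta> > 0" "ball t \<delta> \<subseteq> (\<lambda>t. (p, t)) -` U"
    using assms(2) open_contains_ball by blast
  then show ?thesis by (intro that[of \<delta>]) (auto simp: subset_eq dist_commute)
qed

lemma curve_near:
  assumes "p \<in> P" "t \<in> {0..1}" "e \<in> A" "G p t \<in> cdom e"
  obtains \<delta> where "\<delta> > 0" "\<And>t'. t' \<in> {0..1} \<Longrightarrow> dist t' t < \<delta> \<Longrightarrow> G p t' \<in> cdom e"
proof -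
  obtain U h where U: "open U" "(p, t) \<in> U"
    "\<forall>p' t'. (p', t') \<in> U \<longrightarrow> p' \<in> P \<longrightarrow> t' \<in> {0..1} \<longrightarrow> G p' t' \<in> cdom e \<and> coord e (G p' t') = h (p', t')"
    using fam[OF assms] by blast
  obtain \<delta> where "\<delta> > 0" "\<And>t'. dist t' t < \<delta> \<Longrightarrow> (p, t') \<in> U" using open_slice[OF U(1,2)] by metis
  then show ?thesis using U assms(1) by (intro that[of \<delta>]) auto
qed

lemma velocity_eq:
  assumes h: "smooth_open U h" "open U" "(p, t) \<in> U" and p: "p \<in> P" and t: "t \<in> {0..1}" and e: "e \<in> A"
    and G: "\<And>t'. (p, t') \<in> U \<Longrightarrow> t' \<in> {0..1} \<Longrightarrow> G p t' \<in> cdom e \<and> coord e (G p t') = h (p, t')"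
  shows "((coord e \<circ> G p) has_vector_derivative frechet_derivative h (at (p, t)) (0, 1)) (at t within {0..1})"
    and "velocity A (G p) t e = frechet_derivative h (at (p, t)) (0, 1)"
proof -
  obtain \<delta> where \<delta>: "\<delta> > 0" "\<And>t'. dist t' t < \<delta> \<Longrightarrow> (p, t') \<in> U" using open_slice[OF h(2,3)] by metis
  show 1: "((coord e \<circ> G p) has_vector_derivative frechet_derivative h (at (p, t)) (0, 1)) (at t within {0..1})"
    by (rule has_vector_derivative_transform_within[OF has_vector_derivative_at_within[OF has_vector_derivative_second[OF h(1,3)]] \<delta>(1) t])
      (use \<delta> G in auto)
  show "velocity A (G p) t e = frechet_derivative h (at (p, t)) (0, 1)"
    using vector_derivative_within_closed_interval[OF _ t 1] e G[OF h(3) t] by (simp add: velocity_def)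
qed

lemma velocity_has_derivative:
  assumes "p \<in> P" "t \<in> {0..1}" "e \<in> A" "G p t \<in> cdom e"
  shows "((coord e \<circ> G p) has_vector_derivative velocity A (G p) t e) (at t within {0..1})"
proof -
  obtain U h where U: "open U" "(p, t) \<in> U" "smooth_open U h"
    "\<forall>p' t'. (p', t') \<in> U \<longrightarrow> p' \<in> P \<longrightarrow> t' \<in> {0..1} \<longrightarrow> G p' t' \<in> cdom e \<and> coord e (G p' t') = h (p', t')"
    using fam[OF assms] by blast
  show ?thesis
    using velocity_eq[OF U(3,1,2) assms(1-3)] U(4) assms(1) by auto
qed

text \<open>It suffices to verify the equation in one chart around each point: the second derivatives of
  the transition map cancel.\<close>

lemma solves_one_chart:
  assumes p: "p \<in> P" and ab: "0 \<le> a" "b \<le> 1"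
    and tan: "\<And>t. t \<in> {a..b} \<Longrightarrow> V t \<in> tangent_space A (G p t)"
    and e: "e \<in> A" and Ge: "\<And>t. t \<in> {a..b} \<Longrightarrow> G p t \<in> cdom e"
    and V: "\<And>t. t \<in> {a..b} \<Longrightarrow>
      ((\<lambda>s. V s e) has_vector_derivative - chr e (G p t) (velocity A (G p) t e) (V t e)) (at t within {a..b})"
  shows "solves (G p) a b V"
  unfolding solves_def
proof (intro conjI ballI impI tan)
  fix t d assume t: "t \<in> {a..b}" and d: "d \<in> A" "G p t \<in> cdom d"
  let ?m = "G p t" and ?v = "velocity A (G p) t e" and ?w = "V t e"
  let ?Gb = "\<lambda>b y. frechet_derivative (coord d \<circ> param e) (at y) b"
  have t01: "t \<in> {0..1}" using t ab by auto
  have em: "?m \<in> cdom e" using Ge t by auto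
  have cur: "((coord e \<circ> G p) has_vector_derivative ?v) (at t within {a..b})"
    by (rule has_vector_derivative_within_subset[OF velocity_has_derivative[OF p t01 e em]]) (use ab in auto)
  have Gb: "(?Gb b has_derivative frechet_derivative (?Gb b) (at (coord e ?m))) (at (coord e ?m))" for b
    by (rule smooth_open_has_derivative[OF smooth_open_frechet[OF smooth_transition[OF e d(1)]]]) (use em d in auto)
  obtain \<delta> where \<delta>: "\<delta> > 0" "\<And>t'. t' \<in> {0..1} \<Longrightarrow> dist t' t < \<delta> \<Longrightarrow> G p t' \<in> cdom d"
    using curve_near[OF p t01 d] by blast
  have rep: "V s d = (\<Sum>b\<in>Basis. (V s e \<bullet> b) *\<^sub>R ?Gb b ((coord e \<circ> G p) s))" if s: "s \<in> {a..b}" "dist s t < \<delta>" for s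
  proof -
    have sd: "G p s \<in> cdom d" using \<delta>(2)[of s] s ab by auto
    have "V s d = jac e d (G p s) (V s e)"
      by (rule tangent_vec_jac[OF tan[OF s(1)] e Ge[OF s(1)] d(1) sd])
    also have "\<dots> = (\<Sum>b\<in>Basis. (V s e \<bullet> b) *\<^sub>R jac e d (G p s) b)"
      by (rule linear_sum_Basis[OF linear_jac[OF e d(1) Ge[OF s(1)] sd]])
    finally show ?thesis by (simp add: jac_def)
  qed
  have Gbc: "((\<lambda>s. ?Gb k ((coord e \<circ> G p) s)) has_vector_derivative frechet_derivative (?Gb k) (at (coord e ?m)) ?v) (at t within {a..b})" for k
  proof -
    have "(?Gb k has_derivative frechet_derivative (?Gb k) (at (coord e ?m))) (at ((coord e \<circ> G p) t))"
      using Gb[of k] by simp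
    from has_derivative_compose[OF cur[unfolded has_vector_derivative_def] this] show ?thesis
      by (simp only: has_vector_derivative_def linear_cmul[OF has_derivative_linear[OF Gb]])
  qed
  have "((\<lambda>s. \<Sum>b\<in>Basis. (V s e \<bullet> b) *\<^sub>R ?Gb b ((coord e \<circ> G p) s)) has_vector_derivative
      (\<Sum>b\<in>Basis. (?w \<bullet> b) *\<^sub>R frechet_derivative (?Gb b) (at (coord e ?m)) ?v + (- chr e ?m ?v ?w \<bullet> b) *\<^sub>R ?Gb b ((coord e \<circ> G p) t)))
      (at t within {a..b})"
    by (intro has_vector_derivative_sum bounded_bilinear.has_vector_derivative[OF bounded_bilinear_scaleR]
        bounded_linear.has_vector_derivative[OF bounded_linear_inner_left V[OF t]] Gbc)
  then have der: "((\<lambda>s. V s d) has_vector_derivative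
      (\<Sum>b\<in>Basis. (?w \<bullet> b) *\<^sub>R frechet_derivative (?Gb b) (at (coord e ?m)) ?v + (- chr e ?m ?v ?w \<bullet> b) *\<^sub>R ?Gb b ((coord e \<circ> G p) t)))
      (at t within {a..b})"
    by (rule has_vector_derivative_transform_within[OF _ \<delta>(1) t]) (simp add: rep)
  have J: "(\<Sum>b\<in>Basis. (u \<bullet> b) *\<^sub>R ?Gb b ((coord e \<circ> G p) t)) = jac e d ?m u" for u
    using linear_sum_Basis[OF linear_jac[OF e d(1) em d(2)], of u] by (simp add: jac_def)
  have "((\<lambda>y. \<Sum>b\<in>Basis. (?w \<bullet> b) *\<^sub>R ?Gb b y) has_derivative
      (\<lambda>u. \<Sum>b\<in>Basis. (?w \<bullet> b) *\<^sub>R frechet_derivative (?Gb b) (at (coord e ?m)) u)) (at (coord e ?m))"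
    by (intro has_derivative_sum has_derivative_scaleR_right Gb)
  then have "(?Gb ?w has_derivative
      (\<lambda>u. \<Sum>b\<in>Basis. (?w \<bullet> b) *\<^sub>R frechet_derivative (?Gb b) (at (coord e ?m)) u)) (at (coord e ?m))"
  proof (rule has_derivative_transform_within_open[OF _ open_overlap[OF e d(1)]])
    show "coord e ?m \<in> coord e ` (cdom e \<inter> cdom d)" using em d by auto
    fix y assume "y \<in> coord e ` (cdom e \<inter> cdom d)"
    then have "linear (frechet_derivative (coord d \<circ> param e) (at y))"
      by (intro has_derivative_linear[OF smooth_open_has_derivative[OF smooth_transition[OF e d(1)]]])
    from linear_sum_Basis[OF this, of ?w] show "(\<Sum>b\<in>Basis. (?w \<bullet> b) *\<^sub>R ?Gb b y) = ?Gb ?w y" by (rule sym)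
  qed
  \<comment> \<open>The transformation law differentiates the transition map in the fixed direction
    \<open>V t e\<close>, whereas the product rule has produced basis directions; linearity
    reconciles the two.\<close>
  then have D2: "frechet_derivative (?Gb ?w) (at (coord e ?m)) ?v =
      (\<Sum>b\<in>Basis. (?w \<bullet> b) *\<^sub>R frechet_derivative (?Gb b) (at (coord e ?m)) ?v)"
    by (rule fun_cong[OF frechet_derivative_at[symmetric]])
  have vel: "velocity A (G p) t d = jac e d ?m ?v"
  proof -
    have tr: "((coord d \<circ> param e) has_derivative jac e d ?m) (at ((coord e \<circ> G p) t))"
      using transition_has_derivative[OF e d(1) em d(2)] by simp
    have cur1: "((coord e \<circ> G p) has_vector_derivative ?v) (at t within {0..1})"
      by (rule velocity_has_derivative[OF p t01 e em])
    obtain \<delta>' where \<delta>': "\<delta>' > 0" "\<And>t'. t' \<in> {0..1} \<Longrightarrow> dist t' t < \<delta>' \<Longrightarrow> G p t' \<in> cdom e"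
      using curve_near[OF p t01 e em] by blast
    have "((\<lambda>s. (coord d \<circ> param e) ((coord e \<circ> G p) s)) has_vector_derivative jac e d ?m ?v) (at t within {0..1})"
      using has_derivative_compose[OF cur1[unfolded has_vector_derivative_def] tr] linear_cmul[OF has_derivative_linear[OF tr]]
      by (simp add: has_vector_derivative_def)
    then have "((coord d \<circ> G p) has_vector_derivative jac e d ?m ?v) (at t within {0..1})"
      by (rule has_vector_derivative_transform_within[OF _ \<delta>'(1) t01]) (use \<delta>' e in auto)
    then have "vector_derivative (coord d \<circ> G p) (at t within {0..1}) = jac e d ?m ?v"
      by (rule vector_derivative_within_closed_interval[OF zero_less_one t01])
    moreover have "velocity A (G p) t d = vector_derivative (coord d \<circ> G p) (at t within {0..1})"
      using d by (simp add: velocity_def)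
    ultimately show ?thesis by simp
  qed
  have Vd: "V t d = jac e d ?m ?w" by (rule tangent_vec_jac[OF tan[OF t] e em d])
  show "((\<lambda>s. V s d) has_vector_derivative - chr d ?m (velocity A (G p) t d) (V t d)) (at t within {a..b})"
    unfolding vel Vd christoffel_transform[OF e em d] D2
    using der by (simp only: sum.distrib J linear_neg[OF linear_jac[OF e d(1) em d(2)]]) (simp add: algebra_simps)
qed

text \<open>The velocity of a constant curve is 0, so the right-hand side of the equation vanishes
  and constant vectors are parallel.\<close>

lemma constant_solves:
  assumes p: "p \<in> P" and G: "\<And>t. t \<in> {0..1} \<Longrightarrow> G p t = m" and ab: "0 \<le> a" "b \<le> 1" and e: "e \<in> A" "m \<in> cdom e"
  shows "solves (G p) a b (\<lambda>t. coord_vec A e m u)"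
proof (rule solves_one_chart[OF p ab _ e(1)])
  fix t assume t: "t \<in> {a..b}"
  then have t01: "t \<in> {0..1}" using ab by auto
  show "coord_vec A e m u \<in> tangent_space A (G p t)" using G[OF t01] coord_vec_in_tangent_space e by simp
  show "G p t \<in> cdom e" using G[OF t01] e by simp
  have "((\<lambda>s. coord e m) has_vector_derivative 0) (at t within {0..1})" by simp
  then have cur: "((coord e \<circ> G p) has_vector_derivative 0) (at t within {0..1})"
    by (rule has_vector_derivative_transform_within[OF _ zero_less_one t01]) (use G in auto)
  have "velocity A (G p) t e = 0"
    using vector_derivative_within_closed_interval[OF _ t01 cur] by (simp add: velocity_def)
  then show "((\<lambda>s. coord_vec A e m u e) has_vector_derivative
      - chr e (G p t) (velocity A (G p) t e) (coord_vec A e m u e)) (at t within {a..b})"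
    using linear_0[OF linear_christoffel_left[OF e]] G[OF t01] by simp
qed

end

text \<open>A product neighbourhood in which the family stays in one chart and transport is an
  instance of \<open>linear_ode\<close>. The time interval may stick out of [0,1]; there only
  \<open>h\<close> is used.\<close>

locale flow_box = smooth_family A D P G
  for A :: "('m::t2_space, 'e::euclidean_space) chart set" and D :: "('m, 'e) connection"
    and P :: "'p::euclidean_space set" and G :: "'p \<Rightarrow> real \<Rightarrow> 'm" +
  fixes e :: "('m, 'e) chart" and h :: "'p \<times> real \<Rightarrow> 'e" and N :: "'p set" and \<alpha> \<beta> L :: real
  assumes e: "e \<in> A" and N: "open N" "convex N" "N \<subseteq> P"
    and h: "smooth_open (N \<times> {\<alpha><..<\<beta>}) h" "h ` (N \<times> {\<alpha><..<\<beta>}) \<subseteq> coord e ` cdom e"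
    and G_h: "\<And>p t. p \<in> N \<Longrightarrow> t \<in> {\<alpha><..<\<beta>} \<Longrightarrow> t \<in> {0..1} \<Longrightarrow> G p t \<in> cdom e \<and> coord e (G p t) = h (p, t)"
    and L: "0 \<le> L" "L * (\<beta> - \<alpha>) \<le> 1/2"
    and bound: "\<And>z w. z \<in> N \<times> {\<alpha><..<\<beta>} \<Longrightarrow> norm (coeff e h z w) \<le> L * norm w"
begin

abbreviation I where "I \<equiv> {\<alpha><..<\<beta>}"

lemma open_box: "open (N \<times> I)"
  using N by (intro open_Times) auto

lemma coeff_smooth: "smooth_open (N \<times> I) (\<lambda>z. coeff e h z w)"
  by (rule smooth_open_coeff[OF e open_box h])

lemma coeff_linear: "z \<in> N \<times> I \<Longrightarrow> linear (coeff e h z)"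
  using linear_coeff[OF e, of h z] h(2) by blast

lemma coeff_curve:
  assumes "p \<in> N" "t \<in> I" "t \<in> {0..1}"
  shows "coeff e h (p, t) w = - chr e (G p t) (velocity A (G p) t e) w"
proof -
  have pt: "(p, t) \<in> N \<times> I" using assms by auto
  have "velocity A (G p) t e = frechet_derivative h (at (p, t)) (0, 1)"
    by (rule velocity_eq(2)[OF h(1) open_box pt _ assms(3) e]) (use assms N G_h in auto)
  moreover have "param e (h (p, t)) = G p t"
    using G_h[OF assms] e by (metis param_coord)
  ultimately show ?thesis by (simp add: coeff_def)
qed

lemma ex_fundamental:
  assumes s: "s \<in> I"
  shows "\<exists>\<Psi>. (\<forall>u. smooth_open (N \<times> I) (\<lambda>z. \<Psi> z u)) \<and> (\<forall>z\<in>N \<times> I. linear (\<Psi> z)) \<and>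
    (\<forall>p\<in>N. \<forall>u. \<Psi> (p, s) u = u) \<and>
    (\<forall>p\<in>N. \<forall>t\<in>I. \<forall>u. ((\<lambda>t. \<Psi> (p, t) u) has_vector_derivative coeff e h (p, t) (\<Psi> (p, t) u)) (at t))"
proof -
  interpret linear_ode N \<alpha> \<beta> s L "coeff e h"
    by (rule linear_ode.intro) (use N s L coeff_linear bound smooth_open_continuous_on[OF coeff_smooth] in auto)
  show ?thesis by (rule fundamental_solution[OF coeff_smooth])
qed

lemma fundamental_solves:
  assumes \<Psi>: "\<And>p t u. p \<in> N \<Longrightarrow> t \<in> I \<Longrightarrow> ((\<lambda>t. \<Psi> (p, t) u) has_vector_derivative coeff e h (p, t) (\<Psi> (p, t) u)) (at t)"
    and p: "p \<in> N" and ab: "{a..b} \<subseteq> I" "0 \<le> a" "b \<le> 1"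
  shows "solves (G p) a b (\<lambda>t. coord_vec A e (G p t) (\<Psi> (p, t) u))"
proof (rule solves_one_chart[OF _ ab(2,3) _ e])
  show pP: "p \<in> P" using p N by auto
  fix t assume t: "t \<in> {a..b}"
  have t': "t' \<in> I \<and> t' \<in> {0..1}" if "t' \<in> {a..b}" for t' using that ab by auto
  have G: "G p t' \<in> cdom e" if "t' \<in> {a..b}" for t' using G_h p t'[OF that] by blast
  show "G p t \<in> cdom e" using G t by blast
  show "coord_vec A e (G p t) (\<Psi> (p, t) u) \<in> tangent_space A (G p t)"
    by (intro coord_vec_in_tangent_space e G t)
  have "((\<lambda>t. \<Psi> (p, t) u) has_vector_derivative - chr e (G p t) (velocity A (G p) t e) (\<Psi> (p, t) u)) (at t within {a..b})"
    using has_vector_derivative_at_within[OF \<Psi>[OF p, of t u]] t'[OF t] coeff_curve[OF p] by simp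
  then have "((\<lambda>s. coord_vec A e (G p s) (\<Psi> (p, s) u) e) has_vector_derivative
      - chr e (G p t) (velocity A (G p) t e) (\<Psi> (p, t) u)) (at t within {a..b})"
    by (rule has_vector_derivative_transform[OF t, rotated]) (simp add: coord_vec_same e G)
  then show "((\<lambda>s. coord_vec A e (G p s) (\<Psi> (p, s) u) e) has_vector_derivative
      - chr e (G p t) (velocity A (G p) t e) (coord_vec A e (G p t) (\<Psi> (p, t) u) e)) (at t within {a..b})"
    by (simp only: coord_vec_same[OF e G[OF t]])
qed

lemma fundamental_unique:
  assumes \<Psi>: "\<And>p t u. p \<in> N \<Longrightarrow> t \<in> I \<Longrightarrow> ((\<lambda>t. \<Psi> (p, t) u) has_vector_derivative coeff e h (p, t) (\<Psi> (p, t) u)) (at t)"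
      "\<And>p u. p \<in> N \<Longrightarrow> \<Psi> (p, s) u = u"
    and p: "p \<in> N" and ab: "{a..b} \<subseteq> I" "0 \<le> a" "b \<le> 1" and s: "s \<in> {a..b}" and t: "t \<in> {a..b}"
    and V: "solves (G p) a b V"
  shows "V t e = \<Psi> (p, t) (V s e)"
proof (rule linear_ode_unique[of a b "\<lambda>t. V t e" "\<lambda>t. coeff e h (p, t)" "\<lambda>t. 0" _ L s])
  have t': "t' \<in> I \<and> t' \<in> {0..1}" if "t' \<in> {a..b}" for t' using that ab by auto
  show "((\<lambda>t. V t e) has_vector_derivative coeff e h (p, t) (V t e) + 0) (at t within {a..b})" if "t \<in> {a..b}" for t
    using V that G_h[OF p, of t] t'[OF that] coeff_curve[OF p] e by (simp add: solves_def)
  show "((\<lambda>t. \<Psi> (p, t) (V s e)) has_vector_derivative coeff e h (p, t) (\<Psi> (p, t) (V s e)) + 0) (at t within {a..b})"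
    if "t \<in> {a..b}" for t
    using has_vector_derivative_at_within[OF \<Psi>(1)[OF p]] t'[OF that] by simp
  show "linear (coeff e h (p, t))" if "t \<in> {a..b}" for t
    using t'[OF that] p by (intro coeff_linear) auto
  show "norm (coeff e h (p, t) w) \<le> L * norm w" if "t \<in> {a..b}" for t w
    using t'[OF that] p by (intro bound) auto
  have "b - a \<le> \<beta> - \<alpha>" using t'[of a] t'[of b] s by auto
  then have "L * (b - a) \<le> L * (\<beta> - \<alpha>)" using L by (intro mult_left_mono)
  then show "L * (b - a) \<le> 1/2" using L by linarith
  show "V s e = \<Psi> (p, s) (V s e)" using \<Psi>(2)[OF p] by simp
qed (use s t in auto)

end

section \<open>Transport along a whole curve by subdivision\<close>

context smooth_family
begin

lemma ex_flow_box:
  assumes p0: "p0 \<in> P" and t0: "t0 \<in> {0..1}" and e: "e \<in> A" "G p0 t0 \<in> cdom e"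
  obtains h N \<delta> L where "p0 \<in> N" "\<delta> > 0" "flow_box A D P G e h N (t0 - \<delta>) (t0 + \<delta>) L"
proof -
  obtain U h where U: "open U" "(p0, t0) \<in> U" "smooth_open U h" "h ` U \<subseteq> coord e ` cdom e"
    "\<And>p' t'. (p', t') \<in> U \<Longrightarrow> p' \<in> P \<Longrightarrow> t' \<in> {0..1} \<Longrightarrow> G p' t' \<in> cdom e \<and> coord e (G p' t') = h (p', t')"
    using fam[OF p0 t0 e] by blast
  \<comment> \<open>Values at the centre, enlarged by 1, remain bounds on a neighbourhood by
    continuity.\<close>
  define M where "M b = norm (coeff e h (p0, t0) b) + 1" for b
  have cont: "continuous_on U (\<lambda>z. coeff e h z b)" for b
    by (rule smooth_open_continuous_on[OF smooth_open_coeff[OF e(1) U(1,3,4)]])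
  have "open (U \<inter> (\<lambda>z. norm (coeff e h z b)) -` {..<M b})" for b
    by (rule continuous_open_preimage[OF continuous_on_norm[OF cont] U(1) open_lessThan])
  then have W: "open (\<Inter>b\<in>Basis. U \<inter> (\<lambda>z. norm (coeff e h z b)) -` {..<M b})"
    by (intro open_INT finite_Basis) auto
  define W where "W = (\<Inter>b\<in>Basis. U \<inter> (\<lambda>z. norm (coeff e h z b)) -` {..<M b}) \<inter> (P \<times> UNIV)"
  have "open W" unfolding W_def by (intro open_Int W open_Times open_P open_UNIV)
  moreover have "(p0, t0) \<in> W" using U p0 by (auto simp: W_def M_def)
  ultimately obtain N1 T1 where N1: "open N1" "open T1" "p0 \<in> N1" "t0 \<in> T1" "N1 \<times> T1 \<subseteq> W"
    by (auto elim: open_prod_elim)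
  obtain r where r: "r > 0" "ball p0 r \<subseteq> N1" using N1 openE by blast
  obtain d where d: "d > 0" "ball t0 d \<subseteq> T1" using N1 openE by blast
  \<comment> \<open>Coordinates of \<open>w\<close> are at most \<open>norm w\<close>, so the sum of
    the bounds on basis vectors bounds the linear map.\<close>
  define L where "L = (\<Sum>b\<in>(Basis :: 'e set). M b)"
  have L0: "L \<ge> 0" unfolding L_def M_def by (intro sum_nonneg) auto
  \<comment> \<open>The time interval has length \<open>2 * \<delta>\<close>, and
    \<open>L / (2 * (L + 1))\<close> is at most \<open>1/2\<close>, also for
    \<open>L = 0\<close>.\<close>
  define \<delta> where "\<delta> = min d (1 / (4 * (L + 1)))"
  have \<delta>: "\<delta> > 0" using d L0 by (simp add: \<delta>_def)
  have sub: "ball p0 r \<times> {t0 - \<delta><..<t0 + \<delta>} \<subseteq> W"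
  proof -
    have "{t0 - \<delta><..<t0 + \<delta>} \<subseteq> ball t0 d" by (auto simp: \<delta>_def dist_real_def)
    then show ?thesis using r d N1 by blast
  qed
  obtain b0 :: 'e where "b0 \<in> Basis" using nonempty_Basis by blast
  then have WU: "W \<subseteq> U" by (auto simp: W_def)
  have "flow_box A D P G e h (ball p0 r) (t0 - \<delta>) (t0 + \<delta>) L"
  proof
    show "ball p0 r \<subseteq> P"
    proof
      fix x assume "x \<in> ball p0 r"
      then have "(x, t0) \<in> W" using \<delta> by (intro subsetD[OF sub]) simp
      then show "x \<in> P" by (simp add: W_def)
    qed
    show "smooth_open (ball p0 r \<times> {t0 - \<delta><..<t0 + \<delta>}) h"
      using smooth_open_subset[OF U(3)] sub WU by blast
    show "h ` (ball p0 r \<times> {t0 - \<delta><..<t0 + \<delta>}) \<subseteq> coord e ` cdom e"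
      using U(4) sub WU by blast
    show "G p t \<in> cdom e \<and> coord e (G p t) = h (p, t)"
      if "p \<in> ball p0 r" "t \<in> {t0 - \<delta><..<t0 + \<delta>}" "t \<in> {0..1}" for p t
    proof -
      have "(p, t) \<in> W" using sub that by blast
      then show ?thesis using U(5)[of p t] WU that by (auto simp: W_def)
    qed
    have "L * (4 * \<delta>) \<le> L * (1 / (L + 1))"
      using L0 by (intro mult_left_mono) (auto simp: \<delta>_def min_def field_simps)
    also have "\<dots> \<le> 1" using L0 by simp
    finally show "L * (t0 + \<delta> - (t0 - \<delta>)) \<le> 1/2" by simp
    show "norm (coeff e h z w) \<le> L * norm w" if z: "z \<in> ball p0 r \<times> {t0 - \<delta><..<t0 + \<delta>}" for z w
    proof -
      have zW: "z \<in> W" using sub z by blast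
      then have "h z \<in> coord e ` cdom e" using U(4) WU by blast
      from linear_sum_Basis[OF linear_coeff[of e h z, OF e(1) this], of w]
      have "norm (coeff e h z w) = norm (\<Sum>b\<in>Basis. (w \<bullet> b) *\<^sub>R coeff e h z b)" by simp
      also have "\<dots> \<le> (\<Sum>b\<in>Basis. norm ((w \<bullet> b) *\<^sub>R coeff e h z b))" by (rule norm_sum)
      also have "\<dots> \<le> (\<Sum>b\<in>Basis. norm w * M b)"
        using zW by (intro sum_mono) (auto simp: W_def intro!: mult_mono Basis_le_norm)
      finally show ?thesis by (simp add: L_def sum_distrib_left mult.commute)
    qed
  qed (use e L0 in auto)
  then show ?thesis using r \<delta> by (intro that[of "ball p0 r" \<delta> h L]) auto
qed

text \<open>Existence for every initial component and the end value of every solution are stated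
  together, so that transport is well defined. Separate charts at the two ends allow composition
  along a curve that fits into no single chart.\<close>

definition transports ::
  "'p set \<Rightarrow> real \<Rightarrow> real \<Rightarrow> ('m, 'e) chart \<Rightarrow> ('m, 'e) chart \<Rightarrow> ('p \<Rightarrow> 'e \<Rightarrow> 'e) \<Rightarrow> bool" where
  "transports N a b e e' \<Phi> \<longleftrightarrow> open N \<and> N \<subseteq> P \<and> (\<forall>u. smooth_open N (\<lambda>p. \<Phi> p u)) \<and>
     (\<forall>p\<in>N. G p a \<in> cdom e \<and> G p b \<in> cdom e' \<and> linear (\<Phi> p) \<and>
        (\<forall>u. \<exists>V. solves (G p) a b V \<and> V a e = u) \<and>
        (\<forall>V. solves (G p) a b V \<longrightarrow> V b e' = \<Phi> p (V a e)))"

text \<open>Over an interval of length 0 transport is a mere change of chart. Composing with it at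
  both ends adapts a piece computed in one chart to prescribed ones.\<close>

lemma transports_refl:
  assumes p0: "p0 \<in> P" and t: "t \<in> {0..1}" and e: "e \<in> A" "G p0 t \<in> cdom e" and e': "e' \<in> A" "G p0 t \<in> cdom e'"
  shows "\<exists>N. p0 \<in> N \<and> transports N t t e e' (\<lambda>p. jac e e' (G p t))"
proof -
  obtain U h where U: "open U" "(p0, t) \<in> U" "smooth_open U h"
    "\<And>p' t'. (p', t') \<in> U \<Longrightarrow> p' \<in> P \<Longrightarrow> t' \<in> {0..1} \<Longrightarrow> G p' t' \<in> cdom e \<and> coord e (G p' t') = h (p', t')"
    using fam[OF p0 t e] by blast
  obtain U' h' where U': "open U'" "(p0, t) \<in> U'"
    "\<And>p' t'. (p', t') \<in> U' \<Longrightarrow> p' \<in> P \<Longrightarrow> t' \<in> {0..1} \<Longrightarrow> G p' t' \<in> cdom e' \<and> coord e' (G p' t') = h' (p', t')"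
    using fam[OF p0 t e'] by blast
  define N where "N = {p. (p, t) \<in> U} \<inter> {p. (p, t) \<in> U'} \<inter> P"
  have N: "open N" unfolding N_def by (intro open_Int open_Pair_section U U' open_P)
  have G: "G p t \<in> cdom e" "G p t \<in> cdom e'" "coord e (G p t) = h (p, t)" if "p \<in> N" for p
    using that U(4)[of p t] U'(3)[of p t] t by (auto simp: N_def)
  have "smooth_open N (\<lambda>p. jac e e' (G p t) u)" for u
  proof (rule smooth_open_cong[OF N])
    show "smooth_open N (\<lambda>p. frechet_derivative (coord e' \<circ> param e) (at (h (p, t))) u)"
    proof (rule smooth_open_compose[OF smooth_open_frechet[OF smooth_transition[OF e(1) e'(1)]] _ N open_overlap[OF e(1) e'(1)]])
      show "smooth_open N (\<lambda>p. h (p, t))"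
        by (rule smooth_open_subset[OF smooth_open_section[OF U(1,3)]]) (auto simp: N_def)
      show "(\<lambda>p. h (p, t)) ` N \<subseteq> coord e ` (cdom e \<inter> cdom e')"
        using G by (metis (no_types, lifting) IntI image_subsetI rev_image_eqI)
    qed
    show "frechet_derivative (coord e' \<circ> param e) (at (h (p, t))) u = jac e e' (G p t) u" if "p \<in> N" for p
      using G(3)[OF that] by (simp add: jac_def)
  qed
  moreover have "\<exists>V. solves (G p) t t V \<and> V t e = u" if p: "p \<in> N" for p u
  proof (intro exI[of _ "\<lambda>s. coord_vec A e (G p t) u"] conjI)
    show "coord_vec A e (G p t) u e = u" using G[OF p] e by (simp add: coord_vec_same)
    \<comment> \<open>A derivative within a one-point set is no condition, so only tangency
      matters.\<close>
    show "solves (G p) t t (\<lambda>s. coord_vec A e (G p t) u)"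
      using coord_vec_in_tangent_space[OF e(1) G(1)[OF p]]
      by (auto simp: solves_def has_vector_derivative_def has_derivative_within_singleton_iff
          intro!: bounded_linear_minus bounded_linear_scaleR_left)
  qed
  moreover have "V t e' = jac e e' (G p t) (V t e)" if "p \<in> N" "solves (G p) t t V" for p V
    using that G e e' by (intro tangent_vec_jac[of _ "G p t"]) (auto simp: solves_def)
  ultimately have "transports N t t e e' (\<lambda>p. jac e e' (G p t))"
    unfolding transports_def using N G e e' linear_jac by (auto simp: N_def)
  moreover have "p0 \<in> N" using U U' p0 by (simp add: N_def)
  ultimately show ?thesis by blast
qed

lemma smooth_open_apply:
  assumes "open N" "\<And>u. smooth_open N (\<lambda>p. \<Phi> p u)" "\<And>p. p \<in> N \<Longrightarrow> linear (\<Phi> p)" "smooth_open N f"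
  shows "smooth_open N (\<lambda>p. \<Phi> p (f p :: 'e) :: 'f::real_normed_vector)"
proof (rule smooth_open_cong[OF assms(1)])
  show "smooth_open N (\<lambda>p. \<Sum>b\<in>Basis. (f p \<bullet> b) *\<^sub>R \<Phi> p b)"
    by (intro smooth_open_sum smooth_open_scaleR smooth_open_inner smooth_open_const assms finite_Basis)
  show "(\<Sum>b\<in>Basis. (f p \<bullet> b) *\<^sub>R \<Phi> p b) = \<Phi> p (f p)" if "p \<in> N" for p
    by (rule linear_sum_Basis[OF assms(3)[OF that], symmetric])
qed

text \<open>For existence, the second piece is started at the vector reached by the first and both
  are glued. For the end value, every solution restricts to the two pieces.\<close>

lemma transports_comp:
  assumes T: "transports N a b e e' \<Phi>" and T': "transports N' b c e' e'' \<Phi>'"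
    and abc: "0 \<le> a" "a \<le> b" "b \<le> c" "c \<le> 1" and e: "e \<in> A" "e' \<in> A"
  shows "transports (N \<inter> N') a c e e'' (\<lambda>p u. \<Phi>' p (\<Phi> p u))"
proof -
  have N: "open (N \<inter> N')" using T T' by (auto simp: transports_def)
  have "smooth_open (N \<inter> N') (\<lambda>p. \<Phi>' p (\<Phi> p u))" for u
    by (rule smooth_open_apply[OF N])
      (use T T' in \<open>auto simp: transports_def intro: smooth_open_subset\<close>)
  moreover have "linear (\<lambda>u. \<Phi>' p (\<Phi> p u))" if "p \<in> N \<inter> N'" for p
    using linear_compose[of "\<Phi> p" "\<Phi>' p"] that T T' by (simp add: transports_def o_def)
  moreover have "\<exists>V. solves (G p) a c V \<and> V a e = u" if p: "p \<in> N \<inter> N'" for p u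
  proof -
    obtain V where V: "solves (G p) a b V" "V a e = u" using T p unfolding transports_def by blast
    obtain V' where V': "solves (G p) b c V'" "V' b e' = V b e'" using T' p unfolding transports_def by blast
    have "V b = V' b"
      by (rule tangent_vec_eqI[of _ "G p b" _ e'])
        (use V V' T p e abc in \<open>auto simp: solves_def transports_def\<close>)
    from solves_glue[OF V(1) V'(1) this abc(2,3)] show ?thesis
      using V(2) abc by (intro exI[of _ "\<lambda>t. if t \<in> {a..b} then V t else V' t"]) simp
  qed
  moreover have "V c e'' = \<Phi>' p (\<Phi> p (V a e))" if p: "p \<in> N \<inter> N'" and V: "solves (G p) a c V" for p V
  proof -
    have "solves (G p) a b V" "solves (G p) b c V"
      using V abc by (auto intro: solves_subinterval)
    then show ?thesis using T T' p by (simp add: transports_def)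
  qed
  ultimately show ?thesis
    using N T T' unfolding transports_def by blast
qed

end

context flow_box
begin

lemma flow_transports:
  assumes ab: "a \<le> b" "{a..b} \<subseteq> I" "0 \<le> a" "b \<le> 1"
  shows "\<exists>\<Psi>. (\<forall>u. smooth_open (N \<times> I) (\<lambda>z. \<Psi> z u)) \<and> (\<forall>p\<in>N. \<forall>u. \<Psi> (p, a) u = u) \<and>
    (\<forall>p\<in>N. \<forall>t\<in>I. \<forall>u. ((\<lambda>t. \<Psi> (p, t) u) has_vector_derivative coeff e h (p, t) (\<Psi> (p, t) u)) (at t)) \<and>
    (\<forall>t\<in>{a..b}. transports N a t e e (\<lambda>p. \<Psi> (p, t)))"
proof -
  have aI: "a \<in> I" using ab by auto
  obtain \<Psi> where \<Psi>': "\<forall>u. smooth_open (N \<times> I) (\<lambda>z. \<Psi> z u)" "\<forall>z\<in>N \<times> I. linear (\<Psi> z)"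
    "\<forall>p\<in>N. \<forall>u. \<Psi> (p, a) u = u"
    "\<forall>p\<in>N. \<forall>t\<in>I. \<forall>u. ((\<lambda>t. \<Psi> (p, t) u) has_vector_derivative coeff e h (p, t) (\<Psi> (p, t) u)) (at t)"
    using ex_fundamental[OF aI] by blast
  note \<Psi> = \<Psi>'(1)[rule_format] \<Psi>'(2)[rule_format] \<Psi>'(3)[rule_format] \<Psi>'(4)[rule_format]
  have "transports N a t e e (\<lambda>p. \<Psi> (p, t))" if t: "t \<in> {a..b}" for t
    unfolding transports_def
  proof (intro conjI allI ballI impI N)
    have tI: "t \<in> I" "t \<in> {0..1}" "a \<in> {0..1}" using t ab by auto
    have at: "{a..t} \<subseteq> I" "t \<le> 1" using t ab by auto
    show "smooth_open N (\<lambda>p. \<Psi> (p, t) u)" for u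
      by (rule smooth_open_subset[OF smooth_open_section[OF open_box \<Psi>(1)]]) (use tI in auto)
    fix p assume p: "p \<in> N"
    show Ga: "G p a \<in> cdom e" and "G p t \<in> cdom e" using G_h[OF p] tI aI by auto
    show "linear (\<Psi> (p, t))" using \<Psi>(2) p tI by auto
    show "\<exists>V. solves (G p) a t V \<and> V a e = u" for u
      using fundamental_solves[OF \<Psi>(4) p at(1) ab(3) at(2), where u = u] \<Psi>(3)[OF p] Ga e
      by (intro exI[of _ "\<lambda>t. coord_vec A e (G p t) (\<Psi> (p, t) u)"]) (simp add: coord_vec_same)
    show "V t e = \<Psi> (p, t) (V a e)" if "solves (G p) a t V" for V
      by (rule fundamental_unique[OF \<Psi>(4,3) p at(1) ab(3) at(2) _ _ that]) (use t in auto)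
  qed
  then show ?thesis using \<Psi>' by blast
qed

end

context smooth_family
begin

text \<open>A flow box around (p0, t0) contains every sufficiently short interval around
  \<open>t0\<close>; chart changes at both ends then replace the chart of the box by the required
  ones.\<close>

lemma local_transport:
  assumes p0: "p0 \<in> P" and t0: "t0 \<in> {0..1}"
  shows "\<exists>\<delta>>0. \<forall>a b. a \<le> t0 \<and> t0 \<le> b \<and> b - a < \<delta> \<longrightarrow> 0 \<le> a \<longrightarrow> b \<le> 1 \<longrightarrow>
    (\<forall>e\<in>A. \<forall>e'\<in>A. G p0 a \<in> cdom e \<longrightarrow> G p0 b \<in> cdom e' \<longrightarrow> (\<exists>N \<Phi>. p0 \<in> N \<and> transports N a b e e' \<Phi>))"
proof -
  obtain d where d: "d \<in> A" "G p0 t0 \<in> cdom d" by (rule ex_chart)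
  obtain h N \<delta> L where B: "p0 \<in> N" "\<delta> > 0" "flow_box A D P G d h N (t0 - \<delta>) (t0 + \<delta>) L"
    using ex_flow_box[OF p0 t0 d] .
  interpret flow_box A D P G d h N "t0 - \<delta>" "t0 + \<delta>" L by (rule B(3))
  show ?thesis
  proof (intro exI[of _ \<delta>] conjI allI impI ballI B(2))
    fix a b e e' assume ab: "a \<le> t0 \<and> t0 \<le> b \<and> b - a < \<delta>" "0 \<le> a" "b \<le> 1"
      and e': "e \<in> A" "e' \<in> A" "G p0 a \<in> cdom e" "G p0 b \<in> cdom e'"
    have ab': "a \<le> b" "{a..b} \<subseteq> I" "a \<in> I" "b \<in> I" "a \<in> {0..1}" "b \<in> {0..1}" using ab by auto
    obtain \<Psi> where "\<forall>t\<in>{a..b}. transports N a t d d (\<lambda>p. \<Psi> (p, t))"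
      using flow_transports[OF ab'(1,2) ab(2,3)] by blast
    then have T: "transports N a b d d (\<lambda>p. \<Psi> (p, b))" using ab' by auto
    have Gd: "G p0 a \<in> cdom d" "G p0 b \<in> cdom d" using G_h[OF B(1)] ab' by blast+
    obtain N1 where N1: "p0 \<in> N1" "transports N1 a a e d (\<lambda>p. jac e d (G p a))"
      using transports_refl[OF p0 ab'(5) e'(1,3) d(1) Gd(1)] by blast
    obtain N2 where N2: "p0 \<in> N2" "transports N2 b b d e' (\<lambda>p. jac d e' (G p b))"
      using transports_refl[OF p0 ab'(6) d(1) Gd(2) e'(2,4)] by blast
    have "transports (N1 \<inter> N) a b e d (\<lambda>p u. \<Psi> (p, b) (jac e d (G p a) u))"
      by (rule transports_comp[OF N1(2) T]) (use ab ab' d e' in auto)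
    then have "transports (N1 \<inter> N \<inter> N2) a b e e' (\<lambda>p u. jac d e' (G p b) (\<Psi> (p, b) (jac e d (G p a) u)))"
      by (rule transports_comp[OF _ N2(2)]) (use ab ab' d e' in auto)
    moreover have "p0 \<in> N1 \<inter> N \<inter> N2" using N1 N2 B by blast
    ultimately show "\<exists>N \<Phi>. p0 \<in> N \<and> transports N a b e e' \<Phi>" by (intro exI conjI)
  qed
qed

text \<open>The subdivision is left to the bisection principle \<open>Bolzano\<close>: the property
  holds on short intervals and passes to unions of adjacent ones. Each composition intersects two
  parameter neighbourhoods, which keeps them open around \<open>p0\<close>.\<close>

theorem ex_transport:
  assumes p0: "p0 \<in> P" and e: "e \<in> A" "G p0 0 \<in> cdom e" and e': "e' \<in> A" "G p0 1 \<in> cdom e'"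
  obtains N \<Phi> where "p0 \<in> N" "transports N 0 1 e e' \<Phi>"
proof -
  define Q where "Q a b \<longleftrightarrow> (0 \<le> a \<longrightarrow> b \<le> 1 \<longrightarrow>
    (\<forall>e\<in>A. \<forall>e'\<in>A. G p0 a \<in> cdom e \<longrightarrow> G p0 b \<in> cdom e' \<longrightarrow> (\<exists>N \<Phi>. p0 \<in> N \<and> transports N a b e e' \<Phi>)))" for a b
  have "Q 0 1"
  proof (rule Bolzano)
    fix a b c assume Q: "Q a b" "Q b c" and ab: "a \<le> b" "b \<le> c"
    show "Q a c"
      unfolding Q_def
    proof (intro impI ballI)
      fix e e' assume ac: "0 \<le> a" "c \<le> 1" and e: "e \<in> A" "e' \<in> A" "G p0 a \<in> cdom e" "G p0 c \<in> cdom e'"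
      obtain d where d: "d \<in> A" "G p0 b \<in> cdom d" by (rule ex_chart)
      obtain N \<Phi> where N: "p0 \<in> N" "transports N a b e d \<Phi>"
        using Q(1) ac ab e d unfolding Q_def by (meson order_trans)
      obtain N' \<Phi>' where N': "p0 \<in> N'" "transports N' b c d e' \<Phi>'"
        using Q(2) ac ab e d unfolding Q_def by (meson order_trans)
      show "\<exists>N \<Phi>. p0 \<in> N \<and> transports N a c e e' \<Phi>"
        using transports_comp[OF N(2) N'(2) ac(1) ab ac(2) e(1) d(1)] N N' by blast
    qed
  next
    fix x :: real assume "0 \<le> x" "x \<le> 1"
    then show "\<exists>d>0. \<forall>a b. a \<le> x \<and> x \<le> b \<and> b - a < d \<longrightarrow> Q a b"
      unfolding Q_def using local_transport[OF p0, of x] by simp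
  qed simp
  then show ?thesis using that e e' unfolding Q_def by auto
qed

text \<open>Near \<open>t0\<close> the field is the fundamental solution started at
  \<open>t0\<close> from its own value. That solution lives on an open interval, so it also extends
  the field past an end of [0,1].\<close>

lemma solves_smooth:
  assumes p: "p \<in> P" and V: "solves (G p) 0 1 V" and t0: "t0 \<in> {0..1}" and e: "e \<in> A" "G p t0 \<in> cdom e"
  shows "\<exists>U f. open U \<and> t0 \<in> U \<and> smooth_open U f \<and> (\<forall>t\<in>U \<inter> {0..1}. f t = V t e)"
proof -
  obtain h N \<delta> L where B: "p \<in> N" "\<delta> > 0" "flow_box A D P G e h N (t0 - \<delta>) (t0 + \<delta>) L"
    using ex_flow_box[OF p t0 e] .
  interpret flow_box A D P G e h N "t0 - \<delta>" "t0 + \<delta>" L by (rule B(3))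
  have t0I: "t0 \<in> I" using B by auto
  obtain \<Psi> where \<Psi>': "\<forall>u. smooth_open (N \<times> I) (\<lambda>z. \<Psi> z u)" "\<forall>z\<in>N \<times> I. linear (\<Psi> z)"
    "\<forall>p\<in>N. \<forall>u. \<Psi> (p, t0) u = u"
    "\<forall>p\<in>N. \<forall>t\<in>I. \<forall>u. ((\<lambda>t. \<Psi> (p, t) u) has_vector_derivative coeff e h (p, t) (\<Psi> (p, t) u)) (at t)"
    using ex_fundamental[OF t0I] by blast
  note \<Psi> = \<Psi>'(1)[rule_format] \<Psi>'(2)[rule_format] \<Psi>'(3)[rule_format] \<Psi>'(4)[rule_format]
  have "smooth_open I (\<lambda>t. \<Psi> (p, t) (V t0 e))"
    by (rule smooth_open_compose[OF \<Psi>(1) _ _ open_box])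
      (use B in \<open>auto intro!: smooth_open_Pair smooth_open_const smooth_open_ident\<close>)
  moreover have "\<Psi> (p, t) (V t0 e) = V t e" if t: "t \<in> I \<inter> {0..1}" for t
  proof (rule fundamental_unique[OF \<Psi>(4,3) B(1), symmetric])
    show "{min t t0..max t t0} \<subseteq> I" "0 \<le> min t t0" "max t t0 \<le> 1" using t t0 t0I by auto
    show "solves (G p) (min t t0) (max t t0) V"
      using V by (rule solves_subinterval) (use t t0 in auto)
  qed auto
  ultimately show ?thesis using t0I by (intro exI[of _ I] exI) auto
qed

text \<open>Parallel fields are smooth by definition, while \<open>solves\<close> asks only for the
  differential equation; the converse is therefore a regularity statement, supplied by
  \<open>solves_smooth\<close>.\<close>

lemma parallel_along_iff:
  assumes p: "p \<in> P"
  shows "parallel_along A D (G p) V \<longleftrightarrow> solves (G p) 0 1 V"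
proof
  assume L: "parallel_along A D (G p) V"
  show "solves (G p) 0 1 V"
    unfolding solves_def
  proof (intro conjI ballI impI)
    fix t :: real assume t: "t \<in> {0..1}"
    show "V t \<in> tangent_space A (G p t)" using L t by (simp add: parallel_along_def vector_fields_along_def)
    fix e assume e: "e \<in> A" "G p t \<in> cdom e"
    let ?S = "{t \<in> {0..1}. G p t \<in> cdom e}"
    have "smooth_within ?S (\<lambda>t. V t e)"
      using L e by (auto simp: parallel_along_def vector_fields_along_def smooth_map_def std_atlas_def o_def)
    moreover have "t \<in> ?S" using t e by simp
    ultimately obtain U f where U: "open U" "t \<in> U" "smooth_open U f" "\<forall>s\<in>U \<inter> ?S. f s = V s e"
      unfolding smooth_within_def by blast
    obtain \<delta> where \<delta>: "\<delta> > 0" "\<And>s. s \<in> {0..1} \<Longrightarrow> dist s t < \<delta> \<Longrightarrow> G p s \<in> cdom e"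
      using curve_near[OF p t e] by blast
    obtain \<delta>' where \<delta>': "\<delta>' > 0" "ball t \<delta>' \<subseteq> U" using U openE by blast
    have f: "(f has_derivative frechet_derivative f (at t)) (at t)"
      by (rule smooth_open_has_derivative[OF U(3,2)])
    have "frechet_derivative f (at t) = (\<lambda>r. r *\<^sub>R frechet_derivative f (at t) 1)"
    proof
      show "frechet_derivative f (at t) r = r *\<^sub>R frechet_derivative f (at t) 1" for r
        using linear_cmul[OF has_derivative_linear[OF f], of r 1] unfolding real_scaleR_def mult_1_right .
    qed
    then have "(f has_vector_derivative frechet_derivative f (at t) 1) (at t)"
      using f unfolding has_vector_derivative_def by metis
    then have "(f has_vector_derivative frechet_derivative f (at t) 1) (at t within {0..1})"
      by (rule has_vector_derivative_at_within)
    then have "((\<lambda>s. V s e) has_vector_derivative frechet_derivative f (at t) 1) (at t within {0..1})"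
    proof (rule has_vector_derivative_transform_within)
      show "0 < min \<delta> \<delta>'" using \<delta>(1) \<delta>'(1) by simp
      show "f s = V s e" if "s \<in> {0..1}" "dist s t < min \<delta> \<delta>'" for s
      proof -
        have "s \<in> ball t \<delta>'" using that by (simp add: dist_commute)
        moreover have "G p s \<in> cdom e" using \<delta>(2)[OF that(1)] that(2) by simp
        ultimately show ?thesis using U(4) \<delta>'(2) that(1) by blast
      qed
    qed (rule t)
    moreover from this have "vector_derivative (\<lambda>s. V s e) (at t within {0..1}) = frechet_derivative f (at t) 1"
      by (rule vector_derivative_within_closed_interval[OF zero_less_one t])
    moreover have "cov_deriv_along A D (G p) V t e = 0"
      using L t by (simp add: parallel_along_def tzero_def)
    ultimately show "((\<lambda>s. V s e) has_vector_derivative - chr e (G p t) (velocity A (G p) t e) (V t e)) (at t within {0..1})"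
      using e by (simp add: cov_deriv_along_def add_eq_0_iff2)
  qed
next
  assume R: "solves (G p) 0 1 V"
  have sm: "smooth_within {t \<in> {0..1}. G p t \<in> cdom e} (\<lambda>t. V t e)" if e: "e \<in> A" for e
    unfolding smooth_within_def
  proof
    fix t assume t: "t \<in> {t \<in> {0..1}. G p t \<in> cdom e}"
    then obtain U f where "open U" "t \<in> U" "smooth_open U f" "\<forall>t\<in>U \<inter> {0..1}. f t = V t e"
      using solves_smooth[OF p R _ e] by blast
    then show "\<exists>U h. open U \<and> t \<in> U \<and> smooth_open U h \<and> (\<forall>y\<in>U \<inter> {t \<in> {0..1}. G p t \<in> cdom e}. h y = V y e)"
      by blast
  qed
  have "continuous_on S f" if sw: "smooth_within S f" for S :: "real set" and f :: "real \<Rightarrow> 'e"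
    unfolding continuous_on_eq_continuous_within
  proof
    fix x assume x: "x \<in> S"
    obtain U g where U: "open U" "x \<in> U" "smooth_open U g" "\<forall>y\<in>U \<inter> S. g y = f y"
      using sw x unfolding smooth_within_def by blast
    have "continuous_on (U \<inter> S) g"
      by (rule continuous_on_subset[OF smooth_open_continuous_on[OF U(3)]]) simp
    then have "continuous_on (U \<inter> S) f"
      by (rule continuous_on_eq) (use U(4) in blast)
    then have "continuous (at x within U \<inter> S) f"
      using U(2) x by (simp add: continuous_on_eq_continuous_within)
    moreover have "at x within S = at x within U \<inter> S"
      by (rule at_within_nhd[OF U(2,1)]) auto
    ultimately show "continuous (at x within S) f" by simp
  qed
  then have "V \<in> vector_fields_along A (G p)"
    using sm R by (auto simp: vector_fields_along_def smooth_map_def std_atlas_def o_def solves_def)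
  moreover have "cov_deriv_along A D (G p) V t = tzero" if t: "t \<in> {0..1}" for t
  proof
    fix e
    show "cov_deriv_along A D (G p) V t e = tzero e"
    proof (cases "e \<in> A \<and> G p t \<in> cdom e")
      case True
      then have "((\<lambda>s. V s e) has_vector_derivative - chr e (G p t) (velocity A (G p) t e) (V t e)) (at t within {0..1})"
        using R t by (simp add: solves_def)
      then have "vector_derivative (\<lambda>s. V s e) (at t within {0..1}) = - chr e (G p t) (velocity A (G p) t e) (V t e)"
        by (rule vector_derivative_within_closed_interval[OF zero_less_one t])
      then show ?thesis using True by (simp add: cov_deriv_along_def tzero_def)
    qed (auto simp: cov_deriv_along_def tzero_def)
  qed
  ultimately show "parallel_along A D (G p) V" by (simp add: parallel_along_def)
qed

lemma parallel_transport_eq: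
  assumes T: "transports N 0 1 e e' \<Phi>" and p: "p \<in> N" and e: "e \<in> A" "e' \<in> A"
    and v: "v \<in> tangent_space A (G p 0)"
  shows "parallel_transport A D (G p) v = coord_vec A e' (G p 1) (\<Phi> p (v e))"
  unfolding parallel_transport_def
proof (rule the_equality)
  have pP: "p \<in> P" and G: "G p 0 \<in> cdom e" "G p 1 \<in> cdom e'" using T p by (auto simp: transports_def)
  have V1: "V 1 = coord_vec A e' (G p 1) (\<Phi> p (V 0 e))" if V: "solves (G p) 0 1 V" for V
  proof -
    have "V 1 = coord_vec A e' (G p 1) (V 1 e')"
      using V e G by (intro tangent_vec_eq) (auto simp: solves_def)
    also have "V 1 e' = \<Phi> p (V 0 e)" using T p V by (auto simp: transports_def)
    finally show ?thesis .
  qed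
  obtain V where V: "solves (G p) 0 1 V" "V 0 e = v e" using T p unfolding transports_def by blast
  have "V 0 = v"
    by (rule tangent_vec_eqI[of "V 0" "G p 0" v e, OF _ v e(1) G(1) V(2)]) (use V in \<open>auto simp: solves_def\<close>)
  then show "\<exists>V. parallel_along A D (G p) V \<and> V 0 = v \<and> V 1 = coord_vec A e' (G p 1) (\<Phi> p (v e))"
    using V V1[OF V(1)] parallel_along_iff[OF pP] by blast
  show "w = coord_vec A e' (G p 1) (\<Phi> p (v e))" if "\<exists>V. parallel_along A D (G p) V \<and> V 0 = v \<and> V 1 = w" for w
    using that V1 parallel_along_iff[OF pP] by blast
qed

end

section \<open>The first variation of parallel transport at a constant curve\<close>

text \<open>The vanishing factor will be a component of the velocity of a constant curve; the
  derivative of the other factor, made of Christoffel symbols and the solution, then never has to be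
  computed.\<close>

lemma product_derivative_at_zero:
  fixes f :: "'a::real_normed_vector \<Rightarrow> real" and g :: "'a \<Rightarrow> 'b::real_normed_vector"
  assumes "(f has_derivative f') (at x)" "f x = 0" "(g has_derivative g') (at x)"
  shows "((\<lambda>y. f y *\<^sub>R g y) has_derivative (\<lambda>v. f' v *\<^sub>R g x)) (at x)"
  using has_derivative_scaleR[OF assms(1,3)] assms(2) by simp

lemma has_derivative_section:
  assumes "(f has_derivative f') (at (p, t))"
  shows "((\<lambda>p. f (p, t)) has_derivative (\<lambda>q. f' (q, 0))) (at p)"
proof -
  have "((\<lambda>p. (p, t)) has_derivative (\<lambda>q. (q, 0))) (at p)"
    by (auto intro!: derivative_eq_intros)
  from has_derivative_compose[OF this assms] show ?thesis .
qed

context flow_box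
begin

text \<open>Along the constant curve, the derivative of the solution in direction \<open>q\<close>
  plus the Christoffel term of the variation of \<open>h\<close> does not change in time; comparing
  the two ends gives the formula.\<close>

lemma flow_derivative_constant:
  assumes p0: "p0 \<in> N" and G0: "\<And>t. t \<in> {0..1} \<Longrightarrow> G p0 t = m"
    and ab: "a \<le> b" "{a..b} \<subseteq> I" "0 \<le> a" "b \<le> 1"
    and \<Psi>: "\<And>u. smooth_open (N \<times> I) (\<lambda>z. \<Psi> z u)" "\<And>p u. p \<in> N \<Longrightarrow> \<Psi> (p, a) u = u"
    "\<And>p t u. p \<in> N \<Longrightarrow> t \<in> I \<Longrightarrow> ((\<lambda>t. \<Psi> (p, t) u) has_vector_derivative coeff e h (p, t) (\<Psi> (p, t) u)) (at t)"
  shows "frechet_derivative (\<lambda>z. \<Psi> z u) (at (p0, b)) (q, 0) =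
    chr e m (frechet_derivative h (at (p0, a)) (q, 0)) u - chr e m (frechet_derivative h (at (p0, b)) (q, 0)) u"
proof -
  let ?f = "\<lambda>z. \<Psi> z u"
  let ?df = "\<lambda>z. frechet_derivative ?f (at z)" and ?dh = "\<lambda>z. frechet_derivative h (at z)"
  have I01: "t \<in> I \<and> t \<in> {0..1} \<and> (p0, t) \<in> N \<times> I" if "t \<in> {a..b}" for t
    using that ab p0 by auto
  have a: "a \<in> {a..b}" and b: "b \<in> {a..b}" using ab by auto
  have m: "m \<in> cdom e" using G_h[OF p0, of a] I01[OF a] G0[of a] by simp
  have ht0: "?dh (p0, t) (0, 1) = 0" if t: "t \<in> {a..b}" for t
  proof -
    have 1: "velocity A (G p0) t e = ?dh (p0, t) (0, 1)"
      by (rule velocity_eq(2)[OF h(1) open_box]) (use I01[OF t] p0 N e G_h in auto)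
    have "((\<lambda>s. coord e m) has_vector_derivative 0) (at t within {0..1})" by simp
    then have cur: "((coord e \<circ> G p0) has_vector_derivative 0) (at t within {0..1})"
      by (rule has_vector_derivative_transform_within[OF _ zero_less_one]) (use I01[OF t] G0 in auto)
    then have "vector_derivative (coord e \<circ> G p0) (at t within {0..1}) = 0"
      using I01[OF t] vector_derivative_within_closed_interval[OF zero_less_one] by blast
    then show ?thesis using 1 by (simp add: velocity_def split: if_splits)
  qed
  have hm: "param e (h (p0, t)) = m" if t: "t \<in> {a..b}" for t
    using G_h[OF p0, of t] I01[OF t] G0[of t] e m by (metis param_coord)
  have fu: "?f (p0, t) = u" if t: "t \<in> {a..b}" for t
  proof -
    have "solves (G p0) a b (\<lambda>t. coord_vec A e m u)"
      by (rule constant_solves) (use p0 N G0 ab e m in auto)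
    from fundamental_unique[OF \<Psi>(3,2) p0 ab(2-4) a t this] show ?thesis
      by (simp add: coord_vec_same[OF e m])
  qed
  have dfd: "(?f has_derivative ?df z) (at z)" if "z \<in> N \<times> I" for z
    by (rule smooth_open_has_derivative[OF \<Psi>(1) that])
  define ht where "ht z = ?dh z (0, 1)" for z
  have ht: "smooth_open (N \<times> I) ht"
    unfolding ht_def by (rule smooth_open_frechet[OF h(1)])
  \<comment> \<open>This is minus the right-hand side of the equation, expanded so that every
    summand has a component of the velocity \<open>ht\<close> as a factor.\<close>
  define F where "F z = (\<Sum>i\<in>Basis. \<Sum>j\<in>Basis. (ht z \<bullet> i) *\<^sub>R ((?f z \<bullet> j) *\<^sub>R chr e (param e (h z)) i j))" for z
  have dfF: "?df z (0, 1) = - F z" if z: "z \<in> N \<times> I" for z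
  proof -
    obtain p t where pt: "z = (p, t)" "p \<in> N" "t \<in> I" using z by auto
    have "((\<lambda>t. ?f (p, t)) has_vector_derivative ?df (p, t) (0, 1)) (at t)"
      by (rule has_vector_derivative_second[OF \<Psi>(1)]) (use pt in auto)
    from vector_derivative_unique_at[OF this \<Psi>(3)[OF pt(2,3)]]
    have "?df z (0, 1) = coeff e h z (?f z)" by (simp add: pt(1))
    moreover have "param e (h z) \<in> cdom e"
      by (rule param_in_cdom[OF e]) (use h(2) z in blast)
    ultimately show ?thesis
      by (simp only: coeff_def F_def ht_def christoffel_Basis[OF e, of "param e (h z)" "?dh z (0, 1)" "?f z"])
  qed
  have dF: "(F has_derivative (\<lambda>v. chr e m (frechet_derivative ht (at (p0, t)) v) u)) (at (p0, t))" if t: "t \<in> {a..b}" for t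
  proof -
    let ?z = "(p0, t)"
    have z: "?z \<in> N \<times> I" using I01[OF t] by simp
    have 1: "((\<lambda>z. ht z \<bullet> i) has_derivative (\<lambda>v. frechet_derivative ht (at ?z) v \<bullet> i)) (at ?z)" for i
      by (rule bounded_linear.has_derivative[OF bounded_linear_inner_left smooth_open_has_derivative[OF ht z]])
    have 2: "ht ?z \<bullet> i = 0" for i using ht0[OF t] by (simp add: ht_def)
    have g: "smooth_open (N \<times> I) (\<lambda>z. (?f z \<bullet> j) *\<^sub>R chr e (param e (h z)) i j)" for i j
      by (intro smooth_open_scaleR smooth_open_inner smooth_open_const open_box \<Psi>(1)
          smooth_open_compose[OF smooth_open_christoffel[OF e] h(1) open_box open_coord_cdom[OF e] h(2)])
    have "(F has_derivative (\<lambda>v. \<Sum>i\<in>Basis. \<Sum>j\<in>Basis. (frechet_derivative ht (at ?z) v \<bullet> i) *\<^sub>R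
        ((?f ?z \<bullet> j) *\<^sub>R chr e (param e (h ?z)) i j))) (at ?z)"
      unfolding F_def
      by (intro has_derivative_sum product_derivative_at_zero[OF 1 2 smooth_open_has_derivative[OF g z]])
    then show ?thesis
      unfolding fu[OF t] hm[OF t] christoffel_Basis[OF e m, symmetric] .
  qed
  \<comment> \<open>In both summands of K' the mixed derivatives are interchanged. The first becomes
    minus the derivative of \<open>F\<close> in direction \<open>q\<close>, the second the
    Christoffel term of the derivative of the velocity, and these cancel.\<close>
  define K where "K t = ?df (p0, t) (q, 0) + chr e m (?dh (p0, t) (q, 0)) u" for t
  have "(K has_vector_derivative 0) (at t within {a..b})" if t: "t \<in> {a..b}" for t
  proof -
    have z: "(p0, t) \<in> N \<times> I" using I01[OF t] by simp
    have k1: "((\<lambda>t. ?df (p0, t) (q, 0)) has_vector_derivative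
        frechet_derivative (\<lambda>z. ?df z (q, 0)) (at (p0, t)) (0, 1)) (at t)"
      by (rule has_vector_derivative_second[OF smooth_open_frechet[OF \<Psi>(1)] z])
    have "frechet_derivative (\<lambda>z. ?df z (q, 0)) (at (p0, t)) (0, 1) = frechet_derivative (\<lambda>z. ?df z (0, 1)) (at (p0, t)) (q, 0)"
      by (rule second_derivative_symmetric[OF \<Psi>(1) open_box z])
    also have "\<dots> = - chr e m (frechet_derivative ht (at (p0, t)) (q, 0)) u"
    proof -
      have "((\<lambda>z. ?df z (0, 1)) has_derivative (\<lambda>v. - chr e m (frechet_derivative ht (at (p0, t)) v) u)) (at (p0, t))"
        by (rule has_derivative_transform_within_open[OF has_derivative_minus[OF dF[OF t]] open_box z]) (simp add: dfF)
      then show ?thesis using frechet_derivative_at by metis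
    qed
    finally have eq1: "frechet_derivative (\<lambda>z. ?df z (q, 0)) (at (p0, t)) (0, 1) = - chr e m (frechet_derivative ht (at (p0, t)) (q, 0)) u" .
    have "((\<lambda>t. ?dh (p0, t) (q, 0)) has_vector_derivative
        frechet_derivative (\<lambda>z. ?dh z (q, 0)) (at (p0, t)) (0, 1)) (at t)"
      by (rule has_vector_derivative_second[OF smooth_open_frechet[OF h(1)] z])
    moreover have "frechet_derivative (\<lambda>z. ?dh z (q, 0)) (at (p0, t)) (0, 1) = frechet_derivative ht (at (p0, t)) (q, 0)"
      unfolding ht_def by (rule second_derivative_symmetric[OF h(1) open_box z])
    ultimately have "((\<lambda>t. chr e m (?dh (p0, t) (q, 0)) u) has_vector_derivative
        chr e m (frechet_derivative ht (at (p0, t)) (q, 0)) u) (at t)"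
      using bounded_linear.has_vector_derivative[OF linear_conv_bounded_linear[THEN iffD1, OF linear_christoffel_left[OF e m]]] by metis
    from has_vector_derivative_add[OF k1 this] have "(K has_vector_derivative 0) (at t)"
      unfolding K_def eq1 by simp
    then show ?thesis by (rule has_vector_derivative_at_within)
  qed
  then obtain c where "\<And>t. t \<in> {a..b} \<Longrightarrow> K t = c"
    using has_vector_derivative_zero_constant[of "{a..b}" K] by auto
  then have "K a = K b" using a b by metis
  \<comment> \<open>The initial value is \<open>u\<close> for all parameters, so nothing varies at
    the time \<open>a\<close>.\<close>
  moreover have "?df (p0, a) (q, 0) = 0"
  proof -
    have "((\<lambda>p. ?f (p, a)) has_derivative (\<lambda>q. ?df (p0, a) (q, 0))) (at p0)"
      by (rule has_derivative_section[OF dfd]) (use I01[OF a] in simp)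
    then have "((\<lambda>p. u) has_derivative (\<lambda>q. ?df (p0, a) (q, 0))) (at p0)"
      by (rule has_derivative_transform_within_open[OF _ N(1) p0]) (simp add: \<Psi>(2))
    from has_derivative_unique[OF this has_derivative_const] show ?thesis by meson
  qed
  ultimately show ?thesis by (simp add: K_def algebra_simps)
qed

end

context smooth_family
begin

lemma transports_constant:
  assumes T: "transports N a b e e \<Phi>" and p: "p \<in> N" and G: "\<And>t. t \<in> {0..1} \<Longrightarrow> G p t = m"
    and ab: "0 \<le> a" "a \<le> b" "b \<le> 1" and e: "e \<in> A" "m \<in> cdom e"
  shows "\<Phi> p u = u"
proof -
  have "solves (G p) a b (\<lambda>t. coord_vec A e m u)"
    by (rule constant_solves) (use T p G ab e in \<open>auto simp: transports_def\<close>)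
  then have "coord_vec A e m u e = \<Phi> p (coord_vec A e m u e)"
    using T p unfolding transports_def by blast
  then show ?thesis by (simp add: coord_vec_same[OF e])
qed

abbreviation variation :: "('m, 'e) chart \<Rightarrow> 'p \<Rightarrow> real \<Rightarrow> 'p \<Rightarrow> 'e" where
  "variation e p t \<equiv> frechet_derivative (\<lambda>p. coord e (G p t)) (at p)"

text \<open>The formula telescopes over adjacent intervals, so bisection extends it from short
  intervals to [0,1]. All pieces use the chart \<open>e\<close>, as the constant curve never leaves
  it.\<close>

theorem transport_derivative_constant:
  assumes p0: "p0 \<in> P" and G: "\<And>t. t \<in> {0..1} \<Longrightarrow> G p0 t = m" and e: "e \<in> A" "m \<in> cdom e"
  shows "\<exists>N \<Phi>. p0 \<in> N \<and> transports N 0 1 e e \<Phi> \<and>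
    (\<forall>u. ((\<lambda>p. \<Phi> p u) has_derivative
      (\<lambda>q. chr e m (variation e p0 0 q) u - chr e m (variation e p0 1 q) u)) (at p0))"
proof -
  define der where "der \<Phi> a b \<longleftrightarrow> (\<forall>u. ((\<lambda>p. \<Phi> p u) has_derivative
      (\<lambda>q. chr e m (variation e p0 a q) u - chr e m (variation e p0 b q) u)) (at p0))" for \<Phi> :: "'p \<Rightarrow> 'e \<Rightarrow> 'e" and a b
  define Q where "Q a b \<longleftrightarrow> (0 \<le> a \<longrightarrow> b \<le> 1 \<longrightarrow> (\<exists>N \<Phi>. p0 \<in> N \<and> transports N a b e e \<Phi> \<and> der \<Phi> a b))" for a b
  have "Q 0 1"
  proof (rule Bolzano)
    fix a b c assume Q: "Q a b" "Q b c" and ab: "a \<le> b" "b \<le> c"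
    show "Q a c"
      unfolding Q_def
    proof (intro impI)
      assume ac: "0 \<le> a" "c \<le> 1"
      obtain N \<Phi> where N: "p0 \<in> N" "transports N a b e e \<Phi>" "der \<Phi> a b"
        using Q(1) ac ab unfolding Q_def by (meson order_trans)
      obtain N' \<Phi>' where N': "p0 \<in> N'" "transports N' b c e e \<Phi>'" "der \<Phi>' b c"
        using Q(2) ac ab unfolding Q_def by (meson order_trans)
      have T: "transports (N \<inter> N') a c e e (\<lambda>p u. \<Phi>' p (\<Phi> p u))"
        by (rule transports_comp[OF N(2) N'(2) ac(1) ab ac(2) e(1) e(1)])
      have "((\<lambda>p. \<Phi>' p (\<Phi> p u)) has_derivative
          (\<lambda>q. chr e m (variation e p0 a q) u - chr e m (variation e p0 c q) u)) (at p0)" for u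
      proof -
        let ?d = "\<lambda>q u. chr e m (variation e p0 a q) u - chr e m (variation e p0 b q) u"
        let ?d' = "\<lambda>q u. chr e m (variation e p0 b q) u - chr e m (variation e p0 c q) u"
        \<comment> \<open>At \<open>p0\<close> both transports are the identity, so in the product
          rule the two derivatives simply add and the middle terms cancel.\<close>
        have id: "\<Phi> p0 u = u" "\<Phi>' p0 u = u" for u
          using transports_constant[OF N(2,1) G _ _ _ e] transports_constant[OF N'(2,1) G _ _ _ e] ac ab by auto
        have "((\<lambda>p. \<Sum>k\<in>Basis. (\<Phi> p u \<bullet> k) *\<^sub>R \<Phi>' p k) has_derivative
          (\<lambda>q. \<Sum>k\<in>Basis. (\<Phi> p0 u \<bullet> k) *\<^sub>R ?d' q k + (?d q u \<bullet> k) *\<^sub>R \<Phi>' p0 k)) (at p0)"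
          using N(3) N'(3) unfolding der_def
          by (intro has_derivative_sum has_derivative_scaleR bounded_linear.has_derivative[OF bounded_linear_inner_left]) auto
        then have 1: "((\<lambda>p. \<Phi>' p (\<Phi> p u)) has_derivative
          (\<lambda>q. \<Sum>k\<in>Basis. (\<Phi> p0 u \<bullet> k) *\<^sub>R ?d' q k + (?d q u \<bullet> k) *\<^sub>R \<Phi>' p0 k)) (at p0)"
        proof (rule has_derivative_transform_within_open[of _ _ _ _ "N'"])
          show "open N'" using N'(2) by (simp add: transports_def)
          show "(\<Sum>k\<in>Basis. (\<Phi> p u \<bullet> k) *\<^sub>R \<Phi>' p k) = \<Phi>' p (\<Phi> p u)" if "p \<in> N'" for p
            using linear_sum_Basis[of "\<Phi>' p" "\<Phi> p u"] N'(2) that by (simp add: transports_def)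
        qed (rule N'(1))
        have lin: "linear (?d' q)" for q
          by (intro linear_compose_sub linear_christoffel_right e)
        have "(\<Sum>k\<in>Basis. (\<Phi> p0 u \<bullet> k) *\<^sub>R ?d' q k + (?d q u \<bullet> k) *\<^sub>R \<Phi>' p0 k) = ?d' q u + ?d q u" for q
          unfolding id sum.distrib euclidean_representation linear_sum_Basis[OF lin, symmetric] ..
        then have "(\<Sum>k\<in>Basis. (\<Phi> p0 u \<bullet> k) *\<^sub>R ?d' q k + (?d q u \<bullet> k) *\<^sub>R \<Phi>' p0 k)
            = chr e m (variation e p0 a q) u - chr e m (variation e p0 c q) u" for q
          by simp
        then show ?thesis using 1 by simp
      qed
      then have "der (\<lambda>p u. \<Phi>' p (\<Phi> p u)) a c" unfolding der_def by blast
      moreover have "p0 \<in> N \<inter> N'" using N N' by blast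
      ultimately show "\<exists>N \<Phi>. p0 \<in> N \<and> transports N a c e e \<Phi> \<and> der \<Phi> a c"
        using T by (intro exI conjI)
    qed
  next
    fix x :: real assume x: "0 \<le> x" "x \<le> 1"
    have Gx: "G p0 x \<in> cdom e" using G[of x] x e by simp
    have "x \<in> {0..1}" using x by simp
    from ex_flow_box[OF p0 this e(1) Gx]
    obtain h N \<delta> L where B: "p0 \<in> N" "\<delta> > 0" "flow_box A D P G e h N (x - \<delta>) (x + \<delta>) L" .
    interpret flow_box A D P G e h N "x - \<delta>" "x + \<delta>" L by (rule B(3))
    show "\<exists>d>0. \<forall>a b. a \<le> x \<and> x \<le> b \<and> b - a < d \<longrightarrow> Q a b"
    proof (intro exI[of _ \<delta>] conjI allI impI B(2))
      fix a b assume ab0: "a \<le> x \<and> x \<le> b \<and> b - a < \<delta>"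
      show "Q a b"
        unfolding Q_def
      proof (intro impI)
        assume ab1: "0 \<le> a" "b \<le> 1"
        have ab: "a \<le> b" "{a..b} \<subseteq> I" "a \<in> I" "b \<in> I" "a \<in> {0..1}" "b \<in> {0..1}" using ab0 ab1 by auto
        obtain \<Psi> where \<Psi>': "\<forall>u. smooth_open (N \<times> I) (\<lambda>z. \<Psi> z u)" "\<forall>p\<in>N. \<forall>u. \<Psi> (p, a) u = u"
          "\<forall>p\<in>N. \<forall>t\<in>I. \<forall>u. ((\<lambda>t. \<Psi> (p, t) u) has_vector_derivative coeff e h (p, t) (\<Psi> (p, t) u)) (at t)"
          "\<forall>t\<in>{a..b}. transports N a t e e (\<lambda>p. \<Psi> (p, t))"
          using flow_transports[OF ab(1,2) ab1] by blast
        note \<Psi> = \<Psi>'(1)[rule_format] \<Psi>'(2)[rule_format] \<Psi>'(3)[rule_format]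
        have T: "transports N a b e e (\<lambda>p. \<Psi> (p, b))" using \<Psi>'(4) ab by auto
        have var: "variation e p0 t q = frechet_derivative h (at (p0, t)) (q, 0)" if t: "t \<in> I" "t \<in> {0..1}" for t q
        proof -
          have "(h has_derivative frechet_derivative h (at (p0, t))) (at (p0, t))"
            by (rule smooth_open_has_derivative[OF h(1)]) (use B t in auto)
          from has_derivative_section[OF this]
          have "((\<lambda>p. coord e (G p t)) has_derivative (\<lambda>q. frechet_derivative h (at (p0, t)) (q, 0))) (at p0)"
            by (rule has_derivative_transform_within_open[OF _ N(1) B(1)]) (use G_h t in auto)
          then show ?thesis using frechet_derivative_at by metis
        qed
        have "((\<lambda>p. \<Psi> (p, b) u) has_derivative
            (\<lambda>q. chr e m (variation e p0 a q) u - chr e m (variation e p0 b q) u)) (at p0)" for u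
        proof -
          have "((\<lambda>z. \<Psi> z u) has_derivative frechet_derivative (\<lambda>z. \<Psi> z u) (at (p0, b))) (at (p0, b))"
            by (rule smooth_open_has_derivative[OF \<Psi>(1)]) (use B ab in auto)
          note d = has_derivative_section[OF this]
          have "frechet_derivative (\<lambda>z. \<Psi> z u) (at (p0, b)) (q, 0) =
              chr e m (variation e p0 a q) u - chr e m (variation e p0 b q) u" for q
            unfolding var[OF ab(3,5)] var[OF ab(4,6)]
            by (rule flow_derivative_constant[OF B(1) G ab(1,2) ab1 \<Psi>])
          then show ?thesis using d by simp
        qed
        then have "der (\<lambda>p. \<Psi> (p, b)) a b" unfolding der_def by blast
        then show "\<exists>N \<Phi>. p0 \<in> N \<and> transports N a b e e \<Phi> \<and> der \<Phi> a b"
          using T B(1) by (intro exI conjI)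
      qed
    qed
  qed simp
  then show ?thesis unfolding Q_def der_def by simp
qed

end

section \<open>The transport bi-form\<close>

lemma (in connection_manifold) constant_geodesic: "geodesic A D (\<lambda>t. m)"
proof -
  have vel: "velocity A (\<lambda>t. m) t c = 0" if t: "t \<in> {0..1}" for t c
  proof -
    have "((coord c \<circ> (\<lambda>t. m)) has_vector_derivative 0) (at t within {0..1})" by (simp add: o_def)
    from vector_derivative_within_closed_interval[OF zero_less_one t this]
    show ?thesis by (simp add: velocity_def)
  qed
  have "cov_deriv_along A D (\<lambda>t. m) (velocity A (\<lambda>t. m)) t = tzero" if t: "t \<in> {0..1}" for t
  proof
    fix c
    have "((\<lambda>s. 0::'e) has_vector_derivative 0) (at t within {0..1})" by simp
    then have "((\<lambda>s. velocity A (\<lambda>t. m) s c) has_vector_derivative 0) (at t within {0..1})"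
      by (rule has_vector_derivative_transform[OF t, rotated]) (simp add: vel)
    then have "vector_derivative (\<lambda>s. velocity A (\<lambda>t. m) s c) (at t within {0..1}) = 0"
      by (rule vector_derivative_within_closed_interval[OF zero_less_one t])
    then show "cov_deriv_along A D (\<lambda>t. m) (velocity A (\<lambda>t. m)) t c = tzero c"
      using linear_0[OF linear_christoffel_left[of c m 0]]
      by (simp add: cov_deriv_along_def vel[OF t] tzero_def)
  qed
  moreover have "smooth_within S (\<lambda>t. k)" for S :: "real set" and k :: 'e
    unfolding smooth_within_def by (auto intro!: exI[of _ UNIV] exI[of _ "\<lambda>t. k"] smooth_open_const)
  ultimately show ?thesis
    by (simp add: geodesic_def smooth_map_def o_def)
qed

section \<open>Smooth functions on the product manifold\<close>

context manifold
begin

definition prod_chart :: "('m, 'e) chart \<Rightarrow> ('m, 'e) chart \<Rightarrow> ('m \<times> 'm, 'e \<times> 'e) chart" where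
  "prod_chart c d = (cdom c \<times> cdom d, map_prod (coord c) (coord d))"

lemma prod_atlasE:
  assumes "k \<in> prod_atlas A A"
  obtains c d where "c \<in> A" "d \<in> A" "k = prod_chart c d"
  using assms unfolding prod_atlas_def prod_chart_def by blast

lemma inj_on_coord: "c \<in> A \<Longrightarrow> inj_on (coord c) (cdom c)"
  by (metis inj_on_inverseI param_coord)

lemma prod_chart_param:
  assumes c: "c \<in> A" and d: "d \<in> A" and m: "m \<in> cdom c" and n: "n \<in> cdom d"
  shows "param (prod_chart c d) (coord c m, coord d n) = (m, n)"
proof -
  have "inj_on (map_prod (coord c) (coord d)) (cdom c \<times> cdom d)"
    using inj_on_coord[OF c] inj_on_coord[OF d] by (rule map_prod_inj_on)
  from inv_into_f_f[OF this, of "(m, n)"] show ?thesis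
    using m n by (simp add: prod_chart_def)
qed

text \<open>Transport is obtained near each pair of points as a function of their coordinates in two
  arbitrary charts. An extension \<open>F\<close> in these coordinates provides both continuity and
  smoothness.\<close>

lemma smooth_map_prodI:
  fixes f :: "'m \<times> 'm \<Rightarrow> 'f::euclidean_space"
  assumes S: "open S"
    and f: "\<And>m n c d. (m, n) \<in> S \<Longrightarrow> c \<in> A \<Longrightarrow> d \<in> A \<Longrightarrow> m \<in> cdom c \<Longrightarrow> n \<in> cdom d \<Longrightarrow>
      \<exists>N F. open N \<and> (coord c m, coord d n) \<in> N \<and> smooth_open N F \<and>
        (\<forall>m'\<in>cdom c. \<forall>n'\<in>cdom d. (coord c m', coord d n') \<in> N \<longrightarrow> F (coord c m', coord d n') = f (m', n'))"
  shows "smooth_map (prod_atlas A A) std_atlas S f"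
proof -
  have "isCont f z" if z: "z \<in> S" for z
  proof -
    obtain m n where mn: "z = (m, n)" by (cases z)
    obtain c d where c: "c \<in> A" "m \<in> cdom c" and d: "d \<in> A" "n \<in> cdom d"
      using ex_chart[of m] ex_chart[of n] by metis
    obtain N F where N: "open N" "(coord c m, coord d n) \<in> N" "smooth_open N F"
      "\<forall>m'\<in>cdom c. \<forall>n'\<in>cdom d. (coord c m', coord d n') \<in> N \<longrightarrow> F (coord c m', coord d n') = f (m', n')"
      using f[of m n c d] z mn c d by blast
    have cont: "continuous_on (cdom c \<times> cdom d) (\<lambda>z. (coord c (fst z), coord d (snd z)))"
      by (intro continuous_on_Pair continuous_on_compose2[OF continuous_on_coord[OF c(1)]]
          continuous_on_compose2[OF continuous_on_coord[OF d(1)]]) (auto intro!: continuous_intros)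
    define O' where "O' = (cdom c \<times> cdom d) \<inter> (\<lambda>z. (coord c (fst z), coord d (snd z))) -` N"
    have O': "open O'"
      unfolding O'_def by (rule continuous_open_preimage[OF cont _ N(1)]) (intro open_Times open_cdom c d)
    have "continuous_on O' (\<lambda>z. F (coord c (fst z), coord d (snd z)))"
      by (rule continuous_on_compose2[OF smooth_open_continuous_on[OF N(3)] continuous_on_subset[OF cont]])
        (auto simp: O'_def)
    then have "continuous_on O' f"
      by (rule continuous_on_eq) (use N(4) in \<open>auto simp: O'_def\<close>)
    moreover have "z \<in> O'" using mn c d N by (simp add: O'_def)
    ultimately show ?thesis using O' by (simp add: continuous_on_eq_continuous_at)
  qed
  then have "continuous_on S f" by (intro continuous_at_imp_continuous_on) blast
  moreover have "smooth_within (coord k ` (S \<inter> cdom k)) (\<lambda>y. f (param k y))" if k: "k \<in> prod_atlas A A" for k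
    unfolding smooth_within_def
  proof
    obtain c d where c: "c \<in> A" "d \<in> A" "k = prod_chart c d" using k by (rule prod_atlasE)
    fix y assume "y \<in> coord k ` (S \<inter> cdom k)"
    then obtain m n where mn: "(m, n) \<in> S" "m \<in> cdom c" "n \<in> cdom d" "y = (coord c m, coord d n)"
      using c by (auto simp: prod_chart_def)
    obtain N F where N: "open N" "(coord c m, coord d n) \<in> N" "smooth_open N F"
      "\<forall>m'\<in>cdom c. \<forall>n'\<in>cdom d. (coord c m', coord d n') \<in> N \<longrightarrow> F (coord c m', coord d n') = f (m', n')"
      using f[OF mn(1) c(1,2) mn(2,3)] by blast
    have "F y' = f (param k y')" if y': "y' \<in> N \<inter> coord k ` (S \<inter> cdom k)" for y'
    proof -
      obtain m' n' where m': "m' \<in> cdom c" "n' \<in> cdom d" "y' = (coord c m', coord d n')"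
        using y' c by (auto simp: prod_chart_def)
      then show ?thesis using N(4) y' prod_chart_param[OF c(1,2) m'(1,2)] c(3) by auto
    qed
    then show "\<exists>U h. open U \<and> y \<in> U \<and> smooth_open U h \<and>
        (\<forall>y'\<in>U \<inter> coord k ` (S \<inter> cdom k). h y' = f (param k y'))"
      using N mn(4) by (intro exI[of _ N] exI[of _ F]) auto
  qed
  ultimately show ?thesis
    by (simp add: smooth_map_def std_atlas_def o_def)
qed

end

section \<open>Selected geodesics and transport along them\<close>

locale transport_setting = connection_manifold A D + D0: connection_manifold A D0
  for A :: "('m::t2_space, 'e::euclidean_space) chart set" and D D0 :: "('m, 'e) connection" +
  fixes \<C> :: "'m set set"
  assumes cover: "strongly_convex_covering A D0 \<C>"
begin

abbreviation sel where "sel \<equiv> selected_geodesic A D0 \<C>"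

lemma convex_member: "C \<in> \<C> \<Longrightarrow> geodesically_convex A D0 C"
  using cover by (simp add: strongly_convex_covering_def)

lemma ex_member: obtains C where "C \<in> \<C>" "m \<in> C"
proof -
  have "m \<in> \<Union>\<C>" using cover by (simp add: strongly_convex_covering_def)
  then show ?thesis by (auto intro: that)
qed

lemma open_member: "C \<in> \<C> \<Longrightarrow> open C"
  using convex_member by (simp add: geodesically_convex_def)

lemma geodesic_segment_unique:
  "geodesically_convex A D0 C \<Longrightarrow> geodesic_segment A D0 C m n \<gamma> \<Longrightarrow> geodesic_segment A D0 C m n \<gamma>' \<Longrightarrow>
    t \<in> {0..1} \<Longrightarrow> \<gamma> t = \<gamma>' t"
proof -
  assume C: "geodesically_convex A D0 C" and s: "geodesic_segment A D0 C m n \<gamma>" "geodesic_segment A D0 C m n \<gamma>'" "t \<in> {0..1}"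
  then have "m \<in> C" "n \<in> C" unfolding geodesic_segment_def by (auto simp: subset_eq image_iff)
  then show ?thesis using C s unfolding geodesically_convex_def by blast
qed

text \<open>The segments selected by two members of the covering agree, since the intersection of the
  members is convex as well.\<close>

lemma sel_segment:
  assumes C: "C \<in> \<C>" "m \<in> C" "n \<in> C"
  shows "geodesic_segment A D0 C m n (sel m n)"
proof -
  obtain \<gamma> where \<gamma>: "geodesic_segment A D0 C m n \<gamma>"
    using convex_member[OF C(1)] C unfolding geodesically_convex_def by blast
  have "geodesic_segment A D0 C' m n \<gamma>" if C': "C' \<in> \<C>" "m \<in> C'" "n \<in> C'" for C'
  proof -
    have "geodesically_convex A D0 (C' \<inter> C)"
      using cover C C' unfolding strongly_convex_covering_def by blast
    then obtain \<gamma>' where \<gamma>': "geodesic_segment A D0 (C' \<inter> C) m n \<gamma>'"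
      using C C' unfolding geodesically_convex_def by blast
    then have "geodesic_segment A D0 C m n \<gamma>'" by (auto simp: geodesic_segment_def)
    then have "\<gamma> t = \<gamma>' t" if "t \<in> {0..1}" for t
      using geodesic_segment_unique[OF convex_member[OF C(1)] \<gamma> _ that] by blast
    then have "\<gamma> ` {0..1} \<subseteq> C'" using \<gamma>' unfolding geodesic_segment_def by (auto simp: image_subset_iff)
    then show ?thesis using \<gamma> by (simp add: geodesic_segment_def)
  qed
  then have "\<exists>\<gamma>. \<forall>C\<in>\<C>. m \<in> C \<and> n \<in> C \<longrightarrow> geodesic_segment A D0 C m n \<gamma>" by blast
  from someI_ex[OF this] show ?thesis
    using C unfolding selected_geodesic_def by blast
qed

lemma sel_ends:
  assumes "C \<in> \<C>" "m \<in> C" "n \<in> C"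
  shows "sel m n 0 = m" "sel m n 1 = n"
  using sel_segment[OF assms] by (auto simp: geodesic_segment_def)

text \<open>The constant curve is a geodesic segment inside a member of the covering, so uniqueness
  forces the selected one to agree with it on [0,1].\<close>

lemma sel_diagonal: "t \<in> {0..1} \<Longrightarrow> sel m m t = m"
proof -
  assume t: "t \<in> {0..1}"
  obtain C where C: "C \<in> \<C>" "m \<in> C" by (rule ex_member)
  have "geodesic_segment A D0 C m m (\<lambda>t. m)"
    using D0.constant_geodesic C by (auto simp: geodesic_segment_def)
  from geodesic_segment_unique[OF convex_member[OF C(1)] sel_segment[OF C(1,2,2)] this t]
  show ?thesis .
qed

abbreviation params :: "'m set \<Rightarrow> ('m, 'e) chart \<Rightarrow> ('m, 'e) chart \<Rightarrow> ('e \<times> 'e) set" where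
  "params C c d \<equiv> coord c ` (C \<inter> cdom c) \<times> coord d ` (C \<inter> cdom d)"

abbreviation curves :: "('m, 'e) chart \<Rightarrow> ('m, 'e) chart \<Rightarrow> 'e \<times> 'e \<Rightarrow> real \<Rightarrow> 'm" where
  "curves c d p \<equiv> sel (param c (fst p)) (param d (snd p))"

text \<open>Inside one member the selected geodesics are values of its smooth interpolation map,
  whose smoothness on the closed time interval means a local extension \<open>h0\<close>. The domain
  is then shrunk until curves and extension both stay in the chart \<open>e\<close>.\<close>

lemma smooth_family_sel:
  assumes C: "C \<in> \<C>" and c: "c \<in> A" and d: "d \<in> A"
  shows "smooth_family A D (params C c d) (curves c d)"
proof
  show openP: "open (params C c d)"
    by (intro open_Times open_coord_image open_member C c d)
  obtain \<Gamma> where \<Gamma>: "\<And>m n. m \<in> C \<Longrightarrow> n \<in> C \<Longrightarrow> geodesic_segment A D0 C m n (\<lambda>t. \<Gamma> (m, n, t))"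
    and \<Gamma>s: "smooth_map (prod_atlas A (prod_atlas A std_atlas)) A (C \<times> C \<times> {0..1}) \<Gamma>"
    using convex_member[OF C] unfolding geodesically_convex_def by blast
  have sel: "sel m n t = \<Gamma> (m, n, t)" if "m \<in> C" "n \<in> C" "t \<in> {0..1}" for m n t
    using geodesic_segment_unique[OF convex_member[OF C] sel_segment[OF C that(1,2)] \<Gamma>[OF that(1,2)] that(3)] .
  fix p t e assume p: "p \<in> params C c d" and t: "t \<in> {0..1}" and e: "e \<in> A" "curves c d p t \<in> cdom e"
  obtain m n where mn: "p = (coord c m, coord d n)" "m \<in> C" "n \<in> C" "m \<in> cdom c" "n \<in> cdom d"
    using p by auto
  define k where "k = (cdom c \<times> cdom d \<times> (UNIV :: real set), map_prod (coord c) (map_prod (coord d) (\<lambda>x::real. x)))"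
  have "(cdom d \<times> (UNIV :: real set), map_prod (coord d) (\<lambda>x::real. x)) \<in> prod_atlas A std_atlas"
    unfolding prod_atlas_def mem_Collect_eq
    by (intro exI[of _ d] exI[of _ "(UNIV, \<lambda>x. x)"]) (simp add: std_atlas_def d)
  then have k: "k \<in> prod_atlas A (prod_atlas A std_atlas)"
    unfolding k_def prod_atlas_def[of A "prod_atlas A std_atlas"] mem_Collect_eq
    by (intro exI[of _ c] exI[of _ "(cdom d \<times> UNIV, map_prod (coord d) (\<lambda>x. x))"]) (simp add: c)
  have k_param: "param k (coord c m, coord d n, t) = (m, n, t)" if "m \<in> cdom c" "n \<in> cdom d" for m n t
  proof -
    have "inj_on (coord k) (cdom k)"
      unfolding k_def fst_conv snd_conv
      by (intro map_prod_inj_on inj_on_coord c d) (auto simp: inj_on_def)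
    from inv_into_f_f[OF this, of "(m, n, t)"] show ?thesis
      using that by (simp add: k_def)
  qed
  let ?S = "C \<times> C \<times> {0..1::real}"
  let ?K = "coord k ` (?S \<inter> cdom k \<inter> \<Gamma> -` cdom e)"
  have "smooth_within ?K (\<lambda>y. coord e (\<Gamma> (param k y)))"
    using \<Gamma>s k e by (auto simp: smooth_map_def o_def)
  moreover have z0: "(coord c m, coord d n, t) \<in> ?K"
  proof (rule image_eqI)
    show "(coord c m, coord d n, t) = coord k (m, n, t)" by (simp add: k_def)
    show "(m, n, t) \<in> ?S \<inter> cdom k \<inter> \<Gamma> -` cdom e"
      using mn t e sel[OF mn(2,3) t] c d by (simp add: k_def)
  qed
  ultimately obtain U0 h0 where U0: "open U0" "(coord c m, coord d n, t) \<in> U0" "smooth_open U0 h0"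
    "\<forall>y\<in>U0 \<inter> ?K. h0 y = coord e (\<Gamma> (param k y))"
    unfolding smooth_within_def by blast
  \<comment> \<open>The times range over a closed interval, so the preimage of \<open>cdom e\<close>
    is only relatively open; \<open>O1\<close> is an open set that cuts it out.\<close>
  have "continuous_on ?S \<Gamma>" using \<Gamma>s by (simp add: smooth_map_def)
  then obtain O1 where O1: "open O1" "O1 \<inter> ?S = \<Gamma> -` cdom e \<inter> ?S"
    using open_cdom[OF e(1)] unfolding continuous_on_open_invariant by blast
  \<comment> \<open>The interpolation map groups its variables as (m, (n, t)), a family of curves as
    ((m, n), t).\<close>
  define r where "r z = (fst (fst z), snd (fst z), snd z)" for z :: "('e \<times> 'e) \<times> real"
  have r: "bounded_linear r"
    unfolding r_def by (intro bounded_linear_Pair bounded_linear_compose[OF bounded_linear_fst]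
        bounded_linear_compose[OF bounded_linear_snd] bounded_linear_fst bounded_linear_snd)
  have r_cont: "continuous_on S r" for S
    using r by (intro linear_continuous_on)
  define U1 where "U1 = r -` U0"
  have U1: "open U1" unfolding U1_def by (rule open_vimage[OF U0(1) r_cont])
  have h_smooth: "smooth_open U1 (\<lambda>z. h0 (r z))"
    by (rule smooth_open_compose[OF U0(3) smooth_open_linear[OF r U1] U1 U0(1)]) (auto simp: U1_def)
  define U2 where "U2 = (params C c d \<times> UNIV) \<inter> (\<lambda>z. (param c (fst (fst z)), param d (snd (fst z)), snd z)) -` O1"
  have U2: "open U2"
    unfolding U2_def
    by (rule continuous_open_preimage[OF _ open_Times[OF openP open_UNIV] O1(1)])
      (auto intro!: continuous_intros continuous_on_compose2[OF continuous_on_param[OF c]]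
        continuous_on_compose2[OF continuous_on_param[OF d]])
  \<comment> \<open>Nothing controls \<open>h0\<close> at times outside [0,1], so staying in the
    chart is imposed as an open condition.\<close>
  define U where "U = (U1 \<inter> (\<lambda>z. h0 (r z)) -` (coord e ` cdom e)) \<inter> U2"
  have U: "open U"
    unfolding U_def
    by (intro open_Int U2 continuous_open_preimage[OF smooth_open_continuous_on[OF h_smooth] U1 open_coord_cdom[OF e(1)]])
  have key: "curves c d p' t' \<in> cdom e \<and> coord e (curves c d p' t') = h0 (r (p', t'))"
    if p': "(p', t') \<in> U1 \<inter> U2" "p' \<in> params C c d" "t' \<in> {0..1}" for p' t'
  proof -
    obtain m' n' where m': "p' = (coord c m', coord d n')" "m' \<in> C" "n' \<in> C" "m' \<in> cdom c" "n' \<in> cdom d"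
      using p' by auto
    have "(m', n', t') \<in> O1 \<inter> ?S" using p' m' c d by (auto simp: U2_def)
    then have G1: "\<Gamma> (m', n', t') \<in> cdom e" using O1 by blast
    have K: "(coord c m', coord d n', t') \<in> ?K"
    proof (rule image_eqI)
      show "(coord c m', coord d n', t') = coord k (m', n', t')" by (simp add: k_def)
      show "(m', n', t') \<in> ?S \<inter> cdom k \<inter> \<Gamma> -` cdom e" using m' p' G1 by (simp add: k_def)
    qed
    have "r (p', t') = (coord c m', coord d n', t')" by (simp add: r_def m')
    then have "h0 (r (p', t')) = coord e (\<Gamma> (m', n', t'))"
      using U0(4) K p' k_param[OF m'(4,5)] by (auto simp: U1_def)
    moreover have "curves c d p' t' = \<Gamma> (m', n', t')"
      using sel[OF m'(2,3) p'(3)] m' c d by simp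
    ultimately show ?thesis using G1 by simp
  qed
  have p0U: "(p, t) \<in> U1 \<inter> U2"
  proof -
    have "(p, t) \<in> U1" using U0(2) by (simp add: U1_def r_def mn)
    moreover have "(m, n, t) \<in> O1" using O1(2) mn t e sel[OF mn(2,3) t] c d by auto
    ultimately show ?thesis using p mn c d by (simp add: U2_def)
  qed
  show "\<exists>U h. open U \<and> (p, t) \<in> U \<and> smooth_open U h \<and> h ` U \<subseteq> coord e ` cdom e \<and>
        (\<forall>p' t'. (p', t') \<in> U \<longrightarrow> p' \<in> params C c d \<longrightarrow> t' \<in> {0..1} \<longrightarrow>
          curves c d p' t' \<in> cdom e \<and> coord e (curves c d p' t') = h (p', t'))"
  proof (intro exI[of _ U] exI[of _ "\<lambda>z. h0 (r z)"] conjI U allI impI)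
    have "h0 (r (p, t)) \<in> coord e ` cdom e" using key[OF p0U p t] by (metis imageI)
    then show "(p, t) \<in> U" using p0U by (simp add: U_def)
    show "smooth_open U (\<lambda>z. h0 (r z))" by (rule smooth_open_subset[OF h_smooth]) (auto simp: U_def)
    show "(\<lambda>z. h0 (r z)) ` U \<subseteq> coord e ` cdom e" by (auto simp: U_def)
    fix p' t' assume "(p', t') \<in> U" "p' \<in> params C c d" "t' \<in> {0..1}"
    then show "curves c d p' t' \<in> cdom e" "coord e (curves c d p' t') = h0 (r (p', t'))"
      using key[of p' t'] by (auto simp: U_def)
  qed
qed

abbreviation W where "W \<equiv> covering_nbhd \<C>"
abbreviation transp where "transp \<equiv> geodesic_transport A D D0 \<C>"

lemma transp_eq: "transp (m, n) = parallel_transport A D (sel m n)"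
  by (simp add: geodesic_transport_def)

lemma open_W: "open W"
  unfolding covering_nbhd_def by (intro open_UN ballI open_Times open_member)

lemma diagonal_W: "(m, m) \<in> W"
  using ex_member[of m] unfolding covering_nbhd_def by blast

text \<open>The charts \<open>c\<close>, \<open>d\<close> carry the coordinates of the end points
  and \<open>e\<close>, \<open>e'\<close> the components of vectors. They are kept apart because the
  coefficients of a bi-form in one pair of charts are tested for smoothness in every pair.\<close>

lemma transp_local:
  assumes W: "(m, n) \<in> W" and c: "c \<in> A" "m \<in> cdom c" and d: "d \<in> A" "n \<in> cdom d"
    and e: "e \<in> A" "m \<in> cdom e" and e': "e' \<in> A" "n \<in> cdom e'"
  shows "\<exists>N \<Phi>. open N \<and> (coord c m, coord d n) \<in> N \<and> (\<forall>u. smooth_open N (\<lambda>p. \<Phi> p u)) \<and>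
    (\<forall>p\<in>N. linear (\<Phi> p)) \<and>
    (\<forall>m'\<in>cdom c. \<forall>n'\<in>cdom d. (coord c m', coord d n') \<in> N \<longrightarrow> m' \<in> cdom e \<and> n' \<in> cdom e' \<and>
      (\<forall>v\<in>tangent_space A m'. transp (m', n') v = coord_vec A e' n' (\<Phi> (coord c m', coord d n') (v e))))"
proof -
  obtain C where C: "C \<in> \<C>" "m \<in> C" "n \<in> C" using W by (auto simp: covering_nbhd_def)
  interpret smooth_family A D "params C c d" "curves c d"
    by (rule smooth_family_sel[OF C(1) c(1) d(1)])
  let ?p0 = "(coord c m, coord d n)"
  have ends: "curves c d (coord c m', coord d n') 0 = m'" "curves c d (coord c m', coord d n') 1 = n'"
    if "m' \<in> C" "n' \<in> C" "m' \<in> cdom c" "n' \<in> cdom d" for m' n'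
    using sel_ends[OF C(1) that(1,2)] that c d by simp_all
  have p0: "?p0 \<in> params C c d" using C c d by auto
  obtain N \<Phi> where N: "?p0 \<in> N" "transports N 0 1 e e' \<Phi>"
    using ex_transport[OF p0, of e e'] ends[OF C(2,3) c(2) d(2)] e e' by auto
  have "m' \<in> cdom e \<and> n' \<in> cdom e' \<and>
      (\<forall>v\<in>tangent_space A m'. transp (m', n') v = coord_vec A e' n' (\<Phi> (coord c m', coord d n') (v e)))"
    if m': "m' \<in> cdom c" "n' \<in> cdom d" "(coord c m', coord d n') \<in> N" for m' n'
  proof -
    have "(coord c m', coord d n') \<in> params C c d" using N(2) m' by (auto simp: transports_def)
    then have "m' \<in> C" "n' \<in> C"
      using m' inj_on_coord[OF c(1)] inj_on_coord[OF d(1)] by (auto dest: inj_onD)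
    note en = ends[OF this m'(1,2)]
    show ?thesis
      using parallel_transport_eq[OF N(2) m'(3) e(1) e'(1)] N(2) m' en c d
      by (auto simp: transp_eq transports_def)
  qed
  then show ?thesis
    using N unfolding transports_def by (intro exI[of _ N] exI[of _ \<Phi>]) auto
qed

lemma transp_linear:
  assumes W: "(m, n) \<in> W" and e: "e \<in> A" "m \<in> cdom e" and e': "e' \<in> A" "n \<in> cdom e'"
  obtains \<phi> where "linear \<phi>" "\<And>v. v \<in> tangent_space A m \<Longrightarrow> transp (m, n) v = coord_vec A e' n (\<phi> (v e))"
  using transp_local[OF W e e' e e'] e e' by blast

text \<open>Moving the left point varies the start of the constant curve and not its end, so only
  one term of the first variation survives. Vectors at both ends are expressed in \<open>c\<close>,
  although the right point may have its coordinates in another chart.\<close>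

lemma transp_diagonal_local:
  assumes c: "c \<in> A" "m \<in> cdom c" and d: "d \<in> A" "m \<in> cdom d"
  shows "\<exists>N \<Phi>. open N \<and> (coord c m, coord d m) \<in> N \<and> (\<forall>u. \<Phi> (coord c m, coord d m) u = u) \<and> (\<forall>p\<in>N. linear (\<Phi> p)) \<and>
    (\<forall>u. \<exists>\<Phi>'. ((\<lambda>p. \<Phi> p u) has_derivative \<Phi>') (at (coord c m, coord d m)) \<and> (\<forall>z. \<Phi>' (z, 0) = chr c m z u)) \<and>
    (\<forall>m'\<in>cdom c. \<forall>n'\<in>cdom d. (coord c m', coord d n') \<in> N \<longrightarrow> n' \<in> cdom c \<and>
      (\<forall>v\<in>tangent_space A m'. transp (m', n') v = coord_vec A c n' (\<Phi> (coord c m', coord d n') (v c))))"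
proof -
  obtain C where C: "C \<in> \<C>" "m \<in> C" by (rule ex_member)
  interpret smooth_family A D "params C c d" "curves c d"
    by (rule smooth_family_sel[OF C(1) c(1) d(1)])
  let ?p0 = "(coord c m, coord d m)"
  have ends: "curves c d (coord c m', coord d n') 0 = m'" "curves c d (coord c m', coord d n') 1 = n'"
    if "m' \<in> C" "n' \<in> C" "m' \<in> cdom c" "n' \<in> cdom d" for m' n'
    using sel_ends[OF C(1) that(1,2)] that c d by simp_all
  have p0: "?p0 \<in> params C c d" using C c d by auto
  have const: "curves c d ?p0 t = m" if "t \<in> {0..1}" for t
    using sel_diagonal[OF that] c d by simp
  obtain N \<Phi> where N: "?p0 \<in> N" "transports N 0 1 c c \<Phi>"
    and \<Phi>': "\<forall>u. ((\<lambda>p. \<Phi> p u) has_derivative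
      (\<lambda>q. chr c m (variation c ?p0 0 q) u - chr c m (variation c ?p0 1 q) u)) (at ?p0)"
    using transport_derivative_constant[OF p0 const c] by blast
  have var0: "variation c ?p0 0 (z, 0) = z" for z
  proof -
    have "((\<lambda>p::'e \<times> 'e. fst p) has_derivative fst) (at ?p0)" by (auto intro!: derivative_eq_intros)
    then have "((\<lambda>p. coord c (curves c d p 0)) has_derivative fst) (at ?p0)"
      by (rule has_derivative_transform_within_open[OF _ open_P p0]) (use ends in auto)
    from frechet_derivative_at[OF this, symmetric] show ?thesis by simp
  qed
  \<comment> \<open>The end of the curve depends on the second parameter alone, seen in
    \<open>c\<close> through the transition from \<open>d\<close>.\<close>
  have var1: "variation c ?p0 1 (z, 0) = 0" for z
  proof -
    have "((\<lambda>p::'e \<times> 'e. snd p) has_derivative snd) (at ?p0)" by (auto intro!: derivative_eq_intros)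
    moreover have tr: "((coord c \<circ> param d) has_derivative jac d c m) (at (snd ?p0))"
      using transition_has_derivative[OF d(1) c(1) d(2) c(2)] by simp
    ultimately have "((\<lambda>p. (coord c \<circ> param d) (snd p)) has_derivative (\<lambda>q. jac d c m (snd q))) (at ?p0)"
      by (rule has_derivative_compose)
    then have "((\<lambda>p. coord c (curves c d p 1)) has_derivative (\<lambda>q. jac d c m (snd q))) (at ?p0)"
      by (rule has_derivative_transform_within_open[OF _ open_P p0]) (use ends d in auto)
    from frechet_derivative_at[OF this, symmetric] show ?thesis
      using linear_0[OF linear_jac[OF d(1) c(1) d(2) c(2)]] by simp
  qed
  have "\<Phi> ?p0 u = u" for u
    by (rule transports_constant[OF N(2,1) const]) (use c in auto)
  moreover have "\<exists>\<Phi>'. ((\<lambda>p. \<Phi> p u) has_derivative \<Phi>') (at ?p0) \<and> (\<forall>z. \<Phi>' (z, 0) = chr c m z u)" for u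
    using \<Phi>'[rule_format, of u] var0 var1 linear_0[OF linear_christoffel_left[OF c, of u]]
    by (intro exI[of _ "\<lambda>q. chr c m (variation c ?p0 0 q) u - chr c m (variation c ?p0 1 q) u"]) simp
  moreover have "n' \<in> cdom c \<and>
      (\<forall>v\<in>tangent_space A m'. transp (m', n') v = coord_vec A c n' (\<Phi> (coord c m', coord d n') (v c)))"
    if m': "m' \<in> cdom c" "n' \<in> cdom d" "(coord c m', coord d n') \<in> N" for m' n'
  proof -
    have "(coord c m', coord d n') \<in> params C c d" using N(2) m' by (auto simp: transports_def)
    then have "m' \<in> C" "n' \<in> C"
      using m' inj_on_coord[OF c(1)] inj_on_coord[OF d(1)] by (auto dest: inj_onD)
    note en = ends[OF this m'(1,2)]
    show ?thesis
      using parallel_transport_eq[OF N(2) m'(3) c(1) c(1)] N(2) m' en c d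
      by (auto simp: transp_eq transports_def)
  qed
  ultimately show ?thesis
    using N unfolding transports_def by (intro exI[of _ N] exI[of _ \<Phi>]) auto
qed

lemma transp_diagonal:
  assumes "v \<in> tangent_space A m"
  shows "transp (m, m) v = v"
proof -
  obtain c where c: "c \<in> A" "m \<in> cdom c" by (rule ex_chart)
  have "transp (m, m) v = coord_vec A c m (v c)"
    using transp_diagonal_local[OF c c] c assms by metis
  then show ?thesis using tangent_vec_eq[OF assms c] by simp
qed

end

section \<open>The bi-form, its metric and its connection\<close>

locale transport_biform = transport_setting A D D0 \<C>
  for A :: "('m::t2_space, 'e::euclidean_space) chart set" and D D0 :: "('m, 'e) connection"
    and \<C> :: "'m set set" +
  fixes g :: "'m \<Rightarrow> ('m, 'e) tvec \<Rightarrow> ('m, 'e) tvec \<Rightarrow> real"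
  assumes metric: "pseudo_riemannian_metric A g"
begin

abbreviation \<omega> :: "('m, 'e) biform" where
  "\<omega> \<equiv> (\<lambda>(m, n) v w. g n (transp (m, n) v) w)"

lemma metric_add_left: "v \<in> tangent_space A m \<Longrightarrow> v' \<in> tangent_space A m \<Longrightarrow> w \<in> tangent_space A m \<Longrightarrow>
    g m (tadd v v') w = g m v w + g m v' w"
  using metric by (simp add: pseudo_riemannian_metric_def bilinear_form_on_def)

lemma metric_add_right: "v \<in> tangent_space A m \<Longrightarrow> w \<in> tangent_space A m \<Longrightarrow> w' \<in> tangent_space A m \<Longrightarrow>
    g m v (tadd w w') = g m v w + g m v w'"
  using metric by (simp add: pseudo_riemannian_metric_def bilinear_form_on_def)

lemma metric_scale: "v \<in> tangent_space A m \<Longrightarrow> w \<in> tangent_space A m \<Longrightarrow>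
    g m (tscale a v) w = a * g m v w \<and> g m v (tscale a w) = a * g m v w"
  using metric by (simp add: pseudo_riemannian_metric_def bilinear_form_on_def)

lemma metric_nondegenerate:
  "v \<in> tangent_space A m \<Longrightarrow> (\<And>w. w \<in> tangent_space A m \<Longrightarrow> g m v w = 0) \<Longrightarrow> v = tzero"
  using metric unfolding pseudo_riemannian_metric_def by blast

lemma metric_linear_left:
  assumes c: "c \<in> A" "m \<in> cdom c" and w: "w \<in> tangent_space A m"
  shows "linear (\<lambda>u. g m (coord_vec A c m u) w)"
  by (rule linearI)
    (simp_all add: coord_vec_add[OF c] coord_vec_scale[OF c] metric_add_left metric_scale w coord_vec_in_tangent_space[OF c])

lemma metric_linear_right:
  assumes c: "c \<in> A" "m \<in> cdom c" and v: "v \<in> tangent_space A m"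
  shows "linear (\<lambda>u. g m v (coord_vec A c m u))"
  by (rule linearI)
    (simp_all add: coord_vec_add[OF c] coord_vec_scale[OF c] metric_add_right metric_scale v coord_vec_in_tangent_space[OF c])

lemma metric_smooth:
  assumes c: "c \<in> A" "m \<in> cdom c"
  shows "smooth_near (\<lambda>n. g n (coord_vec A c n u) (coord_vec A c n w)) m"
proof -
  have "smooth_map A std_atlas (cdom c) (\<lambda>n. g n (coord_vec A c n u) (coord_vec A c n w))"
    using metric c by (simp add: pseudo_riemannian_metric_def)
  then show ?thesis using smooth_map_iff[OF open_cdom[OF c(1)]] c(2) by blast
qed

lemma metric_field_smooth:
  assumes c: "c \<in> A" "m \<in> cdom c" and Y: "Y \<in> vector_fields A"
  shows "smooth_near (\<lambda>n. g n (coord_vec A c n u) (Y n)) m"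
proof (rule smooth_near_cong[OF _ open_cdom[OF c(1)] c(2)])
  show "smooth_near (\<lambda>n. \<Sum>b\<in>Basis. (Y n c \<bullet> b) *\<^sub>R g n (coord_vec A c n u) (coord_vec A c n b)) m"
    by (intro smooth_near_sum smooth_near_scaleR smooth_near_inner smooth_near_const metric_smooth
        vector_field_smooth[OF Y] c finite_Basis)
  fix n assume n: "n \<in> cdom c"
  have "g n (coord_vec A c n u) (coord_vec A c n (Y n c)) =
      (\<Sum>b\<in>Basis. (Y n c \<bullet> b) *\<^sub>R g n (coord_vec A c n u) (coord_vec A c n b))"
    by (rule linear_sum_Basis[OF metric_linear_right[OF c(1) n coord_vec_in_tangent_space[OF c(1) n]]])
  then show "(\<Sum>b\<in>Basis. (Y n c \<bullet> b) *\<^sub>R g n (coord_vec A c n u) (coord_vec A c n b)) = g n (coord_vec A c n u) (Y n)"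
    using tangent_vec_eq[OF vector_field_tangent[OF Y] c(1) n] by simp
qed

lemma biform_bilinear:
  assumes W: "(m, n) \<in> W"
  shows "bilinear_form_on (tangent_space A m) (tangent_space A n) (\<omega> (m, n))"
proof -
  obtain e where e: "e \<in> A" "m \<in> cdom e" by (rule ex_chart)
  obtain e' where e': "e' \<in> A" "n \<in> cdom e'" by (rule ex_chart)
  obtain \<phi> where \<phi>: "linear \<phi>" "\<And>v. v \<in> tangent_space A m \<Longrightarrow> transp (m, n) v = coord_vec A e' n (\<phi> (v e))"
    using transp_linear[OF W e e'] by metis
  note in_T = coord_vec_in_tangent_space[OF e']
  have comp: "tadd v v' e = v e + v' e" "tscale a v e = a *\<^sub>R v e" for v v' :: "('m, 'e) tvec" and a
    by (simp_all add: tadd_def tscale_def)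
  have add: "transp (m, n) (tadd v v') = tadd (transp (m, n) v) (transp (m, n) v')"
    if "v \<in> tangent_space A m" "v' \<in> tangent_space A m" for v v'
    using that tangent_add[OF that] by (simp add: \<phi>(2) comp linear_add[OF \<phi>(1)] coord_vec_add[OF e'])
  have scale: "transp (m, n) (tscale a v) = tscale a (transp (m, n) v)" if "v \<in> tangent_space A m" for a v
    using that tangent_scale[OF that] by (simp add: \<phi>(2) comp linear_cmul[OF \<phi>(1)] coord_vec_scale[OF e'])
  have T: "transp (m, n) v \<in> tangent_space A n" if "v \<in> tangent_space A m" for v
    using \<phi>(2)[OF that] in_T by simp
  show ?thesis
    unfolding bilinear_form_on_def
    by (simp add: add scale metric_add_left metric_add_right metric_scale T)
qed

text \<open>With the transported vector expanded in \<open>e'\<close>, the coefficient is a finite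
  sum of components of the transport, smooth in both points, times coefficients of \<open>g\<close>,
  smooth in the right point.\<close>

lemma biform_smooth:
  assumes e: "e \<in> A" and e': "e' \<in> A"
  shows "smooth_map (prod_atlas A A) std_atlas (W \<inter> cdom e \<times> cdom e')
    (\<lambda>(m, n). \<omega> (m, n) (coord_vec A e m u) (coord_vec A e' n w))"
proof (rule smooth_map_prodI)
  show "open (W \<inter> cdom e \<times> cdom e')" by (intro open_Int open_W open_Times open_cdom e e')
  fix m n c d assume mn: "(m, n) \<in> W \<inter> cdom e \<times> cdom e'" and c: "c \<in> A" "m \<in> cdom c" and d: "d \<in> A" "n \<in> cdom d"
  then have em: "m \<in> cdom e" "n \<in> cdom e'" "(m, n) \<in> W" by auto
  obtain N \<Phi> where N: "open N" "(coord c m, coord d n) \<in> N" "\<forall>u. smooth_open N (\<lambda>p. \<Phi> p u)" "\<forall>p\<in>N. linear (\<Phi> p)"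
    "\<forall>m'\<in>cdom c. \<forall>n'\<in>cdom d. (coord c m', coord d n') \<in> N \<longrightarrow> m' \<in> cdom e \<and> n' \<in> cdom e' \<and>
      (\<forall>v\<in>tangent_space A m'. transp (m', n') v = coord_vec A e' n' (\<Phi> (coord c m', coord d n') (v e)))"
    using transp_local[OF em(3) c d e em(1) e' em(2)] by blast
  have "\<exists>V. open V \<and> coord d n \<in> V \<and> smooth_open V (\<lambda>y. g (param d y) (coord_vec A e' (param d y) b) (coord_vec A e' (param d y) w))" for b
  proof -
    obtain V where "open V" "coord d n \<in> V" "V \<subseteq> coord d ` cdom d"
      "smooth_open V (\<lambda>y. g (param d y) (coord_vec A e' (param d y) b) (coord_vec A e' (param d y) w))"
      using smooth_nearD[OF metric_smooth[OF e' em(2), of b w] d] .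
    then show ?thesis by blast
  qed
  then have "\<forall>b. \<exists>V. open V \<and> coord d n \<in> V \<and> smooth_open V (\<lambda>y. g (param d y) (coord_vec A e' (param d y) b) (coord_vec A e' (param d y) w))"
    by (rule allI)
  from choice[OF this] obtain V where V0: "\<forall>b. open (V b) \<and> coord d n \<in> V b \<and>
    smooth_open (V b) (\<lambda>y. g (param d y) (coord_vec A e' (param d y) b) (coord_vec A e' (param d y) w))" ..
  have V: "open (V b)" "coord d n \<in> V b"
    "smooth_open (V b) (\<lambda>y. g (param d y) (coord_vec A e' (param d y) b) (coord_vec A e' (param d y) w))" for b
    using V0[rule_format, of b] by simp_all
  define V' where "V' = (\<Inter>b\<in>(Basis::'e set). V b)"
  have V': "open V'" "coord d n \<in> V'" "b \<in> Basis \<Longrightarrow> V' \<subseteq> V b" for b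
    using V by (auto simp: V'_def)
  define M where "M = N \<inter> snd -` V'"
  have M: "open M"
    unfolding M_def by (intro open_Int N open_vimage V' continuous_on_snd continuous_on_id)
  have snd_smooth: "smooth_open M snd" by (rule smooth_open_linear[OF bounded_linear_snd M])
  define F where "F p = (\<Sum>b\<in>Basis. (\<Phi> p u \<bullet> b) *\<^sub>R
    g (param d (snd p)) (coord_vec A e' (param d (snd p)) b) (coord_vec A e' (param d (snd p)) w))" for p
  have "smooth_open M (\<lambda>p. g (param d (snd p)) (coord_vec A e' (param d (snd p)) b) (coord_vec A e' (param d (snd p)) w))"
    if b: "b \<in> Basis" for b
    by (rule smooth_open_compose[OF V(3)[of b] snd_smooth M V(1)]) (use V'(3)[OF b] in \<open>auto simp: M_def\<close>)
  moreover have "smooth_open M (\<lambda>p. \<Phi> p u)" using N(3) smooth_open_subset[of N _ M] by (auto simp: M_def)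
  ultimately have "smooth_open M F"
    unfolding F_def by (intro smooth_open_sum smooth_open_scaleR smooth_open_inner smooth_open_const M finite_Basis)
  moreover have "F (coord c m', coord d n') = \<omega> (m', n') (coord_vec A e m' u) (coord_vec A e' n' w)"
    if m': "m' \<in> cdom c" "n' \<in> cdom d" "(coord c m', coord d n') \<in> M" for m' n'
  proof -
    let ?p = "(coord c m', coord d n')"
    have en: "m' \<in> cdom e" "n' \<in> cdom e'"
      and tr: "\<And>v. v \<in> tangent_space A m' \<Longrightarrow> transp (m', n') v = coord_vec A e' n' (\<Phi> ?p (v e))"
      using N(5) m' by (auto simp: M_def)
    have "\<omega> (m', n') (coord_vec A e m' u) (coord_vec A e' n' w) = g n' (coord_vec A e' n' (\<Phi> ?p u)) (coord_vec A e' n' w)"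
      using tr[OF coord_vec_in_tangent_space[OF e en(1)]] coord_vec_same[OF e en(1)] by simp
    also have "\<dots> = (\<Sum>b\<in>Basis. (\<Phi> ?p u \<bullet> b) *\<^sub>R g n' (coord_vec A e' n' b) (coord_vec A e' n' w))"
      by (rule linear_sum_Basis[OF metric_linear_left[OF e' en(2) coord_vec_in_tangent_space[OF e' en(2)]]])
    finally show ?thesis using m' d by (simp add: F_def)
  qed
  moreover have "(coord c m, coord d n) \<in> M" using N(2) V'(2) by (simp add: M_def)
  ultimately show "\<exists>N F. open N \<and> (coord c m, coord d n) \<in> N \<and> smooth_open N F \<and>
      (\<forall>m'\<in>cdom c. \<forall>n'\<in>cdom d. (coord c m', coord d n') \<in> N \<longrightarrow> F (coord c m', coord d n') =
        (case (m', n') of (m, n) \<Rightarrow> \<omega> (m, n) (coord_vec A e m u) (coord_vec A e' n w)))"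
    using M by (intro exI[of _ M] exI[of _ F]) simp
qed

lemma local_biform_transport: "local_biform A W \<omega>"
  unfolding local_biform_def using open_W diagonal_W biform_bilinear biform_smooth by blast

lemma induced_metric_transport:
  "v \<in> tangent_space A m \<Longrightarrow> induced_metric \<omega> m v w = g m v w"
  by (simp add: induced_metric_def transp_diagonal)

text \<open>Agreement with \<open>g\<close> is known on tangent vectors only, so the axioms are
  transferred under that restriction; coordinate vectors, used for smoothness, are tangent.\<close>

lemma metric_induced_metric: "pseudo_riemannian_metric A (induced_metric \<omega>)"
proof -
  have "bilinear_form_on (tangent_space A m) (tangent_space A m) (induced_metric \<omega> m)" for m
    unfolding bilinear_form_on_def
    by (simp add: induced_metric_transport tangent_add tangent_scale metric_add_left metric_add_right metric_scale)
  moreover have "smooth_map A std_atlas (cdom c) (\<lambda>m. induced_metric \<omega> m (coord_vec A c m u) (coord_vec A c m w))"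
    if c: "c \<in> A" for c u w
    unfolding smooth_map_iff[OF open_cdom[OF c]]
  proof
    fix m assume m: "m \<in> cdom c"
    show "smooth_near (\<lambda>m. induced_metric \<omega> m (coord_vec A c m u) (coord_vec A c m w)) m"
      by (rule smooth_near_cong[OF metric_smooth[OF c m] open_cdom[OF c] m])
        (simp add: induced_metric_transport coord_vec_in_tangent_space[OF c])
  qed
  ultimately show ?thesis
    using metric unfolding pseudo_riemannian_metric_def by (simp add: induced_metric_transport)
qed

text \<open>In a product chart the function is a sum of components of the transported
  \<open>X\<close> times factors \<open>\<beta>\<close> of the right point alone. The left lift
  leaves these factors fixed, and the components have as derivative that of \<open>X\<close> plus
  the Christoffel term, which is the chart formula for \<open>D Z X\<close>.\<close>

lemma lie_deriv_transport:
  assumes X: "X \<in> vector_fields A" and Y: "Y \<in> vector_fields A" and Z: "Z \<in> vector_fields A"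
  shows "lie_deriv (prod_atlas A A) (left_lift A Z) (biform_apply \<omega> X Y) (m, m) = g m (D Z X m) (Y m)"
proof -
  \<comment> \<open>This is the chart chosen inside \<open>lie_deriv\<close>; its two factors need
    not coincide.\<close>
  define k where "k = (SOME k. k \<in> prod_atlas A A \<and> (m, m) \<in> cdom k)"
  obtain c0 where "c0 \<in> A" "m \<in> cdom c0" by (rule ex_chart)
  then have "prod_chart c0 c0 \<in> prod_atlas A A" "(m, m) \<in> cdom (prod_chart c0 c0)"
    unfolding prod_chart_def prod_atlas_def by (blast, simp)
  then have k: "k \<in> prod_atlas A A" "(m, m) \<in> cdom k"
    unfolding k_def by (metis (mono_tags, lifting) someI_ex)+
  obtain c d where cd: "c \<in> A" "d \<in> A" "k = prod_chart c d" using k(1) by (rule prod_atlasE)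
  then have c: "c \<in> A" "m \<in> cdom c" and d: "d \<in> A" "m \<in> cdom d" using k(2) by (auto simp: prod_chart_def)
  let ?p0 = "(coord c m, coord d m)"
  have coord_k: "coord k (m, m) = ?p0" by (simp add: cd prod_chart_def)
  \<comment> \<open>The left factor is recovered from the product domain by projection, which works
    because the right factor contains \<open>m\<close>.\<close>
  have "fst ` cdom k = cdom c" using d(2) by (force simp: cd prod_chart_def)
  then have lift: "left_lift A Z (m, m) k = (Z m c, 0)"
    using k by (simp add: left_lift_def tangent_pair_def tzero_def) (simp add: cd prod_chart_def)
  obtain N \<Phi> where N: "open N" "?p0 \<in> N" "\<forall>u. \<Phi> ?p0 u = u" "\<forall>p\<in>N. linear (\<Phi> p)"
    "\<forall>u. \<exists>\<Phi>'. ((\<lambda>p. \<Phi> p u) has_derivative \<Phi>') (at ?p0) \<and> (\<forall>z. \<Phi>' (z, 0) = chr c m z u)"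
    "\<forall>m'\<in>cdom c. \<forall>n'\<in>cdom d. (coord c m', coord d n') \<in> N \<longrightarrow> n' \<in> cdom c \<and>
      (\<forall>v\<in>tangent_space A m'. transp (m', n') v = coord_vec A c n' (\<Phi> (coord c m', coord d n') (v c)))"
    using transp_diagonal_local[OF c d] by blast
  obtain \<Phi>' where \<Phi>': "\<And>u. ((\<lambda>p. \<Phi> p u) has_derivative \<Phi>' u) (at ?p0)" "\<And>u z. \<Phi>' u (z, 0) = chr c m z u"
    using N(5) by metis
  define \<beta> where "\<beta> b y = g (param d y) (coord_vec A c (param d y) b) (Y (param d y))" for b y
  have "\<exists>\<beta>'. (\<beta> b has_derivative \<beta>') (at (coord d m))" for b
  proof -
    obtain V where "open V" "coord d m \<in> V" "V \<subseteq> coord d ` cdom d" "smooth_open V (\<lambda>y. \<beta> b y)"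
      using smooth_nearD[OF metric_field_smooth[OF c Y, of b] d] unfolding \<beta>_def .
    then show ?thesis using smooth_open_has_derivative by blast
  qed
  then obtain \<beta>' where \<beta>': "\<And>b. (\<beta> b has_derivative \<beta>' b) (at (coord d m))" by metis
  let ?x = "\<lambda>y. X (param c y) c"
  let ?dx = "frechet_derivative ?x (at (coord c m))"
  have dx: "(?x has_derivative ?dx) (at (fst ?p0))"
    using vector_field_has_derivative[OF c X c] by simp
  have dfst: "((\<lambda>p. ?x (fst p)) has_derivative (\<lambda>q. ?dx (fst q))) (at ?p0)"
  proof (rule has_derivative_compose[of fst fst])
    show "(fst has_derivative fst) (at ?p0)" by (auto intro!: derivative_eq_intros)
  qed (rule dx)
  have dsnd: "((\<lambda>p. \<beta> b (snd p)) has_derivative (\<lambda>q. \<beta>' b (snd q))) (at ?p0)" for b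
  proof (rule has_derivative_compose[of snd snd])
    show "(snd has_derivative snd) (at ?p0)" by (auto intro!: derivative_eq_intros)
    show "(\<beta> b has_derivative \<beta>' b) (at (snd ?p0))" using \<beta>' by simp
  qed
  \<comment> \<open>Expansion over the basis separates the moving components of \<open>X\<close>
    from the transport in fixed directions, whose derivatives are known.\<close>
  define \<xi> where "\<xi> p = (\<Sum>j\<in>Basis. (?x (fst p) \<bullet> j) *\<^sub>R \<Phi> p j)" for p
  define \<xi>' where "\<xi>' q = (\<Sum>j\<in>Basis. (?x (fst ?p0) \<bullet> j) *\<^sub>R \<Phi>' j q + (?dx (fst q) \<bullet> j) *\<^sub>R \<Phi> ?p0 j)" for q
  have d\<xi>: "(\<xi> has_derivative \<xi>') (at ?p0)"
    unfolding \<xi>_def \<xi>'_def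
    by (intro has_derivative_sum has_derivative_scaleR bounded_linear.has_derivative[OF bounded_linear_inner_left] dfst \<Phi>'(1))
  define F where "F p = (\<Sum>b\<in>Basis. (\<xi> p \<bullet> b) *\<^sub>R \<beta> b (snd p))" for p
  have dF: "(F has_derivative (\<lambda>q. \<Sum>b\<in>Basis. (\<xi> ?p0 \<bullet> b) *\<^sub>R \<beta>' b (snd q) + (\<xi>' q \<bullet> b) *\<^sub>R \<beta> b (snd ?p0))) (at ?p0)"
    unfolding F_def
    by (intro has_derivative_sum has_derivative_scaleR bounded_linear.has_derivative[OF bounded_linear_inner_left] dsnd d\<xi>)
  define M where "M = N \<inter> (coord c ` cdom c \<times> coord d ` cdom d)"
  have M: "open M" "?p0 \<in> M"
    unfolding M_def using N c d by (auto intro!: open_Int open_Times open_coord_cdom)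
  have FM: "F p = (biform_apply \<omega> X Y \<circ> param k) p" if p: "p \<in> M" for p
  proof -
    obtain m' n' where m': "p = (coord c m', coord d n')" "m' \<in> cdom c" "n' \<in> cdom d" "p \<in> N"
      using p by (auto simp: M_def)
    have n': "n' \<in> cdom c"
      and tr: "transp (m', n') (X m') = coord_vec A c n' (\<Phi> p (X m' c))"
      using N(6) m' vector_field_tangent[OF X] by auto
    have "\<xi> p = \<Phi> p (X m' c)"
      using linear_sum_Basis[of "\<Phi> p" "X m' c"] N(4) m' c by (simp add: \<xi>_def)
    moreover have "g n' (coord_vec A c n' u) (Y n') = (\<Sum>b\<in>Basis. (u \<bullet> b) *\<^sub>R \<beta> b (coord d n'))" for u
      using linear_sum_Basis[OF metric_linear_left[OF c(1) n' vector_field_tangent[OF Y]], of u] m' d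
      by (simp add: \<beta>_def)
    moreover have "param k p = (m', n')"
      using prod_chart_param[OF c(1) d(1) m'(2,3)] m'(1) cd(3) by simp
    ultimately show ?thesis
      by (simp add: F_def biform_apply_def tr m'(1))
  qed
  have "((biform_apply \<omega> X Y \<circ> param k) has_derivative
      (\<lambda>q. \<Sum>b\<in>Basis. (\<xi> ?p0 \<bullet> b) *\<^sub>R \<beta>' b (snd q) + (\<xi>' q \<bullet> b) *\<^sub>R \<beta> b (snd ?p0))) (at ?p0)"
    by (rule has_derivative_transform_within_open[OF dF M FM])
  from frechet_derivative_at[OF this, symmetric]
  have "lie_deriv (prod_atlas A A) (left_lift A Z) (biform_apply \<omega> X Y) (m, m) =
      (\<Sum>b\<in>Basis. (\<xi> ?p0 \<bullet> b) *\<^sub>R \<beta>' b (snd (Z m c, 0::'e)) + (\<xi>' (Z m c, 0) \<bullet> b) *\<^sub>R \<beta> b (snd ?p0))"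
    unfolding lie_deriv_def k_def[symmetric] Let_def coord_k lift by (rule fun_cong)
  also have "\<dots> = (\<Sum>b\<in>Basis. (\<xi>' (Z m c, 0) \<bullet> b) *\<^sub>R \<beta> b (coord d m))"
    using linear_0[OF has_derivative_linear[OF \<beta>']] by simp
  also have "\<dots> = g m (coord_vec A c m (\<xi>' (Z m c, 0))) (Y m)"
    using linear_sum_Basis[OF metric_linear_left[OF c vector_field_tangent[OF Y]], of "\<xi>' (Z m c, 0)"] d
    by (simp add: \<beta>_def)
  also have "\<xi>' (Z m c, 0) = D Z X m c"
  proof -
    have "\<xi>' (Z m c, 0) = (\<Sum>j\<in>Basis. (X m c \<bullet> j) *\<^sub>R chr c m (Z m c) j) + (\<Sum>j\<in>Basis. (?dx (Z m c) \<bullet> j) *\<^sub>R j)"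
      using N(3) c by (simp add: \<xi>'_def \<Phi>'(2) sum.distrib)
    also have "(\<Sum>j\<in>Basis. (X m c \<bullet> j) *\<^sub>R chr c m (Z m c) j) = chr c m (Z m c) (X m c)"
      by (rule linear_sum_Basis[OF linear_christoffel_right[OF c], symmetric])
    also have "(\<Sum>j\<in>Basis. (?dx (Z m c) \<bullet> j) *\<^sub>R j) = ?dx (Z m c)"
      by (rule euclidean_representation)
    finally show ?thesis using conn_chart[OF c Z X] by (simp add: add.commute)
  qed
  also have "coord_vec A c m (D Z X m c) = D Z X m"
    by (rule tangent_vec_eq[OF vector_field_tangent[OF conn_field[OF Z X]] c, symmetric])
  finally show ?thesis .
qed

text \<open>Every tangent vector is the value of a global field, so the defining equation prescribes
  all products with the unknown vector, and nondegeneracy of \<open>g\<close> leaves only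
  \<open>D Z X m\<close>.\<close>

lemma induced_connection_transport:
  assumes X: "X \<in> vector_fields A" and Z: "Z \<in> vector_fields A"
  shows "induced_connection A \<omega> Z X = D Z X"
proof
  fix m
  let ?w = "D Z X m"
  have w: "?w \<in> tangent_space A m" by (rule vector_field_tangent[OF conn_field[OF Z X]])
  show "induced_connection A \<omega> Z X m = ?w"
    unfolding induced_connection_def
  proof (rule the_equality)
    show "?w \<in> tangent_space A m \<and> (\<forall>Y\<in>vector_fields A. induced_metric \<omega> m ?w (Y m) =
        lie_deriv (prod_atlas A A) (left_lift A Z) (biform_apply \<omega> X Y) (m, m))"
      using w lie_deriv_transport[OF X _ Z] induced_metric_transport[OF w] by simp
    fix v assume v: "v \<in> tangent_space A m \<and> (\<forall>Y\<in>vector_fields A. induced_metric \<omega> m v (Y m) =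
        lie_deriv (prod_atlas A A) (left_lift A Z) (biform_apply \<omega> X Y) (m, m))"
    let ?d = "tadd v (tscale (-1) ?w)"
    have T: "tscale (-1) ?w \<in> tangent_space A m" "?d \<in> tangent_space A m"
      using v w by (auto intro: tangent_add tangent_scale)
    have "?d = tzero"
    proof (rule metric_nondegenerate[OF T(2)])
      fix y assume y: "y \<in> tangent_space A m"
      obtain Y where Y: "Y \<in> vector_fields A" "Y m = y" using ex_vector_field_through[OF y] .
      have "g m v y = g m ?w y"
        using v Y lie_deriv_transport[OF X Y(1) Z] induced_metric_transport[of v m] by auto
      then show "g m ?d y = 0"
        using v w T y by (simp add: metric_add_left metric_scale)
    qed
    then show "v = ?w" by (simp add: tadd_def tscale_def tzero_def fun_eq_iff)
  qed
qed

end

theorem proposition2p6: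
  fixes A :: "('m::{t2_space, second_countable_topology}, 'e::euclidean_space) chart set"
    and g :: "'m \<Rightarrow> ('m, 'e) tvec \<Rightarrow> ('m, 'e) tvec \<Rightarrow> real"
    and D D0 :: "('m, 'e) connection"
    and \<C> :: "'m set set"
  assumes "lauritzen_manifold A g D"
    and "affine_connection A D0"
    and "strongly_convex_covering A D0 \<C>"
  shows "integrating_biform A g D (covering_nbhd \<C>)
    (\<lambda>(m, n) v w. g n (geodesic_transport A D D0 \<C> (m, n) v) w)"
proof -
  interpret transport_biform A D D0 \<C> g
    by unfold_locales (use assms in \<open>auto simp: lauritzen_manifold_def\<close>)
  show ?thesis
    unfolding integrating_biform_def contrast_biform_def
    using local_biform_transport metric_induced_metric induced_metric_transport induced_connection_transport
    by blast
qed

end
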